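(* Let $E=\{0,1,\dots,n\}$ and let $M$ be a loopless matroid of rank $r+1$ on $E$. Let $c_1,\dots,c_n$ be nonnegative integers with $c_1+\dots+c_n=r-2$, and let $1\le i,j\le n$. Then \[\deg_M(\gamma_1^{c_1}\cdots\gamma_n^{c_n}\gamma_i^2)\,\deg_M(\gamma_1^{c_1}\cdots\gamma_n^{c_n}\gamma_j^2)\le \deg_M(\gamma_1^{c_1}\cdots\gamma_n^{c_n}\gamma_i\gamma_j)^2.\]
   Context: The Chow ring $A^*(M)$ (real coefficients) is $\mathbb{R}[x_F : F \text{ a nonempty proper flat of } M]$ modulo the ideal generated by all $x_{F_1}x_{F_2}$ with $F_1,F_2$ incomparable and all $\sum_{F\ni i}x_F-\sum_{F\ni j}x_F$ for $i,j\in E$. It is graded, and $\deg_M:A^r(M)\to\mathbb{R}$ is the linear map with $\deg_M(x_{F_1}\cdots x_{F_r})=1$ for every complete flag of flats $\varnothing\subsetneq F_1\subsetneq\cdots\subsetneq F_r\subsetneq E$. For $S\subseteq E$, $x_S$ means the generator if $S$ is a nonempty proper flat and $0$ otherwise. For $1\le k\le n$ the hypersimplex class is $\gamma_k=\sum_{S}\left(\min(|S|,k)-\frac{k}{n+1}|S|\right)x_S\in A^1(M)$, the sum over nonempty proper subsets $S\subsetneq E$. *)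

theory Defs
  imports Complex_Main "HOL-Library.Poly_Mapping" "HOL-Algebra.QuotRing"
begin

record 'a matroid =
  ground :: "'a set"
  indeps :: "'a set set"

definition is_matroid :: "'a matroid \<Rightarrow> bool" where
  "is_matroid M \<longleftrightarrow>
     finite (ground M) \<and>
     indeps M \<subseteq> Pow (ground M) \<and>
     {} \<in> indeps M \<and>
     (\<forall>I\<in>indeps M. \<forall>J. J \<subseteq> I \<longrightarrow> J \<in> indeps M) \<and>
     (\<forall>I\<in>indeps M. \<forall>J\<in>indeps M. card I < card J \<longrightarrow> (\<exists>e\<in>J - I. insert e I \<in> indeps M))"

definition loopless :: "'a matroid \<Rightarrow> bool" where
  "loopless M \<longleftrightarrow> (\<forall>e\<in>ground M. {e} \<in> indeps M)"

definition rank_of :: "'a matroid \<Rightarrow> 'a set \<Rightarrow> nat" where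
  "rank_of M S = Max (card ` {I \<in> indeps M. I \<subseteq> S})"

abbreviation rank :: "'a matroid \<Rightarrow> nat" where
  "rank M \<equiv> rank_of M (ground M)"

definition is_flat :: "'a matroid \<Rightarrow> 'a set \<Rightarrow> bool" where
  "is_flat M F \<longleftrightarrow> F \<subseteq> ground M \<and> (\<forall>e\<in>ground M - F. rank_of M F < rank_of M (insert e F))"

definition proper_flats :: "'a matroid \<Rightarrow> 'a set set" where
  "proper_flats M = {F. is_flat M F \<and> F \<noteq> {} \<and> F \<noteq> ground M}"

text \<open>
  Real polynomials in variables indexed by subsets of the ground set; a monomial is a
  finitely supported exponent function.
\<close>

type_synonym 'a set_poly = "('a set \<Rightarrow>\<^sub>0 nat) \<Rightarrow>\<^sub>0 real"

definition const :: "real \<Rightarrow> 'a set_poly" where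
  "const a = Poly_Mapping.single 0 a"

definition var :: "'a set \<Rightarrow> 'a set_poly" where
  "var F = Poly_Mapping.single (Poly_Mapping.single F 1) 1"

definition total_degree :: "('a set \<Rightarrow>\<^sub>0 nat) \<Rightarrow> nat" where
  "total_degree m = (\<Sum>F\<in>Poly_Mapping.keys m. Poly_Mapping.lookup m F)"

definition flat_poly_ring :: "'a matroid \<Rightarrow> 'a set_poly ring" where
  "flat_poly_ring M =
     \<lparr>carrier = {p. \<forall>m\<in>Poly_Mapping.keys p. Poly_Mapping.keys m \<subseteq> proper_flats M},
      monoid.mult = (*), one = 1, ring.zero = 0, add = (+)\<rparr>"

definition chow_ideal :: "'a matroid \<Rightarrow> 'a set_poly set" where
  "chow_ideal M = Idl\<^bsub>flat_poly_ring M\<^esub>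
     ({var F * var G | F G. F \<in> proper_flats M \<and> G \<in> proper_flats M \<and> \<not> F \<subseteq> G \<and> \<not> G \<subseteq> F} \<union>
      {(\<Sum>F | F \<in> proper_flats M \<and> i \<in> F. var F) - (\<Sum>F | F \<in> proper_flats M \<and> j \<in> F. var F) | i j.
         i \<in> ground M \<and> j \<in> ground M})"

definition chow_ring :: "'a matroid \<Rightarrow> 'a set_poly set ring" where
  "chow_ring M = flat_poly_ring M Quot chow_ideal M"

definition chow_class :: "'a matroid \<Rightarrow> 'a set_poly \<Rightarrow> 'a set_poly set" where
  "chow_class M p = chow_ideal M +>\<^bsub>flat_poly_ring M\<^esub> p"

definition chow_graded :: "'a matroid \<Rightarrow> nat \<Rightarrow> 'a set_poly set set" where
  "chow_graded M d =
     chow_class M ` {p \<in> carrier (flat_poly_ring M). \<forall>m\<in>Poly_Mapping.keys p. total_degree m = d}"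

definition is_complete_flag :: "'a matroid \<Rightarrow> 'a set list \<Rightarrow> bool" where
  "is_complete_flag M Fs \<longleftrightarrow>
     length Fs = rank M - 1 \<and> set Fs \<subseteq> proper_flats M \<and> sorted_wrt (\<subset>) Fs"

text \<open>
  Scalar multiplication by a real number in the quotient ring is multiplication by the class
  of the corresponding constant polynomial. The degree map is made \<^const>\<open>undefined\<close> outside
  the top graded piece, so that the conditions determine it as a function on the whole type.
\<close>

definition is_degree_map :: "'a matroid \<Rightarrow> ('a set_poly set \<Rightarrow> real) \<Rightarrow> bool" where
  "is_degree_map M d \<longleftrightarrow>
     d \<in> extensional (chow_graded M (rank M - 1)) \<and>
     (\<forall>a\<in>chow_graded M (rank M - 1). \<forall>b\<in>chow_graded M (rank M - 1).
        d (a \<oplus>\<^bsub>chow_ring M\<^esub> b) = d a + d b) \<and>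
     (\<forall>t. \<forall>a\<in>chow_graded M (rank M - 1).
        d (chow_class M (const t) \<otimes>\<^bsub>chow_ring M\<^esub> a) = t * d a) \<and>
     (\<forall>Fs. is_complete_flag M Fs \<longrightarrow> d (chow_class M (prod_list (map var Fs))) = 1)"

definition chow_degree :: "'a matroid \<Rightarrow> 'a set_poly set \<Rightarrow> real" where
  "chow_degree M = (THE d. is_degree_map M d)"

definition flat_var :: "'a matroid \<Rightarrow> 'a set \<Rightarrow> 'a set_poly" where
  "flat_var M S = (if S \<in> proper_flats M then var S else 0)"

text \<open>For ground set \<open>{0,\<dots>,n}\<close> the denominator \<open>n + 1\<close> is the size of the ground set.\<close>

definition hypersimplex_class :: "'a matroid \<Rightarrow> nat \<Rightarrow> 'a set_poly set" where
  "hypersimplex_class M k = chow_class M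
     (\<Sum>S | S \<noteq> {} \<and> S \<subset> ground M.
        const (real (min (card S) k) - real k / real (card (ground M)) * real (card S)) * flat_var M S)"

end

theory Submission
  imports "HOL-Analysis.Function_Topology" "HOL-Library.Multiset" Defs
begin

text \<open>
  Divisor classes are functions on the proper flats modulo the linear functions
  \<open>F \<mapsto> \<Sum>x\<in>F. w x\<close> with \<open>\<Sum>x\<in>E. w x = 0\<close>. Degrees of products can be computed recursively
  on links of flags; the balancing condition at flags of corank one makes the result symmetric and
  independent of choices, which yields the degree map of the Chow ring. The classes \<open>\<gamma>\<^sub>k\<close> are
  concave functions of the cardinality, hence limits of ample classes: after subtracting a linear function
  an ample class vanishes on a given flag and is positive on its link.

  For ample classes the Hodge index inequality is proved by induction on the corank of a flag, following
  Braenden and Leake. The quadratic form on a link is a positive combination of the forms on the links of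
  one flat more, so the induction hypothesis bounds it by the square of the associated operator; its
  eigenvalues are therefore nonpositive or at least \<open>1\<close>. Since links are connected, Perron--Frobenius shows that
  the ample class spans the only direction with eigenvalue \<open>\<ge> 1\<close>. For corank two the form is written down explicitly.
\<close>

section \<open>Mixed degrees on balanced complexes\<close>

text \<open>The recursion for \<open>mixed_degree\<close> expands one factor at a time, so neither
  its symmetry nor its independence of the moving function is built in. Both are read off from
  expanding two factors over ordered pairs of adjacent vertices: after adding a suitable linear
  function the summand is antisymmetric in the pair (independence), or symmetric up to a diagonal
  term (symmetry). The inductive step of the index inequality spends one fixed ample factor, which
  is expanded over the link. In corank two no fixed factor is left, which is why that case is a
  separate computation. The second class of the inequality has to stay arbitrary, because the step
  feeds functions cut off to a link into the induction hypothesis. Each \<gamma>_k comes from a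
  function of the cardinality that is concave, but in general not strictly. Adding \<epsilon> y (n +
  1 - y) makes it strictly concave and keeps the zero values at 0 and n + 1; the inequality is
  closed, so \<epsilon> may tend to 0. Since \<open>chow_degree\<close> is a definite description,
  the degree map must also be shown unique. That rests on reducing monomials of degree r modulo the
  ideal to flags.\<close>

locale balanced_complex =
  fixes V :: "'v set" and face :: "'v set \<Rightarrow> bool" and r :: nat and Lin :: "('v \<Rightarrow> real) set"
  assumes finite_V: "finite V"
    and face_subset_V: "face \<tau> \<Longrightarrow> \<tau> \<subseteq> V"
    and face_empty: "face {}"
    and face_mono: "face \<tau> \<Longrightarrow> \<sigma> \<subseteq> \<tau> \<Longrightarrow> face \<sigma>"
    and face_extend: "face \<tau> \<Longrightarrow> card \<tau> < r \<Longrightarrow> \<exists>F. F \<notin> \<tau> \<and> face (insert F \<tau>)"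
    and Lin_zero: "(\<lambda>_. 0) \<in> Lin"
    and Lin_add: "l \<in> Lin \<Longrightarrow> l' \<in> Lin \<Longrightarrow> (\<lambda>F. l F + l' F) \<in> Lin"
    and Lin_scale: "l \<in> Lin \<Longrightarrow> (\<lambda>F. t * l F) \<in> Lin"
    and Lin_separates: "face \<tau> \<Longrightarrow> F \<in> \<tau> \<Longrightarrow> \<exists>l\<in>Lin. l F = 1 \<and> (\<forall>G\<in>\<tau> - {F}. l G = 0)"
    and balanced: "face \<tau> \<Longrightarrow> Suc (card \<tau>) = r \<Longrightarrow> l \<in> Lin \<Longrightarrow> (\<And>F. F \<in> \<tau> \<Longrightarrow> l F = 0) \<Longrightarrow>
      (\<Sum>F | F \<notin> \<tau> \<and> face (insert F \<tau>). l F) = 0"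
begin

definition link :: "'v set \<Rightarrow> 'v set" where
  "link \<tau> = {F. F \<notin> \<tau> \<and> face (insert F \<tau>)}"

definition coordinate :: "'v set \<Rightarrow> 'v \<Rightarrow> 'v \<Rightarrow> real" where
  "coordinate \<tau> F = (SOME l. l \<in> Lin \<and> l F = 1 \<and> (\<forall>G\<in>\<tau> - {F}. l G = 0))"

definition lin_part :: "'v set \<Rightarrow> ('v \<Rightarrow> real) \<Rightarrow> 'v \<Rightarrow> real" where
  "lin_part \<tau> a F = (\<Sum>G\<in>\<tau>. a G * coordinate \<tau> G F)"

text \<open>This is the degree of a product of divisors on the star of \<open>\<tau>\<close>: the first factor is moved by a linear
  function until it vanishes on \<open>\<tau>\<close> and is then expanded over the link. The value is independent of the
  choice of \<^const>\<open>coordinate\<close> only if the length of the list is \<open>r - card \<tau>\<close>.\<close>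

primrec mixed_degree :: "('v \<Rightarrow> real) list \<Rightarrow> 'v set \<Rightarrow> real" where
  "mixed_degree [] \<tau> = 1"
| "mixed_degree (a # as) \<tau> =
     (\<Sum>F\<in>link \<tau>. (a F - lin_part \<tau> a F) * mixed_degree as (insert F \<tau>))"

lemma finite_face: "face \<tau> \<Longrightarrow> finite \<tau>"
  using face_subset_V finite_V finite_subset by blast

lemma link_subset_V: "link \<tau> \<subseteq> V"
  using face_subset_V by (auto simp: link_def)

lemma finite_link [simp]: "finite (link \<tau>)"
  using link_subset_V finite_V finite_subset by blast

lemma link_face: "F \<in> link \<tau> \<Longrightarrow> face (insert F \<tau>)"
  by (simp add: link_def)

lemma link_notin: "F \<in> link \<tau> \<Longrightarrow> F \<notin> \<tau>"
  by (simp add: link_def)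

lemma link_card: "F \<in> link \<tau> \<Longrightarrow> card (insert F \<tau>) = Suc (card \<tau>)"
  using link_face[THEN finite_face] link_notin by (simp add: card_insert_if)

lemma link_link_swap:
  "F \<in> link \<tau> \<and> G \<in> link (insert F \<tau>) \<longleftrightarrow> G \<in> link \<tau> \<and> F \<in> link (insert G \<tau>)"
  by (auto simp: link_def insert_commute intro: face_mono)

lemma link_insert_subset: "G \<in> link (insert F \<tau>) \<Longrightarrow> G \<in> link \<tau>"
  by (auto simp: link_def intro: face_mono)

lemma Lin_sum:
  assumes "finite A" "\<And>x. x \<in> A \<Longrightarrow> f x \<in> Lin"
  shows "(\<lambda>F. \<Sum>x\<in>A. f x F) \<in> Lin"
  using assms by (induction A rule: finite_induct) (auto intro: Lin_zero Lin_add)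

lemma Lin_diff: "l \<in> Lin \<Longrightarrow> l' \<in> Lin \<Longrightarrow> (\<lambda>F. l F - l' F) \<in> Lin"
  using Lin_add[OF _ Lin_scale[of l' "-1"]] by simp

lemma coordinate:
  assumes "face \<tau>" "F \<in> \<tau>"
  shows "coordinate \<tau> F \<in> Lin" "coordinate \<tau> F F = 1"
    "G \<in> \<tau> \<Longrightarrow> G \<noteq> F \<Longrightarrow> coordinate \<tau> F G = 0"
proof -
  have "\<exists>l. l \<in> Lin \<and> l F = 1 \<and> (\<forall>G\<in>\<tau> - {F}. l G = 0)"
    using Lin_separates[OF assms] by blast
  from someI_ex[OF this] show "coordinate \<tau> F \<in> Lin" "coordinate \<tau> F F = 1"
    "G \<in> \<tau> \<Longrightarrow> G \<noteq> F \<Longrightarrow> coordinate \<tau> F G = 0"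
    by (auto simp: coordinate_def)
qed

lemma lin_part_Lin: "face \<tau> \<Longrightarrow> lin_part \<tau> a \<in> Lin"
  unfolding lin_part_def[abs_def]
  by (intro Lin_sum finite_face Lin_scale coordinate)

lemma lin_part_eq:
  assumes "face \<tau>" "F \<in> \<tau>"
  shows "lin_part \<tau> a F = a F"
proof -
  have "lin_part \<tau> a F = (\<Sum>G\<in>\<tau>. if G = F then a F else 0)"
    unfolding lin_part_def using assms
    by (intro sum.cong refl) (auto simp: coordinate)
  then show ?thesis using assms finite_face by simp
qed

lemma lin_part_linear:
  "lin_part \<tau> (\<lambda>F. s * a F + t * b F) F = s * lin_part \<tau> a F + t * lin_part \<tau> b F"
  by (simp add: lin_part_def algebra_simps sum.distrib sum_distrib_left)

lemma lin_part_cong: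
  assumes "\<And>G. G \<in> \<tau> \<Longrightarrow> a G = b G"
  shows "lin_part \<tau> a F = lin_part \<tau> b F"
  using assms by (simp add: lin_part_def)

section \<open>Independence of choices and symmetry of the mixed degree\<close>

lemma sum_link_link_swap:
  "(\<Sum>F\<in>link \<tau>. \<Sum>G\<in>link (insert F \<tau>). h F G) = (\<Sum>F\<in>link \<tau>. \<Sum>G\<in>link (insert F \<tau>). h G F)"
proof -
  have "(\<Sum>F\<in>link \<tau>. \<Sum>G\<in>link (insert F \<tau>). h F G) =
        (\<Sum>F\<in>link \<tau>. \<Sum>G | G \<in> link \<tau> \<and> G \<in> link (insert F \<tau>). h F G)"
    by (intro sum.cong refl) (auto dest: link_insert_subset)
  also have "\<dots> = (\<Sum>G\<in>link \<tau>. \<Sum>F | F \<in> link \<tau> \<and> G \<in> link (insert F \<tau>). h F G)"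
    by (rule sum.swap_restrict) auto
  also have "\<dots> = (\<Sum>G\<in>link \<tau>. \<Sum>F\<in>link (insert G \<tau>). h F G)"
    by (intro sum.cong refl) (use link_link_swap in \<open>auto dest: link_insert_subset\<close>)
  finally show ?thesis .
qed

text \<open>This is what makes \<open>mixed_degree\<close> independent of the choice of
  \<open>coordinate\<close>. For the empty list it is the balancing condition. Otherwise one more
  factor is expanded; by the induction hypothesis a linear function vanishing on the larger face may
  be added for free, and this turns the summand into an antisymmetric one, which cancels over the
  ordered pairs in the link.\<close>

lemma sum_link_Lin_eq_0:
  assumes "face \<tau>" "card \<tau> + Suc (length as) = r" "l \<in> Lin" "\<And>F. F \<in> \<tau> \<Longrightarrow> l F = 0"
  shows "(\<Sum>F\<in>link \<tau>. l F * mixed_degree as (insert F \<tau>)) = 0"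
  using assms
proof (induction as arbitrary: \<tau> l)
  case Nil
  then show ?case using balanced[of \<tau> l] by (simp add: link_def)
next
  case (Cons b bs)
  define c where "c = (\<lambda>F. b F - lin_part \<tau> b F)"
  have c0: "c F = 0" if "F \<in> \<tau>" for F
    using that Cons.prems by (simp add: c_def lin_part_eq)
  have step: "l F * mixed_degree (b # bs) (insert F \<tau>) =
      (\<Sum>G\<in>link (insert F \<tau>). (l F * c G - c F * l G) * mixed_degree bs (insert G (insert F \<tau>)))"
    if F: "F \<in> link \<tau>" for F
  proof -
    let ?b = "lin_part (insert F \<tau>) b"
    let ?m = "\<lambda>G. mixed_degree bs (insert G (insert F \<tau>))"
    have fF: "face (insert F \<tau>)" using F by (rule link_face)
    \<comment> \<open>The linear function \<open>k\<close> vanishes on \<open>insert F \<tau>\<close>; adding it makes the summand antisymmetric in \<open>F\<close> and \<open>G\<close>.\<close>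
    define k where "k = (\<lambda>G. l F * (?b G - lin_part \<tau> b G) - c F * l G)"
    have kLin: "k \<in> Lin" unfolding k_def
      by (intro Lin_diff Lin_scale lin_part_Lin fF Cons.prems)
    have k0: "k G = 0" if "G \<in> insert F \<tau>" for G
      using that Cons.prems(4)[of G] lin_part_eq[OF fF that, of b] lin_part_eq[OF Cons.prems(1), of G b]
      by (auto simp: k_def c_def)
    have "(\<Sum>G\<in>link (insert F \<tau>). k G * ?m G) = 0"
      using Cons.prems(2) F by (intro Cons.IH fF kLin k0) (auto simp: link_card)
    then have "l F * mixed_degree (b # bs) (insert F \<tau>) =
        l F * (\<Sum>G\<in>link (insert F \<tau>). (b G - ?b G) * ?m G) + (\<Sum>G\<in>link (insert F \<tau>). k G * ?m G)"
      by simp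
    also have "\<dots> = (\<Sum>G\<in>link (insert F \<tau>). (l F * c G - c F * l G) * ?m G)"
      unfolding sum_distrib_left sum.distrib[symmetric]
      by (intro sum.cong refl) (simp add: k_def c_def algebra_simps)
    finally show ?thesis .
  qed
  let ?S = "\<Sum>F\<in>link \<tau>. \<Sum>G\<in>link (insert F \<tau>). (l F * c G - c F * l G) * mixed_degree bs (insert G (insert F \<tau>))"
  have "?S = (\<Sum>F\<in>link \<tau>. \<Sum>G\<in>link (insert F \<tau>). (l G * c F - c G * l F) * mixed_degree bs (insert F (insert G \<tau>)))"
    by (rule sum_link_link_swap)
  also have "\<dots> = - ?S"
    unfolding sum_negf[symmetric]
    by (intro sum.cong refl) (simp add: insert_commute algebra_simps)
  finally have "?S = 0" by simp
  then show ?case using step by simp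
qed

text \<open>Two linear functions that agree on \<tau> differ by one that vanishes there and
  contributes nothing. Later expansions pick the l that suits them: one witnessing ampleness, or one
  adapted to a gap of a flag.\<close>

lemma mixed_degree_Cons:
  assumes "face \<tau>" "card \<tau> + Suc (length as) = r" "l \<in> Lin" "\<And>F. F \<in> \<tau> \<Longrightarrow> l F = a F"
  shows "mixed_degree (a # as) \<tau> = (\<Sum>F\<in>link \<tau>. (a F - l F) * mixed_degree as (insert F \<tau>))"
proof -
  have "(\<Sum>F\<in>link \<tau>. (l F - lin_part \<tau> a F) * mixed_degree as (insert F \<tau>)) = 0"
    using assms by (intro sum_link_Lin_eq_0 Lin_diff lin_part_Lin) (auto simp: lin_part_eq)
  moreover have "mixed_degree (a # as) \<tau> - (\<Sum>F\<in>link \<tau>. (a F - l F) * mixed_degree as (insert F \<tau>))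
      = (\<Sum>F\<in>link \<tau>. (l F - lin_part \<tau> a F) * mixed_degree as (insert F \<tau>))"
    by (simp add: sum_subtractf[symmetric] algebra_simps)
  ultimately show ?thesis by simp
qed

lemma mixed_degree_Lin:
  assumes "face \<tau>" "card \<tau> + Suc (length as) = r" "l \<in> Lin"
  shows "mixed_degree (l # as) \<tau> = 0"
  using mixed_degree_Cons[OF assms(1,2,3), of l] by simp

lemma mixed_degree_linear:
  "mixed_degree ((\<lambda>F. s * a F + t * b F) # as) \<tau> =
     s * mixed_degree (a # as) \<tau> + t * mixed_degree (b # as) \<tau>"
  by (simp add: lin_part_linear algebra_simps sum.distrib sum_distrib_left sum_subtractf)

lemma mixed_degree_sum:
  assumes "finite A"
  shows "mixed_degree ((\<lambda>F. \<Sum>x\<in>A. s x * f x F) # as) \<tau> = (\<Sum>x\<in>A. s x * mixed_degree (f x # as) \<tau>)"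
  using assms
proof (induction A rule: finite_induct)
  case empty
  have "lin_part \<tau> (\<lambda>F. 0) G = 0" for G by (simp add: lin_part_def)
  then show ?case by simp
next
  case (insert x A)
  then show ?case
    using mixed_degree_linear[of "s x" "f x" 1 "\<lambda>F. \<Sum>x\<in>A. s x * f x F"]
    by (simp del: mixed_degree.simps)
qed

lemma mixed_degree_cong:
  assumes "face \<tau>" "\<And>F. F \<in> V \<Longrightarrow> a F = b F"
  shows "mixed_degree (a # as) \<tau> = mixed_degree (b # as) \<tau>"
proof -
  have "lin_part \<tau> a F = lin_part \<tau> b F" for F
    using assms face_subset_V by (intro lin_part_cong) blast
  moreover have "a F = b F" if "F \<in> link \<tau>" for F
    using that assms link_subset_V by blast
  ultimately show ?thesis by simp
qed

text \<open>The function b vanishes on \<tau> but not at the newly added F, where it is moved by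
  \<open>b F * u F\<close>. This splits the degree into a part over adjacent pairs and a diagonal
  part. The functions u are left free because the diagonal entries are easy to evaluate only for
  suitable choices.\<close>

lemma mixed_degree_two:
  assumes "face \<tau>" "card \<tau> + Suc (Suc (length as)) = r"
    and "\<And>F. F \<in> \<tau> \<Longrightarrow> a F = 0" "\<And>F. F \<in> \<tau> \<Longrightarrow> b F = 0"
    and u: "\<And>F. F \<in> link \<tau> \<Longrightarrow> u F \<in> Lin" "\<And>F. F \<in> link \<tau> \<Longrightarrow> u F F = 1"
      "\<And>F G. F \<in> link \<tau> \<Longrightarrow> G \<in> \<tau> \<Longrightarrow> u F G = 0"
  shows "mixed_degree (a # b # as) \<tau> =
    (\<Sum>F\<in>link \<tau>. a F * (\<Sum>G\<in>link (insert F \<tau>). b G * mixed_degree as (insert G (insert F \<tau>)))) -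
    (\<Sum>F\<in>link \<tau>. a F * b F * (\<Sum>G\<in>link (insert F \<tau>). u F G * mixed_degree as (insert G (insert F \<tau>))))"
proof -
  have "mixed_degree (a # b # as) \<tau> = (\<Sum>F\<in>link \<tau>. a F * mixed_degree (b # as) (insert F \<tau>))"
    using assms by (subst mixed_degree_Cons[where l = "\<lambda>_. 0"]) (auto simp: Lin_zero)
  also have "\<dots> = (\<Sum>F\<in>link \<tau>. a F * (\<Sum>G\<in>link (insert F \<tau>).
      (b G - b F * u F G) * mixed_degree as (insert G (insert F \<tau>))))"
  proof (intro sum.cong refl)
    fix F assume F: "F \<in> link \<tau>"
    show "a F * mixed_degree (b # as) (insert F \<tau>) = a F * (\<Sum>G\<in>link (insert F \<tau>).
      (b G - b F * u F G) * mixed_degree as (insert G (insert F \<tau>)))"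
      using assms F by (subst mixed_degree_Cons[where l = "\<lambda>G. b F * u F G"])
        (auto simp: link_face link_card Lin_scale u)
  qed
  also have "\<dots> = (\<Sum>F\<in>link \<tau>. a F * (\<Sum>G\<in>link (insert F \<tau>). b G * mixed_degree as (insert G (insert F \<tau>)))) -
    (\<Sum>F\<in>link \<tau>. a F * b F * (\<Sum>G\<in>link (insert F \<tau>). u F G * mixed_degree as (insert G (insert F \<tau>))))"
    by (simp add: sum_subtractf left_diff_distrib right_diff_distrib mult.assoc sum_distrib_left)
  finally show ?thesis .
qed

lemma mixed_degree_lin_part:
  assumes "face \<tau>" "card \<tau> + Suc (length as) = r" "l \<in> Lin"
  shows "mixed_degree ((\<lambda>F. a F - l F) # as) \<tau> = mixed_degree (a # as) \<tau>"
  using mixed_degree_linear[of 1 a "-1" l as \<tau>] mixed_degree_Lin[OF assms] by simp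

lemma mixed_degree_lin_part2:
  assumes "face \<tau>" "card \<tau> + Suc (Suc (length as)) = r" "l \<in> Lin"
  shows "mixed_degree (a # (\<lambda>F. b F - l F) # as) \<tau> = mixed_degree (a # b # as) \<tau>"
  unfolding mixed_degree.simps(2)[of a] using assms
  by (intro sum.cong refl arg_cong2[where f = "(*)"] mixed_degree_lin_part) (auto simp: link_face link_card)

text \<open>Both factors are first made to vanish on \<tau>. In \<open>mixed_degree_two\<close> the
  diagonal part is then visibly symmetric, and exchanging a and b in the other part amounts to
  reversing the ordered pairs.\<close>

lemma mixed_degree_swap:
  assumes "face \<tau>" "card \<tau> + Suc (Suc (length as)) = r"
  shows "mixed_degree (a # b # as) \<tau> = mixed_degree (b # a # as) \<tau>"
proof -
  let ?n = "\<lambda>a F. a F - lin_part \<tau> a F"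
  let ?u = "\<lambda>F. coordinate (insert F \<tau>) F"
  have red: "mixed_degree (a # b # as) \<tau> = mixed_degree (?n a # ?n b # as) \<tau>" for a b
    using assms mixed_degree_lin_part[of \<tau> "?n b # as" "lin_part \<tau> a" a]
      mixed_degree_lin_part2[of \<tau> as "lin_part \<tau> b" a b] lin_part_Lin[OF assms(1)]
    by (simp del: mixed_degree.simps)
  have two: "mixed_degree (?n a # ?n b # as) \<tau> =
    (\<Sum>F\<in>link \<tau>. \<Sum>G\<in>link (insert F \<tau>). ?n a F * ?n b G * mixed_degree as (insert G (insert F \<tau>))) -
    (\<Sum>F\<in>link \<tau>. ?n a F * ?n b F * (\<Sum>G\<in>link (insert F \<tau>). ?u F G * mixed_degree as (insert G (insert F \<tau>))))"
    for a b
  proof -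
    have "?u F \<in> Lin \<and> ?u F F = 1 \<and> (\<forall>G\<in>\<tau>. ?u F G = 0)" if "F \<in> link \<tau>" for F
      using coordinate[OF link_face[OF that], of F] link_notin[OF that] by auto
    then show ?thesis
      using assms by (subst mixed_degree_two[where u = ?u]) (auto simp: lin_part_eq sum_distrib_left mult.assoc)
  qed
  have "(\<Sum>F\<in>link \<tau>. \<Sum>G\<in>link (insert F \<tau>). ?n a F * ?n b G * mixed_degree as (insert G (insert F \<tau>))) =
    (\<Sum>F\<in>link \<tau>. \<Sum>G\<in>link (insert F \<tau>). ?n b F * ?n a G * mixed_degree as (insert G (insert F \<tau>)))"
    by (subst sum_link_link_swap) (simp add: insert_commute mult.commute)
  then show ?thesis
    unfolding red[of a b] red[of b a] two by (simp add: mult.commute)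
qed

lemma mixed_degree_move:
  assumes "face \<tau>" "card \<tau> + Suc (length (as @ bs)) = r"
  shows "mixed_degree (as @ x # bs) \<tau> = mixed_degree (x # as @ bs) \<tau>"
  using assms
proof (induction as arbitrary: \<tau>)
  case (Cons a as)
  have "mixed_degree ((a # as) @ x # bs) \<tau> = mixed_degree (a # x # as @ bs) \<tau>"
    unfolding append_Cons mixed_degree.simps(2)[of a] using Cons.prems
    by (intro sum.cong refl arg_cong2[where f = "(*)"] Cons.IH) (auto simp: link_face link_card)
  also have "\<dots> = mixed_degree (x # a # as @ bs) \<tau>"
    using Cons.prems by (intro mixed_degree_swap) auto
  finally show ?case by (simp only: append_Cons)
qed simp

lemma mixed_degree_perm:
  assumes "mset as = mset bs" "face \<tau>" "card \<tau> + length as = r"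
  shows "mixed_degree as \<tau> = mixed_degree bs \<tau>"
  using assms
proof (induction as arbitrary: bs \<tau>)
  case (Cons a as)
  have "a \<in> set bs" using Cons.prems(1) by (metis list.set_intros(1) set_mset_mset)
  then obtain us vs where bs: "bs = us @ a # vs" by (meson split_list)
  then have m: "mset as = mset (us @ vs)" using Cons.prems(1) by simp
  have "mixed_degree (a # as) \<tau> = mixed_degree (a # us @ vs) \<tau>"
    unfolding mixed_degree.simps(2)[of a] using Cons.prems m
    by (intro sum.cong refl arg_cong2[where f = "(*)"] Cons.IH) (auto simp: link_face link_card)
  also have "\<dots> = mixed_degree bs \<tau>"
    using mixed_degree_move[of \<tau> us vs a] Cons.prems mset_eq_length[OF m] by (simp add: bs del: mixed_degree.simps)
  finally show ?case .
qed simp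

end

section \<open>Reverse Cauchy--Schwarz inequalities\<close>

text \<open>First order condition at a maximum: for a small t of the sign of p the linear term would
  dominate.\<close>

lemma quadratic_nonpos_imp_linear_coeff_zero:
  fixes p q :: real
  assumes "\<And>t. t * p + t\<^sup>2 * q \<le> 0"
  shows "p = 0"
proof (rule ccontr)
  assume p: "p \<noteq> 0"
  \<comment> \<open>At t = s * p the left side is s * p^2 * (1 + s * q), and this s keeps 1 + s * q
    positive.\<close>
  define s where "s = 1 / (1 + \<bar>q\<bar>)"
  have s: "s > 0" "s * \<bar>q\<bar> < 1" by (auto simp: s_def field_simps)
  have "s * p\<^sup>2 * (1 + s * q) \<le> 0"
    using assms[of "s * p"] by (simp add: power2_eq_square algebra_simps)
  moreover have "1 + s * q > 0"
    using s by (smt (verit, best) abs_ge_minus_self mult_left_mono mult_minus_right)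
  ultimately show False using s p by (simp add: mult_le_0_iff zero_less_mult_iff)
qed

text \<open>Extensional functions take the single value \<open>undefined\<close> outside A, so the
  set is a product of compact sets over all indices and Tychonoff applies. Functions on a finite set
  can thus serve as the vectors of an eigenvalue argument.\<close>

lemma compact_PiE_reals:
  fixes R :: "'v \<Rightarrow> real"
  shows "compact (PiE A (\<lambda>v. {- R v..R v}))"
proof -
  have "PiE A (\<lambda>v. {- R v..R v}) = PiE UNIV (\<lambda>v. if v \<in> A then {- R v..R v} else {undefined})"
    by (auto simp: PiE_def Pi_def extensional_def split: if_splits)
  moreover have "compactin (product_topology (\<lambda>_. euclidean) UNIV)
      (PiE UNIV (\<lambda>v. if v \<in> A then {- R v..R v} else {undefined}))"
    by (subst compactin_PiE) auto
  ultimately show ?thesis by (simp add: euclidean_product_topology)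
qed

lemma continuous_on_coordinate [continuous_intros]:
  "continuous_on S (\<lambda>b::'v \<Rightarrow> real. b v)"
  by (rule continuous_on_product_coordinates[THEN continuous_on_subset]) auto

text \<open>Think of \<open>Q\<close> as the operator \<open>A v u = g v / q v * Q v u\<close> with fixed vector \<open>g\<close>: it is self-adjoint for the
  weights \<open>q v / g v\<close>, \<open>bochner\<close> says \<open>A \<le> A\<^sup>2\<close>, and the Perron--Frobenius argument says \<open>A \<le> 1\<close> with
  eigenvalue \<open>1\<close> attained only at \<open>g\<close>. Hence a maximiser of the form on the complement of \<open>g\<close> is
  an eigenvector with eigenvalue \<open>\<le> 0\<close>.\<close>

lemma bochner_reverse_cauchy_schwarz:
  fixes W :: "'v set" and Q :: "'v \<Rightarrow> 'v \<Rightarrow> real" and g q :: "'v \<Rightarrow> real"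
  defines "B \<equiv> \<lambda>a b. \<Sum>v\<in>W. \<Sum>u\<in>W. Q v u * a v * b u"
  assumes fin: "finite W"
    and sym: "\<And>u v. u \<in> W \<Longrightarrow> v \<in> W \<Longrightarrow> Q u v = Q v u"
    and nonneg: "\<And>u v. u \<in> W \<Longrightarrow> v \<in> W \<Longrightarrow> u \<noteq> v \<Longrightarrow> Q u v \<ge> 0"
    and connected: "\<And>h :: 'v \<Rightarrow> real. (\<And>u v. u \<in> W \<Longrightarrow> v \<in> W \<Longrightarrow> u \<noteq> v \<Longrightarrow> Q u v \<noteq> 0 \<Longrightarrow> h u = h v) \<Longrightarrow>
          (\<And>u v. u \<in> W \<Longrightarrow> v \<in> W \<Longrightarrow> h u = h v)"
    and g: "\<And>v. v \<in> W \<Longrightarrow> g v > 0"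
    and q: "\<And>v. v \<in> W \<Longrightarrow> q v = (\<Sum>u\<in>W. Q v u * g u)" "\<And>v. v \<in> W \<Longrightarrow> q v > 0"
    and bochner: "\<And>b. B b b \<le> (\<Sum>v\<in>W. g v * (\<Sum>u\<in>W. Q v u * b u)\<^sup>2 / q v)"
  shows "B b b * B g g \<le> (B b g)\<^sup>2"
proof (cases "W = {}")
  case True
  then show ?thesis by (simp add: B_def)
next
  case False
  define w where "w = (\<lambda>v. q v / g v)"
  define I where "I = (\<lambda>a b. \<Sum>v\<in>W. w v * a v * b v)"
  have w: "w v > 0" if "v \<in> W" for v using g q that by (simp add: w_def)
  have wnn: "w v * x v * x v \<ge> 0" if "v \<in> W" for v x
    using w[OF that] by (simp add: mult.assoc)
  have Bg: "B b g = (\<Sum>v\<in>W. q v * b v)" for b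
    unfolding B_def using q
    by (intro sum.cong refl) (simp add: sum_distrib_left algebra_simps)
  have Ig: "I b g = B b g" for b
    unfolding Bg I_def using g by (intro sum.cong refl) (force simp: w_def)
  have Bsym: "B a b = B b a" for a b
    unfolding B_def by (subst sum.swap) (auto intro!: sum.cong simp: sym mult.assoc mult.commute mult.left_commute)
  have Isym: "I a b = I b a" for a b
    by (simp add: I_def mult.commute mult.left_commute)
  have Blin: "B (\<lambda>v. s * a v + t * b v) c = s * B a c + t * B b c" for a b c s t
    by (simp add: B_def sum.distrib algebra_simps sum_distrib_left)
  have Ilin: "I (\<lambda>v. s * a v + t * b v) c = s * I a c + t * I b c" for a b c s t
    by (simp add: I_def sum.distrib algebra_simps sum_distrib_left)
  have Bquad: "B (\<lambda>v. s * a v + t * b v) (\<lambda>v. s * a v + t * b v) = s\<^sup>2 * B a a + 2 * s * t * B a b + t\<^sup>2 * B b b" for a b s t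
    using Bsym[of b a] by (simp add: Blin Bsym[of _ "\<lambda>v. s * a v + t * b v"] power2_eq_square algebra_simps)
  have Iquad: "I (\<lambda>v. s * a v + t * b v) (\<lambda>v. s * a v + t * b v) = s\<^sup>2 * I a a + 2 * s * t * I a b + t\<^sup>2 * I b b" for a b s t
    using Isym[of b a] by (simp add: Ilin Isym[of _ "\<lambda>v. s * a v + t * b v"] power2_eq_square algebra_simps)
  have Bgg: "B g g > 0" unfolding Bg using fin False g q by (intro sum_pos) auto
  \<comment> \<open>The difference of the two forms is the Dirichlet form of the graph with edge
    weights \<open>Q v u * g v * g u\<close>, evaluated at b / g. Diagonal entries of Q, whose sign
    is not controlled, meet a zero difference.\<close>
  have pf: "I b b - B b b = (\<Sum>v\<in>W. \<Sum>u\<in>W. Q v u * g v * g u * (b v / g v - b u / g u)\<^sup>2) / 2" for b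
  proof -
    have "(\<Sum>v\<in>W. \<Sum>u\<in>W. Q v u * g v * g u * (b v / g v - b u / g u)\<^sup>2) =
      (\<Sum>v\<in>W. \<Sum>u\<in>W. Q v u * g u * ((b v)\<^sup>2 / g v) + Q v u * g v * ((b u)\<^sup>2 / g u) - 2 * (Q v u * b v * b u))"
    proof (intro sum.cong refl)
      fix u v assume "v \<in> W" "u \<in> W"
      then have "g v \<noteq> 0" "g u \<noteq> 0" using g by force+
      then show "Q v u * g v * g u * (b v / g v - b u / g u)\<^sup>2 =
        Q v u * g u * ((b v)\<^sup>2 / g v) + Q v u * g v * ((b u)\<^sup>2 / g u) - 2 * (Q v u * b v * b u)"
        by (simp add: field_simps power2_eq_square)
    qed
    also have "\<dots> = (\<Sum>v\<in>W. \<Sum>u\<in>W. Q v u * g u * ((b v)\<^sup>2 / g v)) + (\<Sum>v\<in>W. \<Sum>u\<in>W. Q v u * g v * ((b u)\<^sup>2 / g u)) - 2 * B b b"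
      unfolding B_def sum_distrib_left sum.distrib[symmetric] sum_subtractf[symmetric] ..
    also have "(\<Sum>v\<in>W. \<Sum>u\<in>W. Q v u * g v * ((b u)\<^sup>2 / g u)) = (\<Sum>v\<in>W. \<Sum>u\<in>W. Q v u * g u * ((b v)\<^sup>2 / g v))"
      by (subst sum.swap) (auto intro!: sum.cong simp: sym)
    also have "(\<Sum>v\<in>W. \<Sum>u\<in>W. Q v u * g u * ((b v)\<^sup>2 / g v)) = I b b"
      unfolding I_def w_def using q
      by (intro sum.cong refl) (simp add: sum_distrib_right power2_eq_square sum_divide_distrib mult.assoc)
    finally show ?thesis by simp
  qed
  have pf_term: "Q v u * g v * g u * (b v / g v - b u / g u)\<^sup>2 \<ge> 0" if "v \<in> W" "u \<in> W" for v u b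
    using that nonneg[OF that] g[of v] g[of u] by (cases "u = v") auto
  have le1: "B b b \<le> I b b" for b
    using pf[of b] sum_nonneg[of W "\<lambda>v. \<Sum>u\<in>W. Q v u * g v * g u * (b v / g v - b u / g u)\<^sup>2"]
      sum_nonneg[of W, OF pf_term] by fastforce
  \<comment> \<open>Equality makes b / g constant along every nonzero off-diagonal entry of Q, hence
    constant by \<open>connected\<close>.\<close>
  have eq1: "\<exists>s. \<forall>v\<in>W. b v = s * g v" if "B b b = I b b" for b
  proof -
    have z: "(\<Sum>v\<in>W. \<Sum>u\<in>W. Q v u * g v * g u * (b v / g v - b u / g u)\<^sup>2) = 0"
      using pf[of b] that by simp
    have row: "(\<Sum>u\<in>W. Q v u * g v * g u * (b v / g v - b u / g u)\<^sup>2) = 0" if "v \<in> W" for v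
      using z that fin by (subst (asm) sum_nonneg_eq_0_iff) (auto intro!: sum_nonneg pf_term)
    have zz: "Q v u * g v * g u * (b v / g v - b u / g u)\<^sup>2 = 0" if "v \<in> W" "u \<in> W" for u v
      using row[OF that(1)] that(2) sum_nonneg_eq_0_iff[of W "\<lambda>u. Q v u * g v * g u * (b v / g v - b u / g u)\<^sup>2"]
        fin pf_term[OF that(1)] by blast
    have "b u / g u = b v / g v" if uv: "u \<in> W" "v \<in> W" for u v
    proof (rule connected[of "\<lambda>v. b v / g v"])
      show "b u / g u = b v / g v" if "u \<in> W" "v \<in> W" "u \<noteq> v" "Q u v \<noteq> 0" for u v
        using zz[OF that(1,2)] g[OF that(1)] g[OF that(2)] that(4) by simp
    qed (use uv in auto)
    moreover obtain v0 where "v0 \<in> W" using False by blast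
    ultimately have "\<forall>v\<in>W. b v = (b v0 / g v0) * g v" using g by (metis less_irrefl nonzero_eq_divide_eq)
    then show ?thesis by blast
  qed
  have neg: "B b b \<le> 0" if orth: "B b g = 0" for b
  proof (rule ccontr)
    assume "\<not> B b b \<le> 0"
    \<comment> \<open>The unit sphere of I in the complement of g. The box excludes no values on W,
      since I x x = 1 already bounds each coordinate there; it fixes the values outside W and
      supplies compactness.\<close>
    define K where "K = {x \<in> PiE W (\<lambda>v. {- (1 / sqrt (w v))..1 / sqrt (w v)}). I x x = 1 \<and> B x g = 0}"
    have bI: "I b b > 0" using le1[of b] \<open>\<not> B b b \<le> 0\<close> by simp
    have in_box: "x v \<in> {- (1 / sqrt (w v))..1 / sqrt (w v)}" if "I x x = 1" "v \<in> W" for x v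
    proof -
      have "w v * x v * x v \<le> I x x"
        unfolding I_def using that fin wnn by (intro member_le_sum) auto
      then have "(x v)\<^sup>2 \<le> 1 / w v" using that w[of v] by (simp add: field_simps power2_eq_square)
      then have "\<bar>x v\<bar> \<le> sqrt (1 / w v)" by (metis real_sqrt_abs real_sqrt_le_mono)
      then show ?thesis by (simp add: real_sqrt_divide abs_le_iff)
    qed
    have I_cong: "I x y = I x' y'" if "\<And>v. v \<in> W \<Longrightarrow> x v = x' v" "\<And>v. v \<in> W \<Longrightarrow> y v = y' v" for x y x' y'
      using that by (simp add: I_def)
    have B_cong: "B x y = B x' y'" if "\<And>v. v \<in> W \<Longrightarrow> x v = x' v" "\<And>v. v \<in> W \<Longrightarrow> y v = y' v" for x y x' y'
      using that by (simp add: B_def)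
    have K_scale: "\<exists>x'\<in>K. B x' x' = B x x / I x x" if "I x x > 0" "B x g = 0" for x
    proof -
      let ?s = "1 / sqrt (I x x)"
      let ?y = "restrict (\<lambda>v. ?s * x v) W"
      have s2: "?s\<^sup>2 = 1 / I x x" using that by (simp add: power_divide)
      have "I ?y ?y = ?s\<^sup>2 * I x x"
        using Iquad[of ?s x 0 x] I_cong[of ?y "\<lambda>v. ?s * x v + 0 * x v" ?y "\<lambda>v. ?s * x v + 0 * x v"] by simp
      then have e1: "I ?y ?y = 1" using that unfolding s2 by simp
      have "B ?y ?y = ?s\<^sup>2 * B x x"
        using Bquad[of ?s x 0 x] B_cong[of ?y "\<lambda>v. ?s * x v + 0 * x v" ?y "\<lambda>v. ?s * x v + 0 * x v"] by simp
      then have e3: "B ?y ?y = B x x / I x x" unfolding s2 by simp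
      have e2: "B ?y g = 0"
        using Blin[of ?s x 0 x g] B_cong[of ?y "\<lambda>v. ?s * x v + 0 * x v" g g] that by simp
      note e = e1 e2 e3
      have "?y \<in> K" unfolding K_def using in_box[OF e(1)] e by (auto simp: PiE_iff)
      then show ?thesis using e by blast
    qed
    have "compact K"
    proof -
      have cl: "closed {x. I x x = 1 \<and> B x g = 0}"
        unfolding I_def B_def
        by (intro closed_Collect_conj closed_Collect_eq continuous_intros)
      have K_eq: "K = PiE W (\<lambda>v. {- (1 / sqrt (w v))..1 / sqrt (w v)}) \<inter> {x. I x x = 1 \<and> B x g = 0}"
        unfolding K_def by blast
      show ?thesis unfolding K_eq by (rule compact_Int_closed[OF compact_PiE_reals cl])
    qed
    moreover have "K \<noteq> {}" using K_scale[OF bI orth] by blast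
    moreover have "continuous_on K (\<lambda>x. B x x)" unfolding B_def by (intro continuous_intros)
    ultimately have "\<exists>x\<in>K. \<forall>y\<in>K. B y y \<le> B x x"
      by (rule continuous_attains_sup)
    then obtain x where x: "x \<in> K" "\<And>y. y \<in> K \<Longrightarrow> B y y \<le> B x x"
      by blast
    define m where "m = B x x"
    have xK: "I x x = 1" "B x g = 0" using x by (auto simp: K_def)
    obtain b' where b': "b' \<in> K" "B b' b' = B b b / I b b" using K_scale[OF bI orth] by blast
    have "B b b / I b b > 0" using bI \<open>\<not> B b b \<le> 0\<close> by simp
    then have m0: "m > 0" using x(2)[OF b'(1)] b'(2) by (simp add: m_def)
    have max: "B y y \<le> m * I y y" if yg: "B y g = 0" for y
    proof (cases "I y y > 0")
      case True
      then obtain y' where "y' \<in> K" "B y' y' = B y y / I y y" using K_scale[OF _ yg] by blast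
      then have "B y y / I y y \<le> m" using x(2)[of y'] by (simp add: m_def)
      then show ?thesis using True by (simp add: field_simps)
    next
      case False
      have "I y y \<ge> 0" unfolding I_def by (intro sum_nonneg wnn)
      then have "I y y = 0" using False by simp
      then show ?thesis using le1[of y] by simp
    qed
    \<comment> \<open>Moving from the maximiser x along y cannot make B - m * I positive, so its
      first order term vanishes.\<close>
    have eig0: "B x y = m * I x y" if y: "B y g = 0" for y
    proof -
      have "t * (2 * (B x y - m * I x y)) + t\<^sup>2 * (B y y - m * I y y) \<le> 0" for t
      proof -
        have "B (\<lambda>v. 1 * x v + t * y v) g = 0" using xK y by (simp only: Blin)
        from max[OF this] show ?thesis unfolding Bquad Iquad using xK by (simp add: m_def algebra_simps)
      qed
      then show ?thesis using quadratic_nonpos_imp_linear_coeff_zero by fastforce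
    qed
    \<comment> \<open>In the direction g both sides vanish because B x g = I x g = 0, so the
      eigenvector equation extends from the complement of g to all y.\<close>
    have eig: "B x y = m * I x y" for y
    proof -
      define t where "t = B y g / B g g"
      have "B (\<lambda>v. 1 * y v + (- t) * g v) g = 0" unfolding Blin using Bgg by (simp add: t_def)
      from eig0[OF this] show ?thesis
        unfolding Bsym[of x] Isym[of x] Blin Ilin
        using xK Ig[of x] by (simp add: Bsym[of g] Isym[of g])
    qed
    have point: "(\<Sum>u\<in>W. Q v u * x u) = m * w v * x v" if v: "v \<in> W" for v
    proof -
      let ?d = "\<lambda>u. if u = v then 1 else 0 :: real"
      have "B ?d x = (\<Sum>v'\<in>W. if v' = v then (\<Sum>u\<in>W. Q v u * x u) else 0)"
        unfolding B_def by (intro sum.cong refl) auto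
      moreover have "I ?d x = (\<Sum>v'\<in>W. if v' = v then w v * x v else 0)"
        unfolding I_def by (intro sum.cong refl) auto
      ultimately show ?thesis using eig[of ?d] v fin
        by (simp add: Bsym[of x] Isym[of x])
    qed
    \<comment> \<open>With the eigenvector equation inserted, \<open>bochner\<close> reads m \<le>
      m^2, so m \<ge> 1. By \<open>le1\<close> then B x x = I x x, so x is a multiple of g; being
      orthogonal to g it is 0, against I x x = 1.\<close>
    have "m \<le> (\<Sum>v\<in>W. g v * (m * w v * x v)\<^sup>2 / q v)"
      using bochner[of x] point by (simp add: m_def)
    also have "\<dots> = m\<^sup>2 * I x x"
      unfolding I_def sum_distrib_left
    proof (intro sum.cong refl)
      fix v assume "v \<in> W"
      then have "g v > 0" "q v > 0" using g q by auto
      then show "g v * (m * w v * x v)\<^sup>2 / q v = m\<^sup>2 * (w v * x v * x v)"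
        by (simp add: w_def field_simps power2_eq_square)
    qed
    finally have "m \<ge> 1" using xK m0 by (simp add: power2_eq_square)
    then have "B x x = I x x" using le1[of x] xK m_def by simp
    then obtain s where s: "\<forall>v\<in>W. x v = s * g v" using eq1 by blast
    then have "B x g = s * B g g" using B_cong[of x "\<lambda>v. s * g v + 0 * g v" g g] Blin[of s g 0 g g] by simp
    then have "s = 0" using xK Bgg by simp
    then have "I x x = 0" using s by (simp add: I_def)
    then show False using xK by simp
  qed
  \<comment> \<open>t * g is the projection of b onto g with respect to B; the remainder lies where
    B is nonpositive.\<close>
  define t where "t = B b g / B g g"
  have "B (\<lambda>v. 1 * b v + (- t) * g v) g = 0" unfolding Blin using Bgg by (simp add: t_def)
  from neg[OF this] have "B b b - 2 * t * B b g + t\<^sup>2 * B g g \<le> 0" unfolding Bquad by simp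
  moreover have "2 * t * B b g - t\<^sup>2 * B g g = (B b g)\<^sup>2 / B g g"
    using Bgg by (simp add: t_def field_simps power2_eq_square)
  ultimately have "B b b \<le> (B b g)\<^sup>2 / B g g" by linarith
  then show ?thesis using Bgg by (simp add: field_simps)
qed

text \<open>Think of ta and tb as the values of a functional at vectors a and b. If qaa > 0 then a
  is outside its kernel, so the kernel contains a vector t * a + b; nonpositivity there is the
  discriminant inequality after completing the square. This carries the index inequality from one
  reference direction to an arbitrary pair.\<close>

lemma reverse_cauchy_schwarz_of_hyperplane:
  fixes qaa qab qbb ta tb :: real
  assumes neg: "\<And>s t. s * ta + t * tb = 0 \<Longrightarrow> s\<^sup>2 * qaa + 2 * s * t * qab + t\<^sup>2 * qbb \<le> 0"
    and "qaa \<ge> 0"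
  shows "qaa * qbb \<le> qab\<^sup>2"
proof (cases "qaa = 0")
  case False
  then have "qaa > 0" using assms by simp
  then have ta: "ta \<noteq> 0" using neg[of 1 0] by auto
  define t where "t = - tb / ta"
  have "t\<^sup>2 * qaa + 2 * t * qab + qbb \<le> 0" using neg[of t 1] ta by (simp add: t_def)
  then have "qaa * (t\<^sup>2 * qaa + 2 * t * qab + qbb) \<le> 0" using \<open>qaa > 0\<close> by (simp add: mult_le_0_iff)
  moreover have "qaa * (t\<^sup>2 * qaa + 2 * t * qab + qbb) = (t * qaa + qab)\<^sup>2 - qab\<^sup>2 + qaa * qbb"
    by (simp add: power2_eq_square algebra_simps)
  ultimately show ?thesis using zero_le_power2[of "t * qaa + qab"] by linarith
qed simp

section \<open>The Hodge index inequality\<close>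

context balanced_complex
begin

definition ample :: "('v \<Rightarrow> real) \<Rightarrow> bool" where
  "ample a \<longleftrightarrow> (\<forall>\<tau>. face \<tau> \<longrightarrow> (\<exists>l\<in>Lin. (\<forall>F\<in>\<tau>. l F = a F) \<and> (\<forall>F\<in>link \<tau>. l F < a F)))"

lemma ampleE:
  assumes "ample a" "face \<tau>"
  obtains l where "l \<in> Lin" "\<And>F. F \<in> \<tau> \<Longrightarrow> l F = a F" "\<And>F. F \<in> link \<tau> \<Longrightarrow> l F < a F"
  using assms unfolding ample_def by blast

lemma link_nonempty: "face \<tau> \<Longrightarrow> card \<tau> < r \<Longrightarrow> link \<tau> \<noteq> {}"
  using face_extend by (auto simp: link_def)

lemma mixed_degree_pos:
  assumes "face \<tau>" "card \<tau> + length as = r" "\<And>a. a \<in> set as \<Longrightarrow> ample a"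
  shows "mixed_degree as \<tau> > 0"
  using assms
proof (induction as arbitrary: \<tau>)
  case (Cons a as)
  obtain l where l: "l \<in> Lin" "\<And>F. F \<in> \<tau> \<Longrightarrow> l F = a F" "\<And>F. F \<in> link \<tau> \<Longrightarrow> l F < a F"
    using ampleE[of a \<tau>] Cons.prems by auto
  have "0 < (\<Sum>F\<in>link \<tau>. (a F - l F) * mixed_degree as (insert F \<tau>))"
    using Cons l link_nonempty[of \<tau>] by (intro sum_pos mult_pos_pos) (auto simp: link_face link_card)
  also have "\<dots> = mixed_degree (a # as) \<tau>"
    using Cons.prems l by (intro mixed_degree_Cons[symmetric]) auto
  finally show ?case .
qed simp

lemma mixed_degree_quad:
  assumes "face \<tau>" "card \<tau> + Suc (Suc (length as)) = r"
  shows "mixed_degree ((\<lambda>F. s * a F + t * b F) # (\<lambda>F. s * a F + t * b F) # as) \<tau> =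
    s\<^sup>2 * mixed_degree (a # a # as) \<tau> + 2 * s * t * mixed_degree (a # b # as) \<tau> + t\<^sup>2 * mixed_degree (b # b # as) \<tau>"
  (is "mixed_degree (?c # ?c # as) \<tau> = _")
proof -
  have "mixed_degree (?c # ?c # as) \<tau> = s * mixed_degree (a # ?c # as) \<tau> + t * mixed_degree (b # ?c # as) \<tau>"
    by (rule mixed_degree_linear)
  also have "\<dots> = s * mixed_degree (?c # a # as) \<tau> + t * mixed_degree (?c # b # as) \<tau>"
    by (simp only: mixed_degree_swap[OF assms, of a ?c] mixed_degree_swap[OF assms, of b ?c])
  also have "\<dots> = s * (s * mixed_degree (a # a # as) \<tau> + t * mixed_degree (b # a # as) \<tau>) +
      t * (s * mixed_degree (a # b # as) \<tau> + t * mixed_degree (b # b # as) \<tau>)"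
    by (simp only: mixed_degree_linear)
  finally show ?thesis
    unfolding mixed_degree_swap[OF assms, of b a] by (simp add: power2_eq_square algebra_simps del: mixed_degree.simps)
qed

end

text \<open>Connectedness is phrased through functions constant along edges because that is how the
  Perron--Frobenius argument uses it. \<open>surface_index\<close> says that the form in corank two
  has at most one positive direction, witnessed by a functional on whose kernel the form is
  nonpositive.\<close>

locale lorentzian_complex = balanced_complex V face r Lin
  for V :: "'v set" and face r Lin +
  assumes link_connected: "face \<tau> \<Longrightarrow> card \<tau> + 3 \<le> r \<Longrightarrow>
      (\<And>u v. u \<in> link \<tau> \<Longrightarrow> v \<in> link (insert u \<tau>) \<Longrightarrow> h u = h v) \<Longrightarrow>
      u \<in> link \<tau> \<Longrightarrow> v \<in> link \<tau> \<Longrightarrow> (h u :: real) = h v"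
    and surface_index: "face \<tau> \<Longrightarrow> card \<tau> + 2 = r \<Longrightarrow>
      \<exists>\<alpha>::('v \<Rightarrow> real) \<Rightarrow> real. (\<forall>a b s t. \<alpha> (\<lambda>F. s * a F + t * b F) = s * \<alpha> a + t * \<alpha> b) \<and>
        (\<forall>c. \<alpha> c = 0 \<longrightarrow> mixed_degree [c, c] \<tau> \<le> 0)"
begin

text \<open>On functions vanishing on \<tau> the degree with g # gs fixed is a quadratic form whose
  matrix Q is indexed by the link. The rows of Q are degrees on faces with one vertex more, and the
  index inequality on those faces is the Bochner bound for Q.\<close>

lemma hodge_index_step:
  assumes \<tau>: "face \<tau>" and card: "card \<tau> + Suc (Suc (length (g # gs))) = r"
    and g: "ample g" "\<And>a. a \<in> set gs \<Longrightarrow> ample a"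
    and IH: "\<And>v b. v \<in> link \<tau> \<Longrightarrow> mixed_degree (g # g # gs) (insert v \<tau>) * mixed_degree (b # b # gs) (insert v \<tau>)
        \<le> (mixed_degree (g # b # gs) (insert v \<tau>))\<^sup>2"
  shows "mixed_degree (b # b # g # gs) \<tau> * mixed_degree (g # g # g # gs) \<tau> \<le> (mixed_degree (b # g # g # gs) \<tau>)\<^sup>2"
proof -
  note [simp del] = mixed_degree.simps
  define W where "W = link \<tau>"
  have Wf: "face (insert v \<tau>)" "card (insert v \<tau>) + Suc (Suc (length gs)) = r" "v \<notin> \<tau>" if "v \<in> W" for v
    using card link_face[of v \<tau>] link_card[of v \<tau>] link_notin[of v \<tau>] that by (simp_all add: W_def)
  define e where "e = (\<lambda>v. coordinate (insert v \<tau>) v)"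
  have e: "e v \<in> Lin" "e v v = 1" "\<And>G. G \<in> \<tau> \<Longrightarrow> e v G = 0" if "v \<in> W" for v
    using coordinate[OF Wf(1)[OF that], of v] Wf(3)[OF that] by (auto simp: e_def)
  define m where "m = (\<lambda>v u. mixed_degree (g # gs) (insert u (insert v \<tau>)))"
  \<comment> \<open>A function b vanishing on \<tau> is moved off v by \<open>b v * e v\<close>; the
    diagonal entry is the effect of that correction. Off the diagonal the nonzero entries are the
    edges of the link, with positive weight by \<open>mpos\<close> below.\<close>
  define Q where "Q = (\<lambda>v u. if u = v then - (\<Sum>G\<in>link (insert v \<tau>). e v G * m v G)
      else if u \<in> link (insert v \<tau>) then m v u else 0)"
  have mpos: "m v u > 0" if "v \<in> W" "u \<in> link (insert v \<tau>)" for u v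
    unfolding m_def using that Wf g card by (intro mixed_degree_pos) (auto simp: link_face link_card)
  have row: "mixed_degree (b # g # gs) (insert v \<tau>) = (\<Sum>u\<in>W. Q v u * b u)"
    if v: "v \<in> W" and b: "\<And>F. F \<in> \<tau> \<Longrightarrow> b F = 0" for v b
  proof -
    have sub: "link (insert v \<tau>) \<subseteq> W - {v}"
      using link_insert_subset[of _ v \<tau>] link_notin[of _ "insert v \<tau>"] by (auto simp: W_def)
    have "mixed_degree (b # g # gs) (insert v \<tau>) = (\<Sum>G\<in>link (insert v \<tau>). (b G - b v * e v G) * m v G)"
      unfolding m_def using Wf v b e by (intro mixed_degree_Cons) (auto intro: Lin_scale)
    also have "\<dots> = (\<Sum>G\<in>link (insert v \<tau>). Q v G * b G) + Q v v * b v"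
      using sub by (auto simp: Q_def algebra_simps sum_subtractf sum_distrib_left intro!: sum.cong)
    also have "(\<Sum>G\<in>link (insert v \<tau>). Q v G * b G) = (\<Sum>G\<in>W - {v}. Q v G * b G)"
      using sub by (intro sum.mono_neutral_left) (auto simp: Q_def W_def)
    finally show ?thesis using v by (simp add: W_def sum.remove[of "link \<tau>" v])
  qed
  define B where "B = (\<lambda>a b. \<Sum>v\<in>W. \<Sum>u\<in>W. Q v u * a v * b u)"
  have form: "mixed_degree (a # b # g # gs) \<tau> = B a b"
    if a: "\<And>F. F \<in> \<tau> \<Longrightarrow> a F = 0" and b: "\<And>F. F \<in> \<tau> \<Longrightarrow> b F = 0" for a b
  proof -
    have "mixed_degree (a # b # g # gs) \<tau> = (\<Sum>v\<in>W. (a v - 0) * mixed_degree (b # g # gs) (insert v \<tau>))"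
      unfolding W_def using \<tau> card a by (intro mixed_degree_Cons) (auto simp: Lin_zero)
    also have "\<dots> = B a b"
      unfolding B_def using row b by (intro sum.cong refl) (simp add: sum_distrib_left mult.commute mult.left_commute)
    finally show ?thesis .
  qed
  obtain l where l: "l \<in> Lin" "\<And>F. F \<in> \<tau> \<Longrightarrow> l F = g F" "\<And>F. F \<in> link \<tau> \<Longrightarrow> l F < g F"
    using ampleE[OF g(1) \<tau>] by blast
  \<comment> \<open>The same class as g, but vanishing on \<tau> and positive on the link: the
    positive vector of the Perron--Frobenius argument. The vector q below is its image under
    Q.\<close>
  define k where "k = (\<lambda>F. g F - l F)"
  have k0: "k F = 0" if "F \<in> \<tau>" for F using l that by (simp add: k_def)
  define q where "q = (\<lambda>v. mixed_degree (g # g # gs) (insert v \<tau>))"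
  have q: "q v = (\<Sum>u\<in>W. Q v u * k u)" "q v > 0" if "v \<in> W" for v
  proof -
    have "mixed_degree (k # g # gs) (insert v \<tau>) = q v"
      unfolding k_def q_def using Wf[OF that] l by (intro mixed_degree_lin_part) auto
    then show "q v = (\<Sum>u\<in>W. Q v u * k u)" using row[OF that k0] by simp
    show "q v > 0" unfolding q_def using Wf[OF that] g by (intro mixed_degree_pos) auto
  qed
  have bochner: "B b b \<le> (\<Sum>v\<in>W. k v * (\<Sum>u\<in>W. Q v u * b u)\<^sup>2 / q v)" for b
  proof -
    \<comment> \<open>Cutting b off outside the link makes it vanish on \<tau> without changing B b
      b. Pulling the fixed factor g to the front and expanding it by k then writes B b b as a
      positive combination of the forms on the larger faces, where \<open>IH\<close>
      applies.\<close>
    define b0 where "b0 = (\<lambda>F. if F \<in> W then b F else 0)"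
    have z: "b0 F = 0" if "F \<in> \<tau>" for F using that Wf by (auto simp: b0_def)
    have "B b b = B b0 b0" unfolding B_def b0_def by (intro sum.cong refl) simp
    also have "\<dots> = mixed_degree (b0 # b0 # g # gs) \<tau>" using form z by simp
    also have "\<dots> = mixed_degree (g # b0 # b0 # gs) \<tau>" using \<tau> card by (intro mixed_degree_perm) auto
    also have "\<dots> = (\<Sum>v\<in>W. (g v - l v) * mixed_degree (b0 # b0 # gs) (insert v \<tau>))"
      unfolding W_def using \<tau> card l by (intro mixed_degree_Cons) auto
    also have "\<dots> \<le> (\<Sum>v\<in>W. k v * (\<Sum>u\<in>W. Q v u * b u)\<^sup>2 / q v)"
    proof (intro sum_mono)
      fix v assume v: "v \<in> W"
      have "mixed_degree (g # b0 # gs) (insert v \<tau>) = mixed_degree (b0 # g # gs) (insert v \<tau>)"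
        using Wf[OF v] by (intro mixed_degree_swap) auto
      also have "\<dots> = (\<Sum>u\<in>W. Q v u * b0 u)" using row v z by simp
      also have "\<dots> = (\<Sum>u\<in>W. Q v u * b u)" by (simp add: b0_def)
      finally have "q v * mixed_degree (b0 # b0 # gs) (insert v \<tau>) \<le> (\<Sum>u\<in>W. Q v u * b u)\<^sup>2"
        using IH[of v b0] v by (simp add: q_def W_def)
      then have "mixed_degree (b0 # b0 # gs) (insert v \<tau>) \<le> (\<Sum>u\<in>W. Q v u * b u)\<^sup>2 / q v"
        using q(2)[OF v] by (simp add: field_simps)
      moreover have "g v - l v > 0" using l v by (auto simp: W_def)
      ultimately show "(g v - l v) * mixed_degree (b0 # b0 # gs) (insert v \<tau>) \<le> k v * (\<Sum>u\<in>W. Q v u * b u)\<^sup>2 / q v"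
        unfolding k_def times_divide_eq_right[symmetric] by (intro mult_left_mono) auto
    qed
    finally show ?thesis .
  qed
  have rcs: "B b b * B k k \<le> (B b k)\<^sup>2" for b
    unfolding B_def
  proof (rule bochner_reverse_cauchy_schwarz)
    show "finite W" by (simp add: W_def)
    show "Q u v = Q v u" if "u \<in> W" "v \<in> W" for u v
      using link_link_swap[of u \<tau> v] that by (auto simp: Q_def m_def W_def insert_commute)
    show "Q u v \<ge> 0" if "u \<in> W" "v \<in> W" "u \<noteq> v" for u v
      using that mpos[of u v] by (auto simp: Q_def)
    show "h u = h v" if hh: "\<And>u v. u \<in> W \<Longrightarrow> v \<in> W \<Longrightarrow> u \<noteq> v \<Longrightarrow> Q u v \<noteq> 0 \<Longrightarrow> h u = h v"
      and "u \<in> W" "v \<in> W" for h :: "'v \<Rightarrow> real" and u v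
    proof (rule link_connected[OF \<tau>, of h])
      show "h u = h v" if uv: "u \<in> link \<tau>" "v \<in> link (insert u \<tau>)" for u v
      proof (rule hh)
        show "u \<in> W" "v \<in> W" "u \<noteq> v" using uv link_insert_subset[of v u \<tau>] link_notin[of v "insert u \<tau>"] by (auto simp: W_def)
        then show "Q u v \<noteq> 0" using uv mpos[of u v] by (auto simp: Q_def)
      qed
    qed (use card that in \<open>auto simp: W_def\<close>)
    show "k v > 0" if "v \<in> W" for v using l that by (auto simp: k_def W_def)
    show "q v = (\<Sum>u\<in>W. Q v u * k u)" "q v > 0" if "v \<in> W" for v using q that by auto
    show "(\<Sum>v\<in>W. \<Sum>u\<in>W. Q v u * b v * b u) \<le> (\<Sum>v\<in>W. k v * (\<Sum>u\<in>W. Q v u * b u)\<^sup>2 / q v)" for b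
      using bochner by (simp add: B_def)
  qed
  \<comment> \<open>Here b need not vanish on \<tau>, so its linear part is removed before
    \<open>form\<close> can be applied.\<close>
  define b0 where "b0 = (\<lambda>F. b F - lin_part \<tau> b F)"
  have z: "b0 F = 0" if "F \<in> \<tau>" for F using that \<tau> by (simp add: b0_def lin_part_eq)
  have red: "mixed_degree ((\<lambda>F. a F - l F) # (\<lambda>F. a' F - l' F) # g # gs) \<tau> = mixed_degree (a # a' # g # gs) \<tau>"
    if "l \<in> Lin" "l' \<in> Lin" for a l a' l'
    using mixed_degree_lin_part[OF \<tau> _ that(1), of "(\<lambda>F. a' F - l' F) # g # gs" a]
      mixed_degree_lin_part2[OF \<tau> card that(2), of a a'] card by simp
  have "B b0 b0 = mixed_degree (b # b # g # gs) \<tau>" "B b0 k = mixed_degree (b # g # g # gs) \<tau>"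
    "B k k = mixed_degree (g # g # g # gs) \<tau>"
    using form[of b0 b0] form[of b0 k] form[of k k] z k0
      red[OF lin_part_Lin[OF \<tau>] lin_part_Lin[OF \<tau>], of b b b b] red[OF lin_part_Lin[OF \<tau>] l(1), of b b g]
      red[OF l(1) l(1), of g g]
    by (simp_all add: b0_def[symmetric] k_def[symmetric])
  then show ?thesis using rcs[of b0] by simp
qed

text \<open>The first fixed factor g serves as the reference direction: by
  \<open>hodge_index_step\<close> the form is nonpositive on the classes whose degree against g is
  0, and the hyperplane lemma passes from g to a. For an empty list the functional of
  \<open>surface_index\<close> takes the place of the degree against g.\<close>

theorem hodge_index:
  assumes "face \<tau>" "card \<tau> + Suc (Suc (length as)) = r" "\<And>a. a \<in> set as \<Longrightarrow> ample a" "ample a"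
  shows "mixed_degree (a # a # as) \<tau> * mixed_degree (b # b # as) \<tau> \<le> (mixed_degree (a # b # as) \<tau>)\<^sup>2"
  using assms
proof (induction as arbitrary: \<tau> a b)
  case Nil
  obtain \<alpha> :: "('v \<Rightarrow> real) \<Rightarrow> real" where \<alpha>: "\<And>a b s t. \<alpha> (\<lambda>F. s * a F + t * b F) = s * \<alpha> a + t * \<alpha> b"
    "\<And>c. \<alpha> c = 0 \<Longrightarrow> mixed_degree [c, c] \<tau> \<le> 0"
    using surface_index[of \<tau>] Nil by auto
  show ?case
  proof (rule reverse_cauchy_schwarz_of_hyperplane)
    show "s\<^sup>2 * mixed_degree [a, a] \<tau> + 2 * s * t * mixed_degree [a, b] \<tau> + t\<^sup>2 * mixed_degree [b, b] \<tau> \<le> 0"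
      if "s * \<alpha> a + t * \<alpha> b = 0" for s t
      using \<alpha>(2)[of "\<lambda>F. s * a F + t * b F"] that mixed_degree_quad[of \<tau> "[]" s a t b] Nil
      by (simp add: \<alpha>(1) del: mixed_degree.simps)
    show "mixed_degree [a, a] \<tau> \<ge> 0"
      using Nil by (intro less_imp_le mixed_degree_pos) auto
  qed
next
  case (Cons g gs)
  have step: "mixed_degree (b # b # g # gs) \<tau> * mixed_degree (g # g # g # gs) \<tau> \<le> (mixed_degree (b # g # g # gs) \<tau>)\<^sup>2" for b
    using Cons.prems by (intro hodge_index_step Cons.IH) (auto simp: link_face link_card)
  have pos: "mixed_degree (g # g # g # gs) \<tau> > 0"
    using Cons.prems by (intro mixed_degree_pos) auto
  show ?case
  proof (rule reverse_cauchy_schwarz_of_hyperplane)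
    show "s\<^sup>2 * mixed_degree (a # a # g # gs) \<tau> + 2 * s * t * mixed_degree (a # b # g # gs) \<tau> + t\<^sup>2 * mixed_degree (b # b # g # gs) \<tau> \<le> 0"
      if z: "s * mixed_degree (a # g # g # gs) \<tau> + t * mixed_degree (b # g # g # gs) \<tau> = 0" for s t
    proof -
      let ?c = "\<lambda>F. s * a F + t * b F"
      have "mixed_degree (?c # ?c # g # gs) \<tau> * mixed_degree (g # g # g # gs) \<tau> \<le> 0"
        using step[of ?c] z by (simp add: mixed_degree_linear del: mixed_degree.simps)
      then show ?thesis using pos mixed_degree_quad[OF Cons.prems(1,2), of s a t b]
        by (simp add: mult_le_0_iff del: mixed_degree.simps)
    qed
    show "mixed_degree (a # a # g # gs) \<tau> \<ge> 0"
      using Cons.prems by (intro less_imp_le mixed_degree_pos) auto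
  qed
qed

end

section \<open>Flats and flags of matroids\<close>

locale rank_matroid =
  fixes M :: "'a matroid" and r :: nat
  assumes matroid: "is_matroid M" and loopless: "loopless M" and rank: "rank M = r + 1"
begin

abbreviation "E \<equiv> ground M"
abbreviation "rk \<equiv> rank_of M"

section \<open>Rank, bases and closures\<close>

lemma finite_E: "finite E"
  and indep_subset: "I \<in> indeps M \<Longrightarrow> I \<subseteq> E"
  and indep_empty: "{} \<in> indeps M"
  and indep_mono: "I \<in> indeps M \<Longrightarrow> J \<subseteq> I \<Longrightarrow> J \<in> indeps M"
  and augment: "I \<in> indeps M \<Longrightarrow> J \<in> indeps M \<Longrightarrow> card I < card J \<Longrightarrow> \<exists>e\<in>J - I. insert e I \<in> indeps M"
  using matroid unfolding is_matroid_def by blast+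

lemma finite_indep: "I \<in> indeps M \<Longrightarrow> finite I"
  using indep_subset finite_E finite_subset by blast

lemma finite_indeps: "finite (indeps M)"
  using indep_subset finite_E by (intro finite_subset[of "indeps M" "Pow E"]) auto

lemma card_le_rk: "I \<in> indeps M \<Longrightarrow> I \<subseteq> S \<Longrightarrow> card I \<le> rk S"
  unfolding rank_of_def using finite_indeps by (intro Max_ge) auto

lemma rk_basis: "\<exists>I\<in>indeps M. I \<subseteq> S \<and> card I = rk S"
proof -
  have "rk S \<in> card ` {I \<in> indeps M. I \<subseteq> S}"
    unfolding rank_of_def using finite_indeps indep_empty by (intro Max_in) auto
  then show ?thesis by auto
qed

lemma rk_mono: "S \<subseteq> T \<Longrightarrow> rk S \<le> rk T"
  using rk_basis[of S] card_le_rk[of _ T] by fastforce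

lemma extend_to_basis:
  assumes "J \<in> indeps M" "J \<subseteq> S"
  shows "\<exists>K\<in>indeps M. J \<subseteq> K \<and> K \<subseteq> S \<and> card K = rk S"
  using assms
proof (induction "rk S - card J" arbitrary: J)
  case 0
  then show ?case using card_le_rk[of J S] by auto
next
  case (Suc n)
  obtain I where I: "I \<in> indeps M" "I \<subseteq> S" "card I = rk S" using rk_basis by blast
  then obtain e where e: "e \<in> I - J" "insert e J \<in> indeps M"
    using augment[of J I] Suc by (metis zero_less_Suc zero_less_diff)
  then have "n = rk S - card (insert e J)" using Suc finite_indep[of J] by simp
  moreover have "insert e J \<subseteq> S" using e(1) I(2) Suc.prems(2) by blast
  ultimately have "\<exists>K\<in>indeps M. insert e J \<subseteq> K \<and> K \<subseteq> S \<and> card K = rk S"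
    using e(2) by (intro Suc(1))
  then show ?case by blast
qed

text \<open>Augmenting K from a basis of \<open>insert y F\<close> adds an element that cannot lie
  in F, where K already has full rank, so it must be y.\<close>

lemma basis_insert_indep:
  assumes "is_flat M F" "K \<in> indeps M" "K \<subseteq> F" "card K = rk F" "y \<in> E - F"
  shows "insert y K \<in> indeps M"
proof -
  have lt: "rk F < rk (insert y F)" using assms by (auto simp: is_flat_def)
  obtain I where I: "I \<in> indeps M" "I \<subseteq> insert y F" "card I = rk (insert y F)"
    using rk_basis by blast
  then obtain e where e: "e \<in> I - K" "insert e K \<in> indeps M"
    using augment[of K I] assms lt by auto
  have "e \<notin> F"
    using card_le_rk[OF e(2), of F] assms e finite_indep[of K] by auto
  then show ?thesis using e I by auto
qed

text \<open>C is the closure of J, a basis of A together with x. It is minimal because an element y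
  of C outside a flat B above \<open>insert x A\<close> could be added to a basis of B extending J,
  which would make J with y independent.\<close>

lemma flat_cover:
  assumes "is_flat M A" "x \<in> E - A"
  shows "\<exists>C. is_flat M C \<and> insert x A \<subseteq> C \<and> rk C = Suc (rk A) \<and>
    (\<forall>B. is_flat M B \<longrightarrow> insert x A \<subseteq> B \<longrightarrow> C \<subseteq> B)"
proof -
  have AE: "A \<subseteq> E" using assms by (auto simp: is_flat_def)
  obtain I where I: "I \<in> indeps M" "I \<subseteq> A" "card I = rk A" using rk_basis by blast
  define J where "J = insert x I"
  have J: "J \<in> indeps M" using basis_insert_indep[OF assms(1) I assms(2)] by (simp add: J_def)
  have "x \<notin> I" using I assms by blast
  then have cJ: "card J = Suc (rk A)" using I finite_indep[of I] by (simp add: J_def)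
  define C where "C = {y \<in> E. y \<in> J \<or> insert y J \<notin> indeps M}"
  have JC: "J \<subseteq> C" using indep_subset[OF J] by (auto simp: C_def)
  have "rk C \<le> card J"
  proof (rule ccontr)
    assume "\<not> rk C \<le> card J"
    moreover obtain K where K: "K \<in> indeps M" "K \<subseteq> C" "card K = rk C" using rk_basis by blast
    ultimately obtain e where "e \<in> K - J" "insert e J \<in> indeps M" using augment[OF J, of K] by auto
    then show False using K by (auto simp: C_def)
  qed
  then have rC: "rk C = Suc (rk A)" using card_le_rk[OF J JC] cJ by simp
  have "is_flat M C"
    unfolding is_flat_def
  proof (intro conjI ballI)
    fix y assume y: "y \<in> E - C"
    then have "insert y J \<in> indeps M" "y \<notin> J" by (auto simp: C_def)
    then have "card (insert y J) \<le> rk (insert y C)" using JC by (intro card_le_rk) auto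
    then show "rk C < rk (insert y C)" using rC cJ \<open>y \<notin> J\<close> finite_indep[OF J] by simp
  qed (auto simp: C_def)
  moreover have "A \<subseteq> C"
  proof
    fix y assume y: "y \<in> A"
    show "y \<in> C"
    proof (rule ccontr)
      assume "y \<notin> C"
      then have yJ: "insert y J \<in> indeps M" "y \<notin> J" using y AE by (auto simp: C_def)
      then have yI: "insert y I \<in> indeps M" using indep_mono[of "insert y J"] by (auto simp: J_def)
      then have "card (insert y I) \<le> rk A" using y I by (intro card_le_rk) auto
      then show False using I yJ finite_indep[of I] by (auto simp: J_def)
    qed
  qed
  moreover have "C \<subseteq> B" if B: "is_flat M B" "insert x A \<subseteq> B" for B
  proof
    fix y assume y: "y \<in> C"
    show "y \<in> B"
    proof (rule ccontr)
      assume yB: "y \<notin> B"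
      have JB: "J \<subseteq> B" using B I by (auto simp: J_def)
      obtain K where K: "K \<in> indeps M" "J \<subseteq> K" "K \<subseteq> B" "card K = rk B"
        using extend_to_basis[OF J JB] by blast
      then have "insert y K \<in> indeps M" using y yB by (intro basis_insert_indep[OF B(1)]) (auto simp: C_def)
      then have "insert y J \<in> indeps M" using K indep_mono by blast
      then show False using y yB JB by (auto simp: C_def)
    qed
  qed
  ultimately show ?thesis using rC JC by (auto simp: J_def)
qed

lemma flat_subset: "is_flat M F \<Longrightarrow> F \<subseteq> E" by (simp add: is_flat_def)

lemma rk_strict_mono:
  assumes "is_flat M F" "is_flat M G" "F \<subset> G"
  shows "rk F < rk G"
proof -
  obtain x where x: "x \<in> G - F" using assms by blast
  then have "rk F < rk (insert x F)" using assms flat_subset[of G] by (auto simp: is_flat_def)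
  also have "\<dots> \<le> rk G" using assms x by (intro rk_mono) auto
  finally show ?thesis .
qed

lemma flat_E: "is_flat M E" by (simp add: is_flat_def)

lemma rk_empty: "rk {} = 0"
  using rk_basis[of "{}"] by auto

lemma flat_empty: "is_flat M {}"
  unfolding is_flat_def
proof (intro conjI ballI)
  fix e assume "e \<in> E - {}"
  then have "card {e} \<le> rk {e}" using loopless by (intro card_le_rk) (auto simp: loopless_def)
  then show "rk {} < rk {e}" by (simp add: rk_empty)
qed simp

definition cover :: "'a set \<Rightarrow> 'a \<Rightarrow> 'a set" where
  "cover A x = (SOME C. is_flat M C \<and> insert x A \<subseteq> C \<and> rk C = Suc (rk A) \<and>
    (\<forall>B. is_flat M B \<longrightarrow> insert x A \<subseteq> B \<longrightarrow> C \<subseteq> B))"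

lemma cover:
  assumes "is_flat M A" "x \<in> E - A"
  shows "is_flat M (cover A x)" "x \<in> cover A x" "A \<subset> cover A x" "rk (cover A x) = Suc (rk A)"
    "\<And>B. is_flat M B \<Longrightarrow> insert x A \<subseteq> B \<Longrightarrow> cover A x \<subseteq> B"
  using someI_ex[OF flat_cover[OF assms]] assms unfolding cover_def[symmetric] by auto

text \<open>Hence the flats covering A partition the ground set outside A. Balancing and the count
  of lines through two points come from this.\<close>

lemma cover_unique:
  assumes "is_flat M A" "is_flat M F" "A \<subseteq> F" "x \<in> F - A" "rk F = Suc (rk A)"
  shows "F = cover A x"
proof (rule ccontr)
  assume "F \<noteq> cover A x"
  moreover have xE: "x \<in> E - A" using assms flat_subset by blast
  ultimately have "cover A x \<subset> F" using cover(5)[OF assms(1) xE assms(2)] assms by auto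
  then show False using rk_strict_mono[OF cover(1)[OF assms(1) xE] assms(2)] assms cover(4)[OF assms(1) xE] by simp
qed

lemma atom_subset_of_mem:
  assumes "is_flat M A" "is_flat M q" "is_flat M F" "A \<subseteq> q" "rk q = Suc (rk A)" "x \<in> q - A" "x \<in> F" "A \<subseteq> F"
  shows "q \<subseteq> F"
proof -
  have "q = cover A x" using assms by (intro cover_unique) auto
  then show ?thesis using assms cover(5)[of A x F] flat_subset[of q] by auto
qed

lemma proper_flat_rk:
  assumes "F \<in> proper_flats M"
  shows "1 \<le> rk F" "rk F \<le> r"
proof -
  have F: "is_flat M F" "{} \<subset> F" "F \<subset> E" using assms flat_subset by (auto simp: proper_flats_def)
  show "1 \<le> rk F" using rk_strict_mono[OF flat_empty F(1,2)] by simp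
  show "rk F \<le> r" using rk_strict_mono[OF F(1) flat_E F(3)] rank by simp
qed

section \<open>Flags of flats, their gaps and their links\<close>

definition chain :: "'a set set \<Rightarrow> bool" where
  "chain \<tau> \<longleftrightarrow> \<tau> \<subseteq> proper_flats M \<and> (\<forall>F\<in>\<tau>. \<forall>G\<in>\<tau>. F \<subseteq> G \<or> G \<subseteq> F)"

text \<open>The improper flats act as sentinels, so that every flat of the link lies between two
  consecutive members.\<close>

definition ext :: "'a set set \<Rightarrow> 'a set set" where
  "ext \<tau> = insert {} (insert E \<tau>)"

text \<open>The number of missing ranks is the corank of the flag, see
  \<open>card_missing\<close>.\<close>

definition missing :: "'a set set \<Rightarrow> nat set" where
  "missing \<tau> = {1..r} - rk ` \<tau>"

text \<open>This is \<open>link\<close> of the complex of flags, available before the locale axioms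
  for that complex are proved; \<open>link_eq_chain_link\<close> identifies the two.\<close>

definition chain_link :: "'a set set \<Rightarrow> 'a set set" where
  "chain_link \<tau> = {F. F \<notin> \<tau> \<and> chain (insert F \<tau>)}"

lemma finite_proper_flats: "finite (proper_flats M)"
  by (rule finite_subset[of _ "Pow E"]) (auto simp: proper_flats_def finite_E dest: flat_subset)

lemma chain_finite: "chain \<tau> \<Longrightarrow> finite \<tau>"
  unfolding chain_def using finite_proper_flats finite_subset by blast

lemma chain_mono: "chain \<tau> \<Longrightarrow> \<sigma> \<subseteq> \<tau> \<Longrightarrow> chain \<sigma>"
  unfolding chain_def by (meson subset_iff subset_trans)

lemma chain_insert_iff:
  "chain (insert F \<tau>) \<longleftrightarrow> F \<in> proper_flats M \<and> chain \<tau> \<and> (\<forall>G\<in>\<tau>. F \<subseteq> G \<or> G \<subseteq> F)"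
proof -
  have "(\<forall>G\<in>\<tau>. G \<subseteq> F \<or> F \<subseteq> G) \<longleftrightarrow> (\<forall>G\<in>\<tau>. F \<subseteq> G \<or> G \<subseteq> F)" by (simp only: disj_commute)
  then show ?thesis by (simp add: chain_def ball_conj_distrib conj_ac)
qed

lemma chain_link_iff:
  "F \<in> chain_link \<tau> \<longleftrightarrow> F \<notin> \<tau> \<and> F \<in> proper_flats M \<and> chain \<tau> \<and> (\<forall>G\<in>\<tau>. F \<subseteq> G \<or> G \<subseteq> F)"
  by (simp add: chain_link_def chain_insert_iff)

lemma ext_flat: "chain \<tau> \<Longrightarrow> G \<in> ext \<tau> \<Longrightarrow> is_flat M G"
  using flat_E flat_empty by (auto simp: ext_def chain_def proper_flats_def)

lemma ext_comparable:
  assumes "chain \<tau>" "F \<in> ext \<tau>" "G \<in> ext \<tau>"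
  shows "F \<subseteq> G \<or> G \<subseteq> F"
proof (cases "F \<in> \<tau> \<and> G \<in> \<tau>")
  case True
  then show ?thesis using assms(1) by (simp add: chain_def)
next
  case False
  then have "F = {} \<or> F = E \<or> G = {} \<or> G = E" using assms by (auto simp: ext_def)
  then show ?thesis using assms ext_flat[THEN flat_subset] by (elim disjE) auto
qed

lemma ext_link_comparable:
  assumes F: "F \<in> chain_link \<tau>" and G: "G \<in> ext \<tau>"
  shows "F \<subset> G \<or> G \<subset> F"
proof (cases "G \<in> \<tau>")
  case True
  then have "F \<noteq> G" "F \<subseteq> G \<or> G \<subseteq> F" using F by (auto simp: chain_link_iff)
  then show ?thesis by blast
next
  case False
  then have "G = {} \<or> G = E" using G by (simp add: ext_def)
  moreover have "F \<noteq> {}" "F \<noteq> E" "F \<subseteq> E" using F flat_subset by (auto simp: chain_link_iff proper_flats_def)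
  ultimately show ?thesis by blast
qed

lemma link_flat: "F \<in> chain_link \<tau> \<Longrightarrow> is_flat M F"
  by (simp add: chain_link_iff proper_flats_def)

lemma link_chain: "F \<in> chain_link \<tau> \<Longrightarrow> chain \<tau>"
  by (simp add: chain_link_iff)

lemma ext_rk_le:
  assumes "chain \<tau>" "F \<in> ext \<tau>" "G \<in> ext \<tau>"
  shows "rk F \<le> rk G \<longleftrightarrow> F \<subseteq> G"
proof
  assume le: "rk F \<le> rk G"
  show "F \<subseteq> G"
  proof (rule ccontr)
    assume "\<not> F \<subseteq> G"
    then have "G \<subset> F" using ext_comparable[OF assms] by blast
    then show False using rk_strict_mono[OF ext_flat[OF assms(1,3)] ext_flat[OF assms(1,2)]] le by simp
  qed
qed (rule rk_mono)

lemma link_rk_less: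
  assumes "F \<in> chain_link \<tau>" "G \<in> ext \<tau>"
  shows "rk F < rk G \<longleftrightarrow> F \<subset> G" "rk G < rk F \<longleftrightarrow> G \<subset> F"
proof -
  have fl: "is_flat M F" "is_flat M G" using link_flat[OF assms(1)] ext_flat[OF link_chain] assms by auto
  show "rk F < rk G \<longleftrightarrow> F \<subset> G" "rk G < rk F \<longleftrightarrow> G \<subset> F"
    using ext_link_comparable[OF assms] rk_strict_mono[OF fl] rk_strict_mono[OF fl(2,1)] by force+
qed

lemma inj_on_rk:
  assumes "chain \<tau>"
  shows "inj_on rk \<tau>"
proof (rule inj_onI)
  fix F G assume "F \<in> \<tau>" "G \<in> \<tau>" "rk F = rk G"
  then show "F = G" using ext_rk_le[OF assms, of F G] ext_rk_le[OF assms, of G F] by (simp add: ext_def)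
qed

lemma rk_chain: "chain \<tau> \<Longrightarrow> rk ` \<tau> \<subseteq> {1..r}"
  using proper_flat_rk by (auto simp: chain_def)

lemma card_missing: "chain \<tau> \<Longrightarrow> card (missing \<tau>) + card \<tau> = r"
  using card_Diff_subset[of "rk ` \<tau>" "{1..r}"] rk_chain[of \<tau>] chain_finite[of \<tau>]
    card_image[OF inj_on_rk, of \<tau>] card_mono[of "{1..r}" "rk ` \<tau>"] by (simp add: missing_def)

lemma missing_insert: "F \<in> chain_link \<tau> \<Longrightarrow> missing (insert F \<tau>) = missing \<tau> - {rk F}"
  by (auto simp: missing_def)

lemma rk_link_missing:
  assumes F: "F \<in> chain_link \<tau>"
  shows "rk F \<in> missing \<tau>"
proof -
  have "chain (insert F \<tau>)" "F \<notin> \<tau>" using F by (auto simp: chain_link_def)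
  then have "rk F \<notin> rk ` \<tau>" using inj_on_rk[of "insert F \<tau>"] by auto
  then show ?thesis using F proper_flat_rk[of F] by (auto simp: missing_def chain_link_iff)
qed

lemma ext_rk_cases: "k \<le> r + 1 \<Longrightarrow> k \<notin> missing \<tau> \<Longrightarrow> \<exists>G\<in>ext \<tau>. rk G = k"
  using rk_empty rank by (cases "k = 0 \<or> k = r + 1") (auto simp: missing_def ext_def image_iff)

text \<open>Consecutive members of the extended flag. The link is the join of the open intervals
  between them, so questions about links reduce to single intervals.\<close>

definition gap :: "'a set set \<Rightarrow> 'a set \<Rightarrow> 'a set \<Rightarrow> bool" where
  "gap \<tau> A B \<longleftrightarrow> A \<in> ext \<tau> \<and> B \<in> ext \<tau> \<and> A \<subset> B \<and> (\<forall>G\<in>ext \<tau>. G \<subseteq> A \<or> B \<subseteq> G)"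

text \<open>A is the member of largest rank below k and B the one of smallest rank above k. They are
  consecutive because containment within a flag is the order by rank and no member has rank
  k.\<close>

lemma gap_exists:
  assumes \<tau>: "chain \<tau>" and k: "k \<in> missing \<tau>"
  shows "\<exists>A B. gap \<tau> A B \<and> rk A < k \<and> k < rk B"
proof -
  have fin: "finite (ext \<tau>)" using chain_finite[OF \<tau>] by (simp add: ext_def)
  have kr: "1 \<le> k" "k \<le> r" using k by (auto simp: missing_def)
  have nk: "rk G \<noteq> k" if "G \<in> ext \<tau>" for G
    using that k kr rk_empty rank by (auto simp: ext_def missing_def)
  have "{} \<in> {G \<in> ext \<tau>. rk G < k}" using kr rk_empty by (auto simp: ext_def)
  then have "Max (rk ` {G \<in> ext \<tau>. rk G < k}) \<in> rk ` {G \<in> ext \<tau>. rk G < k}"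
    using fin by (intro Max_in) auto
  then obtain A where A: "A \<in> ext \<tau>" "rk A < k" "rk A = Max (rk ` {G \<in> ext \<tau>. rk G < k})" by auto
  have Amax: "rk G \<le> rk A" if "G \<in> ext \<tau>" "rk G < k" for G
    unfolding A(3) using fin that by (intro Max_ge) auto
  have "E \<in> {G \<in> ext \<tau>. k < rk G}" using kr rank by (auto simp: ext_def)
  then have "Min (rk ` {G \<in> ext \<tau>. k < rk G}) \<in> rk ` {G \<in> ext \<tau>. k < rk G}"
    using fin by (intro Min_in) auto
  then obtain B where B: "B \<in> ext \<tau>" "k < rk B" "rk B = Min (rk ` {G \<in> ext \<tau>. k < rk G})" by auto
  have Bmin: "rk B \<le> rk G" if "G \<in> ext \<tau>" "k < rk G" for G
    unfolding B(3) using fin that by (intro Min_le) auto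
  have "G \<subseteq> A \<or> B \<subseteq> G" if "G \<in> ext \<tau>" for G
    using Amax[OF that] Bmin[OF that] A(1) B(1) nk[OF that] that ext_rk_le[OF \<tau>, of G A] ext_rk_le[OF \<tau>, of B G] by (meson linorder_neqE_nat)
  moreover have "A \<subset> B" using ext_rk_le[OF \<tau> A(1) B(1)] ext_rk_le[OF \<tau> B(1) A(1)] A(2) B(2) by auto
  ultimately show ?thesis using A(1,2) B(1,2) unfolding gap_def by blast
qed

lemma gap_link:
  assumes \<tau>: "chain \<tau>" and g: "gap \<tau> A B" and F: "is_flat M F" "A \<subset> F" "F \<subset> B"
  shows "F \<in> chain_link \<tau>"
proof -
  have AB: "A \<in> ext \<tau>" "B \<in> ext \<tau>" "\<And>G. G \<in> ext \<tau> \<Longrightarrow> G \<subseteq> A \<or> B \<subseteq> G" using g by (auto simp: gap_def)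
  have "F \<notin> ext \<tau>" using AB(3)[of F] F by auto
  moreover have "F \<subseteq> G \<or> G \<subseteq> F" if "G \<in> \<tau>" for G
    using AB(3)[of G] that F by (auto simp: ext_def)
  ultimately show ?thesis using F \<tau> by (auto simp: chain_link_iff ext_def proper_flats_def)
qed

lemma gap_flats:
  assumes "chain \<tau>" "gap \<tau> A B"
  shows "is_flat M A" "is_flat M B" "A \<subset> B" "A \<subseteq> E" "B \<subseteq> E"
  using assms ext_flat flat_subset by (auto simp: gap_def)

lemma link_gap_exists:
  assumes F: "F \<in> chain_link \<tau>"
  shows "\<exists>A B. gap \<tau> A B \<and> A \<subset> F \<and> F \<subset> B"
proof -
  have \<tau>: "chain \<tau>" using F by (simp add: chain_link_iff)
  obtain A B where AB: "gap \<tau> A B" "rk A < rk F" "rk F < rk B"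
    using gap_exists[OF \<tau> rk_link_missing[OF F]] by blast
  then show ?thesis using link_rk_less[OF F, of B] link_rk_less[OF F, of A] by (auto simp: gap_def)
qed

lemma chain_extend:
  assumes \<tau>: "chain \<tau>" and g: "gap \<tau> A B" and k: "rk A < k" "k < rk B"
  shows "\<exists>F\<in>chain_link \<tau>. A \<subset> F \<and> F \<subset> B"
proof -
  note f = gap_flats[OF \<tau> g]
  obtain x where x: "x \<in> B - A" using f by blast
  then have xE: "x \<in> E - A" using f by blast
  have "cover A x \<subset> B"
    using cover[OF f(1) xE] cover(5)[OF f(1) xE f(2)] x f k by auto
  then show ?thesis using gap_link[OF \<tau> g] cover[OF f(1) xE] by blast
qed

end

section \<open>The Bergman complex is balanced\<close>

context rank_matroid
begin

text \<open>Weights of sum zero are spanned by differences of two unit weights, so these functions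
  are the linear relations of the Chow ring. Intersecting with E keeps the sum finite for every
  set.\<close>

definition modular_functions :: "('a set \<Rightarrow> real) set" where
  "modular_functions = {l. \<exists>w. (\<Sum>x\<in>E. w x) = 0 \<and> l = (\<lambda>F. \<Sum>x\<in>F \<inter> E. w x)}"

lemma indicator_diff_modular:
  assumes "i \<in> E" "j \<in> E"
  shows "(\<lambda>F. of_bool (i \<in> F) - of_bool (j \<in> F)) \<in> modular_functions"
proof -
  have "(\<Sum>x\<in>F \<inter> E. of_bool (x = i) - of_bool (x = j)) = (of_bool (i \<in> F) - of_bool (j \<in> F) :: real)" for F
    using assms finite_E by (simp add: sum_subtractf of_bool_def sum.delta)
  moreover from this[of E] have "(\<Sum>x\<in>E. of_bool (x = i) - of_bool (x = j)) = (0 :: real)"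
    using assms by simp
  ultimately show ?thesis unfolding modular_functions_def
    by (intro CollectI exI[of _ "\<lambda>x. of_bool (x = i) - of_bool (x = j)"]) auto
qed

text \<open>A member of the extended flag lies below A or above B, so it contains both i and j or
  neither. All separating functions for flags are obtained this way.\<close>

lemma gap_coordinate:
  assumes "chain \<tau>" "gap \<tau> A B" "i \<in> F - A" "j \<in> B - F" "F \<subseteq> B"
  defines "l \<equiv> \<lambda>G. of_bool (i \<in> G) - of_bool (j \<in> G) :: real"
  shows "l \<in> modular_functions" "l F = 1" "A \<subseteq> F \<Longrightarrow> G \<in> ext \<tau> \<Longrightarrow> l G = 0"
proof -
  note f = gap_flats[OF assms(1,2)]
  show "l \<in> modular_functions" unfolding l_def using assms f by (intro indicator_diff_modular) auto
  show "l F = 1" using assms by (simp add: l_def)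
  show "l G = 0" if "A \<subseteq> F" "G \<in> ext \<tau>"
  proof -
    have "G \<subseteq> A \<or> B \<subseteq> G" using assms(2) that by (simp add: gap_def)
    then show ?thesis using assms(3,4,5) that(1) unfolding l_def by (elim disjE) (auto simp: of_bool_def)
  qed
qed

lemma ext_rk_not_missing: "G \<in> ext \<tau> \<Longrightarrow> rk G \<notin> missing \<tau>"
  using rk_empty rank by (auto simp: ext_def missing_def)

lemma gap_rk_missing:
  assumes "chain \<tau>" "gap \<tau> A B" "rk A < m" "m < rk B"
  shows "m \<in> missing \<tau>"
proof (rule ccontr)
  assume n: "m \<notin> missing \<tau>"
  have "rk B \<le> r + 1" using rk_mono[OF gap_flats(5)[OF assms(1,2)]] rank by simp
  then obtain G where G: "G \<in> ext \<tau>" "rk G = m" using ext_rk_cases[OF _ n] assms by auto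
  then have "G \<subseteq> A \<or> B \<subseteq> G" using assms(2) by (simp add: gap_def)
  then show False using rk_mono[of G A] rk_mono[of B G] assms G by auto
qed

lemma gap_between:
  assumes "gap \<tau> A B" "F \<in> chain_link \<tau>" "rk A < rk F" "rk F < rk B"
  shows "A \<subset> F" "F \<subset> B"
  using assms link_rk_less[OF assms(2)] by (auto simp: gap_def)

text \<open>Ranks strictly inside a gap are missing and the ranks of its ends are not, so a maximal
  run of missing ranks fills exactly one gap. It is applied to runs of length one and two.\<close>

lemma gap_exact_exists:
  assumes "chain \<tau>" "1 \<le> k" "k \<in> missing \<tau>" "k - 1 \<notin> missing \<tau>" "Suc m \<notin> missing \<tau>" "{k..m} \<subseteq> missing \<tau>" "k \<le> m"
  shows "\<exists>A B. gap \<tau> A B \<and> Suc (rk A) = k \<and> rk B = Suc m"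
proof -
  obtain A B where AB: "gap \<tau> A B" "rk A < k" "k < rk B" using gap_exists[OF assms(1,3)] by blast
  have "k - 1 \<le> rk A" using gap_rk_missing[OF assms(1) AB(1), of "k - 1"] AB assms by (meson leI less_imp_diff_less)
  moreover have "rk B \<le> Suc m" using gap_rk_missing[OF assms(1) AB(1), of "Suc m"] AB assms by (meson leI le_imp_less_Suc less_trans)
  moreover have "rk B \<notin> {k..m}" using ext_rk_not_missing[of B \<tau>] AB(1) assms(6) by (auto simp: gap_def)
  ultimately show ?thesis using AB assms by (intro exI[of _ A] exI[of _ B]) auto
qed

lemma covers_containing:
  assumes "is_flat M A" "is_flat M B" "A \<subset> B" "Suc (rk A) < rk B" "x \<in> B - A"
  shows "{F. is_flat M F \<and> A \<subset> F \<and> F \<subset> B \<and> rk F = Suc (rk A) \<and> x \<in> F} = {cover A x}"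
proof -
  have x: "x \<in> E - A" using assms flat_subset[of B] by auto
  have "cover A x \<subset> B" using cover(4)[OF assms(1) x] cover(5)[OF assms(1) x assms(2)] assms by auto
  moreover have "F = cover A x" if "is_flat M F" "A \<subset> F" "rk F = Suc (rk A)" "x \<in> F" for F
    using that x by (intro cover_unique[OF assms(1)]) auto
  ultimately show ?thesis using cover(1-4)[OF assms(1) x] by blast
qed

text \<open>The link consists of the covers of A inside B, and these partition B - A. Hence the
  values of l add up to the weight of B minus that of A, and both weights are 0 because l vanishes
  on the extended flag.\<close>

lemma chain_balanced:
  assumes \<tau>: "chain \<tau>" and card: "Suc (card \<tau>) = r" and l: "l \<in> modular_functions"
    and l0: "\<And>F. F \<in> \<tau> \<Longrightarrow> l F = 0"
  shows "(\<Sum>F\<in>chain_link \<tau>. l F) = 0"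
proof -
  obtain w where w: "(\<Sum>x\<in>E. w x) = 0" "l = (\<lambda>F. \<Sum>x\<in>F \<inter> E. w x)" using l by (auto simp: modular_functions_def)
  have "card (missing \<tau>) = 1" using card_missing[OF \<tau>] card by simp
  then obtain k where k: "missing \<tau> = {k}" by (auto simp: card_1_singleton_iff)
  then have k1: "1 \<le> k" by (auto simp: missing_def)
  have "\<exists>A B. gap \<tau> A B \<and> Suc (rk A) = k \<and> rk B = Suc k"
    using k k1 by (intro gap_exact_exists[OF \<tau>]) auto
  then obtain A B where AB: "gap \<tau> A B" "Suc (rk A) = k" "rk B = Suc k" by blast
  note f = gap_flats[OF \<tau> AB(1)]
  have link: "chain_link \<tau> = {F. is_flat M F \<and> A \<subset> F \<and> F \<subset> B \<and> rk F = k}" (is "_ = ?S")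
  proof
    show "chain_link \<tau> \<subseteq> ?S"
    proof
      fix F assume F: "F \<in> chain_link \<tau>"
      then have "rk F = k" using rk_link_missing[OF F] k by simp
      then show "F \<in> ?S" using gap_between[OF AB(1) F] AB link_flat[OF F] by auto
    qed
    show "?S \<subseteq> chain_link \<tau>" using gap_link[OF \<tau> AB(1)] by auto
  qed
  have fin: "finite (chain_link \<tau>)"
    by (rule finite_subset[OF _ finite_proper_flats]) (auto simp: chain_link_iff)
  have ext0: "(\<Sum>x\<in>G. w x) = 0" if "G \<in> ext \<tau>" for G
  proof -
    have "G \<subseteq> E" using ext_flat[OF \<tau> that] flat_subset by blast
    then show ?thesis using that l0[of G] w by (auto simp: ext_def Int_absorb2)
  qed
  have finB: "finite B" using f finite_E finite_subset by blast
  have "(\<Sum>F\<in>chain_link \<tau>. l F) = (\<Sum>F\<in>chain_link \<tau>. \<Sum>x\<in>B - A. if x \<in> F then w x else 0)"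
  proof (intro sum.cong refl)
    fix F assume "F \<in> chain_link \<tau>"
    then have F: "A \<subset> F" "F \<subset> B" "F \<subseteq> E" using link f by auto
    have "l F = sum w F" using F w by (simp add: Int_absorb2)
    also have "\<dots> = sum w A + sum w (F - A)"
      using F finB by (subst sum.subset_diff[of A F]) (auto intro: finite_subset)
    also have "sum w A = 0" using ext0 AB(1) by (simp add: gap_def)
    also have "sum w (F - A) = (\<Sum>x\<in>B - A. if x \<in> F then w x else 0)"
      using F finB by (intro sum.mono_neutral_cong_left) auto
    finally show "l F = (\<Sum>x\<in>B - A. if x \<in> F then w x else 0)" by simp
  qed
  also have "\<dots> = (\<Sum>x\<in>B - A. \<Sum>F\<in>chain_link \<tau>. if x \<in> F then w x else 0)"
    by (rule sum.swap)
  also have "\<dots> = (\<Sum>x\<in>B - A. w x)"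
  proof (intro sum.cong refl)
    fix x assume x: "x \<in> B - A"
    have "{F \<in> chain_link \<tau>. x \<in> F} = {cover A x}"
      using covers_containing[OF f(1,2,3) _ x] AB unfolding link by auto
    then show "(\<Sum>F\<in>chain_link \<tau>. if x \<in> F then w x else 0) = w x"
      using fin by (simp add: sum.If_cases Int_def)
  qed
  also have "\<dots> = sum w B - sum w A" using f finB by (intro sum_diff) auto
  also have "\<dots> = 0" using ext0 AB(1) by (simp add: gap_def)
  finally show ?thesis .
qed

lemma chain_extendable:
  assumes "chain \<tau>" "card \<tau> < r"
  shows "chain_link \<tau> \<noteq> {}"
proof -
  have "missing \<tau> \<noteq> {}" using card_missing[OF assms(1)] assms(2) by auto
  then obtain k where "k \<in> missing \<tau>" by blast
  then show ?thesis using gap_exists[OF assms(1)] chain_extend[OF assms(1)] by blast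
qed

text \<open>F lies in the gap that opens when it is removed from the flag. The elements i and j are
  kept explicit so that the function can be recognised as a generator of the Chow ideal when the
  degree map is shown unique.\<close>

lemma flag_separation:
  assumes "chain \<tau>" "F \<in> \<tau>"
  shows "\<exists>i\<in>E. \<exists>j\<in>E. \<forall>G\<in>\<tau>. of_bool (i \<in> G) - of_bool (j \<in> G) = (of_bool (G = F) :: real)"
proof -
  have c: "chain (\<tau> - {F})" using assms chain_mono by blast
  have F: "F \<in> chain_link (\<tau> - {F})" using assms c by (simp add: chain_link_def insert_absorb)
  obtain A B where AB: "gap (\<tau> - {F}) A B" "A \<subset> F" "F \<subset> B" using link_gap_exists[OF F] by blast
  obtain i j where ij: "i \<in> F - A" "j \<in> B - F" using AB by blast
  let ?l = "\<lambda>G. of_bool (i \<in> G) - of_bool (j \<in> G) :: real"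
  have "?l F = 1" "\<And>G. G \<in> ext (\<tau> - {F}) \<Longrightarrow> ?l G = 0"
    using gap_coordinate[OF c AB(1) ij] AB by auto
  then have "\<forall>G\<in>\<tau>. ?l G = of_bool (G = F)" by (auto simp: ext_def)
  moreover have "i \<in> E" "j \<in> E" using ij gap_flats[OF c AB(1)] AB(3) by auto
  ultimately show ?thesis by blast
qed

lemma modular_separates:
  assumes "chain \<tau>" "F \<in> \<tau>"
  shows "\<exists>l\<in>modular_functions. l F = 1 \<and> (\<forall>G\<in>\<tau> - {F}. l G = 0)"
proof -
  obtain i j where "i \<in> E" "j \<in> E"
    "\<forall>G\<in>\<tau>. of_bool (i \<in> G) - of_bool (j \<in> G) = (of_bool (G = F) :: real)"
    using flag_separation[OF assms] by blast
  then show ?thesis using assms(2)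
    by (intro bexI[of _ "\<lambda>G. of_bool (i \<in> G) - of_bool (j \<in> G)"] indicator_diff_modular) auto
qed

end

sublocale rank_matroid \<subseteq> balanced_complex "proper_flats M" chain r modular_functions
proof
  show "finite (proper_flats M)" by (rule finite_proper_flats)
  show "\<And>\<tau>. chain \<tau> \<Longrightarrow> \<tau> \<subseteq> proper_flats M" by (simp add: chain_def)
  show "chain {}" by (simp add: chain_def)
  show "\<And>\<tau> \<sigma>. chain \<tau> \<Longrightarrow> \<sigma> \<subseteq> \<tau> \<Longrightarrow> chain \<sigma>" by (rule chain_mono)
  show "\<And>\<tau>. chain \<tau> \<Longrightarrow> card \<tau> < r \<Longrightarrow> \<exists>F. F \<notin> \<tau> \<and> chain (insert F \<tau>)"
    using chain_extendable by (auto simp: chain_link_def)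
  show "(\<lambda>_. 0) \<in> modular_functions" by (auto simp: modular_functions_def intro!: exI[of _ "\<lambda>_. 0"])
  show "(\<lambda>F. l F + l' F) \<in> modular_functions" if "l \<in> modular_functions" "l' \<in> modular_functions" for l l'
  proof -
    obtain w w' where "(\<Sum>x\<in>E. w x) = 0" "l = (\<lambda>F. \<Sum>x\<in>F \<inter> E. w x)"
      "(\<Sum>x\<in>E. w' x) = 0" "l' = (\<lambda>F. \<Sum>x\<in>F \<inter> E. w' x)"
      using \<open>l \<in> _\<close> \<open>l' \<in> _\<close> unfolding modular_functions_def by blast
    then show ?thesis unfolding modular_functions_def
      by (intro CollectI exI[of _ "\<lambda>x. w x + w' x"]) (simp add: sum.distrib)
  qed
  show "(\<lambda>F. t * l F) \<in> modular_functions" if "l \<in> modular_functions" for l t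
  proof -
    obtain w where "(\<Sum>x\<in>E. w x) = 0" "l = (\<lambda>F. \<Sum>x\<in>F \<inter> E. w x)"
      using \<open>l \<in> _\<close> unfolding modular_functions_def by blast
    then show ?thesis unfolding modular_functions_def
      by (intro CollectI exI[of _ "\<lambda>x. t * w x"]) (simp add: sum_distrib_left[symmetric])
  qed
  show "\<And>\<tau> F. chain \<tau> \<Longrightarrow> F \<in> \<tau> \<Longrightarrow> \<exists>l\<in>modular_functions. l F = 1 \<and> (\<forall>G\<in>\<tau> - {F}. l G = 0)"
    by (rule modular_separates)
  show "(\<Sum>F | F \<notin> \<tau> \<and> chain (insert F \<tau>). l F) = 0"
    if "chain \<tau>" "Suc (card \<tau>) = r" "l \<in> modular_functions" "\<And>F. F \<in> \<tau> \<Longrightarrow> l F = 0" for \<tau> l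
    using chain_balanced[OF that] by (simp add: chain_link_def)
qed

section \<open>Connectivity of links and the surface case\<close>

context rank_matroid
begin

lemma link_eq_chain_link: "link = chain_link"
  by (simp add: fun_eq_iff link_def chain_link_def)

lemma link_insert_iff:
  assumes "F \<in> chain_link \<tau>"
  shows "G \<in> chain_link (insert F \<tau>) \<longleftrightarrow> G \<in> chain_link \<tau> \<and> G \<noteq> F \<and> (F \<subseteq> G \<or> G \<subseteq> F)"
proof -
  have "chain (insert F \<tau>)" "chain \<tau>" using assms by (simp_all add: chain_link_def link_chain[OF assms])
  then show ?thesis by (simp add: chain_link_iff conj_ac disj_commute)
qed

text \<open>Flats in different gaps are comparable, so let the two flats be incomparable in one gap,
  and replace them by atoms below them. The join of the atoms is a common neighbour unless it is all
  of B. In that case the gap is too short to account for the corank, and a flat from another gap is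
  comparable to both.\<close>

lemma chain_link_connected:
  assumes \<tau>: "chain \<tau>" and card: "card \<tau> + 3 \<le> r"
    and h: "\<And>u v. u \<in> chain_link \<tau> \<Longrightarrow> v \<in> chain_link (insert u \<tau>) \<Longrightarrow> h u = h v"
    and uv: "u \<in> chain_link \<tau>" "v \<in> chain_link \<tau>"
  shows "h u = h v"
proof -
  have adj: "h u = h v" if "u \<in> chain_link \<tau>" "v \<in> chain_link \<tau>" "u \<subseteq> v \<or> v \<subseteq> u" for u v
    using h[of u v] that link_insert_iff[of u \<tau> v] by (cases "u = v") auto
  show ?thesis
  proof (cases "u \<subseteq> v \<or> v \<subseteq> u")
    case True
    then show ?thesis using adj uv by blast
  next
    case inc: False
    obtain A B where g: "gap \<tau> A B" and u: "A \<subset> u" "u \<subset> B" using link_gap_exists[OF uv(1)] by blast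
    note f = gap_flats[OF \<tau> g]
    have v: "A \<subset> v" "v \<subset> B"
      using ext_link_comparable[OF uv(2), of A] ext_link_comparable[OF uv(2), of B] g u inc by (auto simp: gap_def)
    note fl = link_flat[OF uv(1)] link_flat[OF uv(2)]
    obtain x y where x: "x \<in> u - A" and y: "y \<in> v - A" using u v by blast
    have xE: "x \<in> E - A" and yE: "y \<in> E - A" using x y flat_subset[OF fl(1)] flat_subset[OF fl(2)] by auto
    define u' where "u' = cover A x"
    define v' where "v' = cover A y"
    have u': "is_flat M u'" "A \<subset> u'" "rk u' = Suc (rk A)" "u' \<subseteq> u"
      using cover[OF f(1) xE] cover(5)[OF f(1) xE fl(1)] x u by (auto simp: u'_def)
    have v': "is_flat M v'" "A \<subset> v'" "rk v' = Suc (rk A)" "v' \<subseteq> v"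
      using cover[OF f(1) yE] cover(5)[OF f(1) yE fl(2)] y v by (auto simp: v'_def)
    have lu': "u' \<in> chain_link \<tau>" using u' u by (intro gap_link[OF \<tau> g]) auto
    have lv': "v' \<in> chain_link \<tau>" using v' v by (intro gap_link[OF \<tau> g]) auto
    have hu: "h u = h u'" using adj[OF uv(1) lu'] u' by blast
    have hv: "h v = h v'" using adj[OF uv(2) lv'] v' by blast
    have "h u' = h v'"
    proof (cases "v' \<subseteq> u'")
      case True
      then show ?thesis using adj[OF lu' lv'] by blast
    next
      case False
      then obtain z where z: "z \<in> v' - u'" by blast
      have zE: "z \<in> E - u'" using z flat_subset[OF v'(1)] by blast
      define w where "w = cover u' z"
      have w: "is_flat M w" "u' \<subset> w" "z \<in> w" "rk w = Suc (Suc (rk A))"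
        using cover[OF u'(1) zE] u' by (auto simp: w_def)
      have "insert z u' \<subseteq> B" using z u'(4) v'(4) u v by blast
      then have wB: "w \<subseteq> B" using cover(5)[OF u'(1) zE f(2)] by (simp add: w_def)
      have vw: "v' \<subseteq> w"
        using z u' v' w by (intro atom_subset_of_mem[OF f(1) v'(1) w(1)]) auto
      show ?thesis
      proof (cases "w = B")
        case False
        then have "w \<in> chain_link \<tau>" using w u' wB by (intro gap_link[OF \<tau> g]) auto
        then show ?thesis using adj[of u' w] adj[of v' w] lu' lv' w vw by auto
      next
        case True
        then have rB: "rk B = Suc (Suc (rk A))" using w by simp
        have "\<exists>m\<in>missing \<tau>. m \<noteq> Suc (rk A)"
        proof (rule ccontr)
          assume "\<not> ?thesis"
          then have "missing \<tau> \<subseteq> {Suc (rk A)}" by blast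
          then have "card (missing \<tau>) \<le> 1" using card_mono[of "{Suc (rk A)}"] by simp
          then show False using card_missing[OF \<tau>] card by simp
        qed
        then obtain m where m: "m \<in> missing \<tau>" "m \<noteq> Suc (rk A)" by blast
        obtain A' B' where g': "gap \<tau> A' B'" and mm: "rk A' < m" "m < rk B'" using gap_exists[OF \<tau> m(1)] by blast
        obtain t where t: "t \<in> chain_link \<tau>" "A' \<subset> t" "t \<subset> B'" using chain_extend[OF \<tau> g' mm] by blast
        \<comment> \<open>The new gap differs from (A, B), whose only inner rank is Suc (rk A); so
          it lies entirely below A or above B.\<close>
        have "B' \<subseteq> A \<or> B \<subseteq> A'"
        proof (rule ccontr)
          assume n: "\<not> ?thesis"
          have G: "\<And>G. G \<in> ext \<tau> \<Longrightarrow> G \<subseteq> A \<or> B \<subseteq> G" "\<And>G. G \<in> ext \<tau> \<Longrightarrow> G \<subseteq> A' \<or> B' \<subseteq> G"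
            and ex: "A \<in> ext \<tau>" "B \<in> ext \<tau>" "A' \<in> ext \<tau>" "B' \<in> ext \<tau>" using g g' unfolding gap_def by blast+
          have "A' \<subseteq> A" "A \<subseteq> A'" "B \<subseteq> B'" "B' \<subseteq> B"
            using G(1)[OF ex(3)] G(1)[OF ex(4)] G(2)[OF ex(1)] G(2)[OF ex(2)] n by blast+
          then have "A' = A" "B' = B" by auto
          then show False using mm m rB by simp
        qed
        then have "(u' \<subseteq> t \<or> t \<subseteq> u') \<and> (v' \<subseteq> t \<or> t \<subseteq> v')"
        proof
          assume "B' \<subseteq> A"
          then have "t \<subseteq> A" using t by blast
          then show ?thesis using u' v' by blast
        next
          assume "B \<subseteq> A'"
          then have "B \<subseteq> t" using t by blast
          then show ?thesis using u'(4) v'(4) u v by blast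
        qed
        then show ?thesis using adj[OF lu' t(1)] adj[OF lv' t(1)] by simp
      qed
    qed
    then show ?thesis using hu hv by simp
  qed
qed

text \<open>The link is a bipartite graph with sides P and L, and adjacency is containment. The
  functions u stay parameters because the two cases below choose them differently.\<close>

lemma surface_form:
  assumes \<tau>: "chain \<tau>" and card: "card \<tau> + 2 = r" and miss: "missing \<tau> = {k, k'}" "k < k'"
    and c: "\<And>F. F \<in> \<tau> \<Longrightarrow> c F = 0"
    and u: "\<And>F. F \<in> chain_link \<tau> \<Longrightarrow> u F \<in> modular_functions" "\<And>F. F \<in> chain_link \<tau> \<Longrightarrow> u F F = 1"
      "\<And>F G. F \<in> chain_link \<tau> \<Longrightarrow> G \<in> \<tau> \<Longrightarrow> u F G = 0"
  defines "P \<equiv> {F \<in> chain_link \<tau>. rk F = k}" and "L \<equiv> {F \<in> chain_link \<tau>. rk F = k'}"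
  shows "mixed_degree [c, c] \<tau> = 2 * (\<Sum>p\<in>P. \<Sum>l\<in>L. of_bool (p \<subseteq> l) * c p * c l)
    - (\<Sum>p\<in>P. (c p)\<^sup>2 * (\<Sum>l\<in>L. of_bool (p \<subseteq> l) * u p l)) - (\<Sum>l\<in>L. (c l)\<^sup>2 * (\<Sum>p\<in>P. of_bool (p \<subseteq> l) * u l p))"
proof -
  have fin: "finite P" "finite L"
    unfolding P_def L_def using finite_link[of \<tau>] by (auto simp: link_eq_chain_link)
  have PL: "chain_link \<tau> = P \<union> L" "P \<inter> L = {}"
    using rk_link_missing[of _ \<tau>] miss by (auto simp: P_def L_def)
  have lp: "chain_link (insert p \<tau>) = {l \<in> L. p \<subseteq> l}" if p: "p \<in> P" for p
  proof -
    have pl: "p \<in> chain_link \<tau>" "rk p = k" using p by (auto simp: P_def)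
    have "G \<in> chain_link (insert p \<tau>) \<longleftrightarrow> G \<in> L \<and> p \<subseteq> G" for G
    proof
      assume G: "G \<in> chain_link (insert p \<tau>)"
      then have "rk G \<in> missing (insert p \<tau>)" by (rule rk_link_missing)
      then have "rk G = k'" using missing_insert[OF pl(1)] miss pl by auto
      moreover have "G \<in> chain_link \<tau>" "p \<subseteq> G \<or> G \<subseteq> p" using G link_insert_iff[OF pl(1)] by auto
      ultimately show "G \<in> L \<and> p \<subseteq> G" using rk_mono[of G p] pl miss(2) by (auto simp: L_def)
    next
      assume "G \<in> L \<and> p \<subseteq> G"
      then show "G \<in> chain_link (insert p \<tau>)" using link_insert_iff[OF pl(1)] pl miss(2) by (auto simp: L_def)
    qed
    then show ?thesis by blast
  qed
  have ll: "chain_link (insert l \<tau>) = {p \<in> P. p \<subseteq> l}" if l: "l \<in> L" for l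
  proof -
    have pl: "l \<in> chain_link \<tau>" "rk l = k'" using l by (auto simp: L_def)
    have "G \<in> chain_link (insert l \<tau>) \<longleftrightarrow> G \<in> P \<and> G \<subseteq> l" for G
    proof
      assume G: "G \<in> chain_link (insert l \<tau>)"
      then have "rk G \<in> missing (insert l \<tau>)" by (rule rk_link_missing)
      then have "rk G = k" using missing_insert[OF pl(1)] miss pl by auto
      moreover have "G \<in> chain_link \<tau>" "l \<subseteq> G \<or> G \<subseteq> l" using G link_insert_iff[OF pl(1)] by auto
      ultimately show "G \<in> P \<and> G \<subseteq> l" using rk_mono[of l G] pl miss(2) by (auto simp: P_def)
    next
      assume "G \<in> P \<and> G \<subseteq> l"
      then show "G \<in> chain_link (insert l \<tau>)" using link_insert_iff[OF pl(1)] pl miss(2) by (auto simp: P_def)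
    qed
    then show ?thesis by blast
  qed
  have sp: "(\<Sum>G\<in>chain_link (insert p \<tau>). f G) = (\<Sum>l\<in>L. of_bool (p \<subseteq> l) * f l)" if "p \<in> P" for p and f :: "'a set \<Rightarrow> real"
    unfolding lp[OF that] using fin by (intro sum.mono_neutral_cong_left) auto
  have sl: "(\<Sum>G\<in>chain_link (insert l \<tau>). f G) = (\<Sum>p\<in>P. of_bool (p \<subseteq> l) * f p)" if "l \<in> L" for l and f :: "'a set \<Rightarrow> real"
    unfolding ll[OF that] using fin by (intro sum.mono_neutral_cong_left) auto
  have "mixed_degree [c, c] \<tau> =
     (\<Sum>F\<in>chain_link \<tau>. c F * (\<Sum>G\<in>chain_link (insert F \<tau>). c G)) -
     (\<Sum>F\<in>chain_link \<tau>. c F * c F * (\<Sum>G\<in>chain_link (insert F \<tau>). u F G))"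
    using mixed_degree_two[of \<tau> "[]" c c u] \<tau> card c u by (simp add: link_eq_chain_link)
  also have "\<dots> = (\<Sum>p\<in>P. c p * (\<Sum>l\<in>L. of_bool (p \<subseteq> l) * c l)) + (\<Sum>l\<in>L. c l * (\<Sum>p\<in>P. of_bool (p \<subseteq> l) * c p))
     - ((\<Sum>p\<in>P. c p * c p * (\<Sum>l\<in>L. of_bool (p \<subseteq> l) * u p l)) + (\<Sum>l\<in>L. c l * c l * (\<Sum>p\<in>P. of_bool (p \<subseteq> l) * u l p)))"
    unfolding PL(1) sum.union_disjoint[OF fin PL(2)] by (simp add: sp sl)
  also have "(\<Sum>l\<in>L. c l * (\<Sum>p\<in>P. of_bool (p \<subseteq> l) * c p)) = (\<Sum>p\<in>P. \<Sum>l\<in>L. of_bool (p \<subseteq> l) * c p * c l)"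
    unfolding sum_distrib_left by (subst sum.swap) (simp add: mult_ac)
  also have "(\<Sum>p\<in>P. c p * (\<Sum>l\<in>L. of_bool (p \<subseteq> l) * c l)) = (\<Sum>p\<in>P. \<Sum>l\<in>L. of_bool (p \<subseteq> l) * c p * c l)"
    unfolding sum_distrib_left by (simp add: mult_ac)
  finally show ?thesis by (simp add: power2_eq_square)
qed

text \<open>\<open>P\<close> and \<open>L\<close> are the points and lines of a rank 3 interval. Two points span exactly one line, which completes the square.\<close>

lemma surface_index_adjacent:
  assumes \<tau>: "chain \<tau>" and card: "card \<tau> + 2 = r" and miss: "missing \<tau> = {k, Suc k}"
    and c: "\<And>F. F \<in> \<tau> \<Longrightarrow> c F = 0"
  defines "P \<equiv> {F \<in> chain_link \<tau>. rk F = k}" and "L \<equiv> {F \<in> chain_link \<tau>. rk F = Suc k}"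
  shows "mixed_degree [c, c] \<tau> = (\<Sum>p\<in>P. c p)\<^sup>2 - (\<Sum>l\<in>L. (c l - (\<Sum>p\<in>P. of_bool (p \<subseteq> l) * c p))\<^sup>2)"
proof -
  have k1: "1 \<le> k" using miss by (auto simp: missing_def)
  have "\<exists>A B. gap \<tau> A B \<and> Suc (rk A) = k \<and> rk B = Suc (Suc k)"
    using k1 by (intro gap_exact_exists[OF \<tau>]) (auto simp: miss)
  then obtain A B where g: "gap \<tau> A B" and AB: "Suc (rk A) = k" "rk B = Suc (Suc k)" by blast
  note f = gap_flats[OF \<tau> g]
  have fin: "finite P" "finite L"
    unfolding P_def L_def using finite_link[of \<tau>] by (auto simp: link_eq_chain_link)
  have btw: "A \<subset> F" "F \<subset> B" "is_flat M F" if "F \<in> chain_link \<tau>" for F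
  proof -
    have "rk F = k \<or> rk F = Suc k" using rk_link_missing[OF that] unfolding miss by simp
    then have "rk A < rk F" "rk F < rk B" using AB by linarith+
    then show "A \<subset> F" "F \<subset> B" by (rule gap_between[OF g that])+
    show "is_flat M F" by (rule link_flat[OF that])
  qed
  have P: "P = {F. is_flat M F \<and> A \<subset> F \<and> F \<subset> B \<and> rk F = k}"
    unfolding P_def using btw gap_link[OF \<tau> g] by blast
  have L: "L = {F. is_flat M F \<and> A \<subset> F \<and> F \<subset> B \<and> rk F = Suc k}"
    unfolding L_def using btw gap_link[OF \<tau> g] by blast
  have lines: "{l \<in> L. p \<subseteq> l \<and> y \<in> l} = {cover p y}" if p: "p \<in> P" and y: "y \<in> B - p" for p y
  proof -
    have "{l \<in> L. p \<subseteq> l \<and> y \<in> l} = {F. is_flat M F \<and> p \<subset> F \<and> F \<subset> B \<and> rk F = Suc (rk p) \<and> y \<in> F}"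
      using p y unfolding L P by auto
    also have "\<dots> = {cover p y}"
      using p y AB f unfolding P by (intro covers_containing) auto
    finally show ?thesis .
  qed
  \<comment> \<open>Any two elements in these positions give a coordinate at F by
    \<open>gap_coordinate\<close>; the diagonal sums computed below do not depend on the
    choice.\<close>
  define i where "i = (\<lambda>F. SOME x. x \<in> F - A)"
  define j where "j = (\<lambda>F. SOME x. x \<in> B - F)"
  have i: "i F \<in> F - A" if "F \<in> chain_link \<tau>" for F
    unfolding i_def using btw(1)[OF that] someI_ex[of "\<lambda>x. x \<in> F - A"] by blast
  have j: "j F \<in> B - F" if "F \<in> chain_link \<tau>" for F
    unfolding j_def using btw(2)[OF that] someI_ex[of "\<lambda>x. x \<in> B - F"] by blast
  define u where "u = (\<lambda>F G. of_bool (i F \<in> G) - of_bool (j F \<in> G) :: real)"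
  have u: "u F \<in> modular_functions" "u F F = 1" "\<And>G. G \<in> \<tau> \<Longrightarrow> u F G = 0" if "F \<in> chain_link \<tau>" for F
    using gap_coordinate[OF \<tau> g i[OF that] j[OF that]] btw[OF that] by (auto simp: u_def ext_def)
  have Pl: "p \<in> chain_link \<tau>" if "p \<in> P" for p using that by (simp add: P_def)
  have Ll: "l \<in> chain_link \<tau>" if "l \<in> L" for l using that by (simp add: L_def)
  \<comment> \<open>Every line through p contains i p, and exactly one of them contains j p, namely
    the line spanned by p and j p. The diagonal entry counts the others.\<close>
  have Up: "(\<Sum>l\<in>L. of_bool (p \<subseteq> l) * u p l) = (\<Sum>l\<in>L. of_bool (p \<subseteq> l)) - 1" if p: "p \<in> P" for p
  proof -
    have "(\<Sum>l\<in>L. of_bool (p \<subseteq> l) * u p l) = (\<Sum>l\<in>L. of_bool (p \<subseteq> l) - of_bool (p \<subseteq> l \<and> j p \<in> l))"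
      using i[OF Pl[OF p]] by (intro sum.cong refl) (auto simp: u_def)
    also have "\<dots> = (\<Sum>l\<in>L. of_bool (p \<subseteq> l)) - real (card {l \<in> L. p \<subseteq> l \<and> j p \<in> l})"
      using fin by (simp add: sum_subtractf of_bool_def sum.If_cases Int_def)
    finally show ?thesis using lines[OF p j[OF Pl[OF p]]] by simp
  qed
  \<comment> \<open>Points on l avoid j l, and exactly one of them contains i l.\<close>
  have Ul: "(\<Sum>p\<in>P. of_bool (p \<subseteq> l) * u l p) = 1" if l: "l \<in> L" for l
  proof -
    have il: "i l \<in> l - A" "j l \<notin> l" using i[OF Ll[OF l]] j[OF Ll[OF l]] by auto
    have "{p \<in> P. p \<subseteq> l \<and> i l \<in> p} = {F. is_flat M F \<and> A \<subset> F \<and> F \<subset> l \<and> rk F = Suc (rk A) \<and> i l \<in> F}"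
      using l AB unfolding P L by auto
    also have "\<dots> = {cover A (i l)}"
      using l AB f il unfolding L by (intro covers_containing) auto
    finally have eq: "{p \<in> P. p \<subseteq> l \<and> i l \<in> p} = {cover A (i l)}" .
    have "(\<Sum>p\<in>P. of_bool (p \<subseteq> l) * u l p) = (\<Sum>p\<in>P. of_bool (p \<subseteq> l \<and> i l \<in> p))"
      using il by (intro sum.cong refl) (auto simp: u_def)
    also have "\<dots> = real (card {p \<in> P. p \<subseteq> l \<and> i l \<in> p})"
      using fin by (simp add: of_bool_def sum.If_cases Int_def)
    finally show ?thesis using eq by simp
  qed
  have pq: "(\<Sum>l\<in>L. of_bool (p \<subseteq> l) * of_bool (q \<subseteq> l) :: real) = 1" if p: "p \<in> P" and q: "q \<in> P" and "p \<noteq> q" for p q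
  proof -
    have "\<not> q \<subseteq> p" using rk_strict_mono[of q p] p q \<open>p \<noteq> q\<close> unfolding P by auto
    then obtain y where y: "y \<in> q - p" by blast
    have yB: "y \<in> B - p" using y q unfolding P by blast
    have "{l \<in> L. p \<subseteq> l \<and> q \<subseteq> l} = {l \<in> L. p \<subseteq> l \<and> y \<in> l}"
    proof -
      have "q \<subseteq> l" if "l \<in> L" "p \<subseteq> l" "y \<in> l" for l
      proof (rule atom_subset_of_mem[OF f(1)])
        show "is_flat M q" "is_flat M l" "A \<subseteq> q" "A \<subseteq> l" "rk q = Suc (rk A)"
          using p q that AB unfolding P L by auto
        show "y \<in> q - A" using y p unfolding P by auto
      qed (use that in auto)
      then show ?thesis using y by blast
    qed
    then have "card {l \<in> L. p \<subseteq> l \<and> q \<subseteq> l} = 1" using lines[OF p yB] by simp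
    moreover have "(\<Sum>l\<in>L. of_bool (p \<subseteq> l) * of_bool (q \<subseteq> l) :: real) = real (card {l \<in> L. p \<subseteq> l \<and> q \<subseteq> l})"
      unfolding of_bool_conj[symmetric] using fin by (simp add: of_bool_def sum.If_cases Int_def)
    ultimately show ?thesis by simp
  qed
  \<comment> \<open>N p q is the number of lines through p and q, which is 1 off the diagonal. The
    sum of the squares (S l)^2 is therefore the square of the sum of the c p plus the diagonal terms
    found in \<open>Up\<close>.\<close>
  define N where "N = (\<lambda>p q. \<Sum>l\<in>L. of_bool (p \<subseteq> l) * of_bool (q \<subseteq> l) :: real)"
  have Nd: "N p p = (\<Sum>l\<in>L. of_bool (p \<subseteq> l))" for p by (simp add: N_def flip: of_bool_conj)
  define S where "S = (\<lambda>l. \<Sum>p\<in>P. of_bool (p \<subseteq> l) * c p)"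
  have S2: "(\<Sum>l\<in>L. (S l)\<^sup>2) = (\<Sum>p\<in>P. \<Sum>q\<in>P. c p * c q * N p q)"
  proof -
    have "(\<Sum>l\<in>L. (S l)\<^sup>2) = (\<Sum>l\<in>L. \<Sum>p\<in>P. \<Sum>q\<in>P. c p * c q * (of_bool (p \<subseteq> l) * of_bool (q \<subseteq> l)))"
      by (simp add: S_def power2_eq_square sum_product mult_ac)
    also have "\<dots> = (\<Sum>p\<in>P. \<Sum>l\<in>L. \<Sum>q\<in>P. c p * c q * (of_bool (p \<subseteq> l) * of_bool (q \<subseteq> l)))"
      by (rule sum.swap)
    also have "\<dots> = (\<Sum>p\<in>P. \<Sum>q\<in>P. \<Sum>l\<in>L. c p * c q * (of_bool (p \<subseteq> l) * of_bool (q \<subseteq> l)))"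
      by (intro sum.cong refl sum.swap)
    finally show ?thesis by (simp add: N_def sum_distrib_left)
  qed
  have "(\<Sum>p\<in>P. \<Sum>q\<in>P. c p * c q * N p q) = (\<Sum>p\<in>P. \<Sum>q\<in>P. c p * c q + (if q = p then (c p)\<^sup>2 * (N p p - 1) else 0))"
    using pq by (intro sum.cong refl) (auto simp: N_def power2_eq_square algebra_simps)
  also have "\<dots> = (\<Sum>p\<in>P. c p)\<^sup>2 + (\<Sum>p\<in>P. (c p)\<^sup>2 * (N p p - 1))"
    using fin by (simp add: sum.distrib power2_eq_square sum_product)
  finally have A: "(\<Sum>l\<in>L. (S l)\<^sup>2) = (\<Sum>p\<in>P. c p)\<^sup>2 + (\<Sum>p\<in>P. (c p)\<^sup>2 * (N p p - 1))" using S2 by simp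
  have cross: "(\<Sum>p\<in>P. \<Sum>l\<in>L. of_bool (p \<subseteq> l) * c p * c l) = (\<Sum>l\<in>L. c l * S l)"
    unfolding S_def sum_distrib_left by (subst sum.swap) (simp add: mult_ac)
  have "mixed_degree [c, c] \<tau> = 2 * (\<Sum>p\<in>P. \<Sum>l\<in>L. of_bool (p \<subseteq> l) * c p * c l)
    - (\<Sum>p\<in>P. (c p)\<^sup>2 * (\<Sum>l\<in>L. of_bool (p \<subseteq> l) * u p l)) - (\<Sum>l\<in>L. (c l)\<^sup>2 * (\<Sum>p\<in>P. of_bool (p \<subseteq> l) * u l p))"
    unfolding P_def L_def by (rule surface_form[OF \<tau> card miss]) (use c u in auto)
  also have "\<dots> = 2 * (\<Sum>l\<in>L. c l * S l) - (\<Sum>p\<in>P. (c p)\<^sup>2 * (N p p - 1)) - (\<Sum>l\<in>L. (c l)\<^sup>2)"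
    by (simp add: cross Up Ul Nd)
  also have "\<dots> = (\<Sum>p\<in>P. c p)\<^sup>2 - (\<Sum>l\<in>L. (c l - S l)\<^sup>2)"
    using A by (simp add: power2_diff sum.distrib sum_subtractf sum_distrib_left mult.assoc)
  finally show ?thesis by (simp add: S_def)
qed

text \<open>The two missing ranks lie in different gaps, so every p is contained in every l. A
  coordinate built from elements of one gap vanishes on the flats of the other, which removes both
  diagonal sums and leaves a product of two linear forms.\<close>

lemma surface_index_distant:
  assumes \<tau>: "chain \<tau>" and card: "card \<tau> + 2 = r" and miss: "missing \<tau> = {k, k'}" "Suc k < k'"
    and c: "\<And>F. F \<in> \<tau> \<Longrightarrow> c F = 0"
  defines "P \<equiv> {F \<in> chain_link \<tau>. rk F = k}" and "L \<equiv> {F \<in> chain_link \<tau>. rk F = k'}"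
  shows "mixed_degree [c, c] \<tau> = 2 * (\<Sum>p\<in>P. c p) * (\<Sum>l\<in>L. c l)"
proof -
  have k1: "1 \<le> k" using miss by (auto simp: missing_def)
  have "\<exists>A B. gap \<tau> A B \<and> Suc (rk A) = k \<and> rk B = Suc k"
    using miss k1 by (intro gap_exact_exists[OF \<tau>]) auto
  then obtain A B where g: "gap \<tau> A B" and AB: "Suc (rk A) = k" "rk B = Suc k" by blast
  have "\<exists>A B. gap \<tau> A B \<and> Suc (rk A) = k' \<and> rk B = Suc k'"
    using miss k1 by (intro gap_exact_exists[OF \<tau>]) auto
  then obtain A' B' where g': "gap \<tau> A' B'" and AB': "Suc (rk A') = k'" "rk B' = Suc k'" by blast
  have BA: "B \<subseteq> A'"
    using ext_rk_le[OF \<tau>, of B A'] g g' AB AB' miss(2) by (auto simp: gap_def)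
  have p: "A \<subset> F" "F \<subset> B" if "F \<in> P" for F
    using gap_between[OF g, of F] that AB by (auto simp: P_def)
  have l: "A' \<subset> F" "F \<subset> B'" if "F \<in> L" for F
    using gap_between[OF g', of F] that AB' by (auto simp: L_def)
  have PL: "F \<in> P \<or> F \<in> L" if "F \<in> chain_link \<tau>" for F
    using rk_link_missing[OF that] miss that by (auto simp: P_def L_def)
  have "\<exists>u. u \<in> modular_functions \<and> u F = 1 \<and> (\<forall>G\<in>\<tau>. u G = 0) \<and>
     (\<forall>G. G \<in> P \<and> F \<in> L \<or> G \<in> L \<and> F \<in> P \<longrightarrow> u G = (0 :: real))" if F: "F \<in> chain_link \<tau>" for F
    using PL[OF F]
  proof
    assume FP: "F \<in> P"
    obtain i j where ij: "i \<in> F - A" "j \<in> B - F" using p[OF FP] by blast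
    let ?u = "\<lambda>G. of_bool (i \<in> G) - of_bool (j \<in> G) :: real"
    have "?u \<in> modular_functions" "?u F = 1" "\<And>G. G \<in> ext \<tau> \<Longrightarrow> ?u G = 0"
      using gap_coordinate[OF \<tau> g ij] p[OF FP] by auto
    moreover have "?u G = 0" if "G \<in> L" for G
    proof -
      have "B \<subseteq> G" using l[OF that] BA by blast
      then show ?thesis using ij p[OF FP] by (auto simp: of_bool_def)
    qed
    moreover have "F \<notin> L" using FP miss(2) by (auto simp: P_def L_def)
    ultimately show ?thesis by (intro exI[of _ ?u]) (simp add: ext_def)
  next
    assume FL: "F \<in> L"
    obtain i j where ij: "i \<in> F - A'" "j \<in> B' - F" using l[OF FL] by blast
    let ?u = "\<lambda>G. of_bool (i \<in> G) - of_bool (j \<in> G) :: real"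
    have "?u \<in> modular_functions" "?u F = 1" "\<And>G. G \<in> ext \<tau> \<Longrightarrow> ?u G = 0"
      using gap_coordinate[OF \<tau> g' ij] l[OF FL] by auto
    moreover have "?u G = 0" if "G \<in> P" for G
    proof -
      have "G \<subseteq> A'" using p[OF that] BA by blast
      then show ?thesis using ij l[OF FL] by (auto simp: of_bool_def)
    qed
    moreover have "F \<notin> P" using FL miss(2) by (auto simp: P_def L_def)
    ultimately show ?thesis by (intro exI[of _ ?u]) (simp add: ext_def)
  qed
  then obtain u where u: "\<And>F. F \<in> chain_link \<tau> \<Longrightarrow> u F \<in> modular_functions \<and> u F F = 1 \<and> (\<forall>G\<in>\<tau>. u F G = 0) \<and>
     (\<forall>G. G \<in> P \<and> F \<in> L \<or> G \<in> L \<and> F \<in> P \<longrightarrow> u F G = (0 :: real))" by metis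
  have sub: "p \<subseteq> l" if "p \<in> P" "l \<in> L" for p l
    using p[OF that(1)] l[OF that(2)] BA by blast
  have "mixed_degree [c, c] \<tau> = 2 * (\<Sum>p\<in>P. \<Sum>l\<in>L. of_bool (p \<subseteq> l) * c p * c l)
    - (\<Sum>p\<in>P. (c p)\<^sup>2 * (\<Sum>l\<in>L. of_bool (p \<subseteq> l) * u p l)) - (\<Sum>l\<in>L. (c l)\<^sup>2 * (\<Sum>p\<in>P. of_bool (p \<subseteq> l) * u l p))"
    unfolding P_def L_def using miss by (intro surface_form[OF \<tau> card]) (use c u in auto)
  also have "(\<Sum>p\<in>P. (c p)\<^sup>2 * (\<Sum>l\<in>L. of_bool (p \<subseteq> l) * u p l)) = 0"
    using u by (intro sum.neutral ballI) (auto simp: P_def intro!: sum.neutral)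
  also have "(\<Sum>l\<in>L. (c l)\<^sup>2 * (\<Sum>p\<in>P. of_bool (p \<subseteq> l) * u l p)) = 0"
    using u by (intro sum.neutral ballI) (auto simp: L_def intro!: sum.neutral)
  also have "(\<Sum>p\<in>P. \<Sum>l\<in>L. of_bool (p \<subseteq> l) * c p * c l) = (\<Sum>p\<in>P. c p) * (\<Sum>l\<in>L. c l)"
    using sub by (simp add: sum_product)
  finally show ?thesis by simp
qed

lemma chain_surface_index:
  assumes \<tau>: "chain \<tau>" and card: "card \<tau> + 2 = r"
  shows "\<exists>\<alpha>::('a set \<Rightarrow> real) \<Rightarrow> real. (\<forall>a b s t. \<alpha> (\<lambda>F. s * a F + t * b F) = s * \<alpha> a + t * \<alpha> b) \<and>
    (\<forall>c. \<alpha> c = 0 \<longrightarrow> mixed_degree [c, c] \<tau> \<le> 0)"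
proof -
  have "card (missing \<tau>) = 2" using card_missing[OF \<tau>] card by simp
  then obtain k k' where miss: "missing \<tau> = {k, k'}" "k < k'"
    by (metis card_2_iff insert_commute linorder_neqE_nat)
  define P where "P = {F \<in> chain_link \<tau>. rk F = k}"
  \<comment> \<open>In both cases the form is nonpositive as soon as its values on P add up to 0.
    Those formulas require c to vanish on \<tau>; subtracting the linear part achieves this and is
    linear in c.\<close>
  define \<alpha> where "\<alpha> = (\<lambda>c. \<Sum>p\<in>P. c p - lin_part \<tau> c p)"
  have "\<alpha> (\<lambda>F. s * a F + t * b F) = s * \<alpha> a + t * \<alpha> b" for a b s t
    by (simp add: \<alpha>_def lin_part_linear sum_distrib_left sum.distrib[symmetric] algebra_simps)
  moreover have "mixed_degree [c, c] \<tau> \<le> 0" if "\<alpha> c = 0" for c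
  proof -
    let ?c = "\<lambda>F. c F - lin_part \<tau> c F"
    have z: "?c F = 0" if "F \<in> \<tau>" for F using lin_part_eq[OF \<tau> that] by simp
    have "mixed_degree [c, c] \<tau> = mixed_degree [?c, ?c] \<tau>"
      using mixed_degree_lin_part[OF \<tau>, of "[?c]" "lin_part \<tau> c" c]
        mixed_degree_lin_part2[OF \<tau>, of "[]" "lin_part \<tau> c" c c] lin_part_Lin[OF \<tau>] card
      by (simp del: mixed_degree.simps)
    also have "\<dots> \<le> 0"
    proof (cases "k' = Suc k")
      case True
      then have m: "missing \<tau> = {k, Suc k}" using miss by simp
      show ?thesis
        using surface_index_adjacent[OF \<tau> card m z] that
        by (simp add: \<alpha>_def P_def sum_nonneg del: mixed_degree.simps)
    next
      case False
      then have "Suc k < k'" using miss by simp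
      from surface_index_distant[OF \<tau> card miss(1) this z] that show ?thesis
        by (simp add: \<alpha>_def P_def del: mixed_degree.simps)
    qed
    finally show ?thesis .
  qed
  ultimately show ?thesis by blast
qed

end

sublocale rank_matroid \<subseteq> lorentzian_complex "proper_flats M" chain r modular_functions
proof
  show "h u = h v" if "chain \<tau>" "card \<tau> + 3 \<le> r"
    "\<And>u v. u \<in> link \<tau> \<Longrightarrow> v \<in> link (insert u \<tau>) \<Longrightarrow> h u = h v" "u \<in> link \<tau>" "v \<in> link \<tau>"
    for \<tau> u v and h :: "'a set \<Rightarrow> real"
    using chain_link_connected[of \<tau> h u v] that unfolding link_eq_chain_link by blast
qed (rule chain_surface_index)

section \<open>Ample and nef functions\<close>

context balanced_complex
begin

lemma mixed_degree_perturb: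
  "((\<lambda>\<epsilon>. mixed_degree (map (\<lambda>a F. a F + \<epsilon> * h F) as) \<tau>) \<longlongrightarrow> mixed_degree as \<tau>) (at_right 0)"
proof (induction as arbitrary: \<tau>)
  case (Cons a as)
  have *: "((\<lambda>\<epsilon>. a F + \<epsilon> * h F) \<longlongrightarrow> a F) (at_right 0)" for F
    by (auto intro!: tendsto_eq_intros)
  show ?case
    unfolding list.map mixed_degree.simps lin_part_def
    by (intro tendsto_sum tendsto_mult tendsto_diff tendsto_const * Cons.IH)
qed simp

end

context lorentzian_complex
begin

theorem hodge_index_nef:
  assumes \<tau>: "face \<tau>" and card: "card \<tau> + Suc (Suc (length as)) = r"
    and ample: "\<And>\<epsilon> c. \<epsilon> > 0 \<Longrightarrow> c \<in> set (a # as) \<Longrightarrow> ample (\<lambda>F. c F + \<epsilon> * h F)"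
  shows "mixed_degree (a # a # as) \<tau> * mixed_degree (b # b # as) \<tau> \<le> (mixed_degree (a # b # as) \<tau>)\<^sup>2"
proof -
  \<comment> \<open>Every factor is perturbed, b included: \<open>hodge_index\<close> accepts any
    function in that place, and b is recovered in the limit.\<close>
  let ?p = "\<lambda>as \<epsilon>. mixed_degree (map (\<lambda>a F. a F + \<epsilon> * h F) as) \<tau>"
  note lim = mixed_degree_perturb[where h = h and \<tau> = \<tau>]
  have "\<forall>\<^sub>F \<epsilon> in at_right 0. ?p (a # a # as) \<epsilon> * ?p (b # b # as) \<epsilon> \<le> (?p (a # b # as) \<epsilon>)\<^sup>2"
    using eventually_at_right_less[of "0::real"]
  proof eventually_elim
    case (elim \<epsilon>)
    show ?case unfolding list.map
      using \<tau> card elim ample by (intro hodge_index) auto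
  qed
  then show ?thesis
    by (intro tendsto_le[OF _ tendsto_power[OF lim] tendsto_mult[OF lim lim]]) auto
qed

end

context rank_matroid
begin

section \<open>Concave functions of the cardinality\<close>

lemma gap_below:
  assumes \<tau>: "chain \<tau>" and G: "G \<in> ext \<tau>" "G \<noteq> {}"
  shows "\<exists>A. gap \<tau> A G"
proof -
  let ?S = "{H \<in> ext \<tau>. H \<subset> G}"
  have "finite ?S" using chain_finite[OF \<tau>] by (simp add: ext_def)
  moreover have "{} \<in> ?S" using G by (auto simp: ext_def)
  ultimately have "Max (rk ` ?S) \<in> rk ` ?S" by (intro Max_in) auto
  then obtain A where A: "A \<in> ?S" "rk A = Max (rk ` ?S)" by (metis (no_types, lifting) imageE)
  have "H \<subseteq> A \<or> G \<subseteq> H" if H: "H \<in> ext \<tau>" for H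
  proof (cases "G \<subseteq> H")
    case False
    then have "H \<in> ?S" using ext_comparable[OF \<tau> H G(1)] H by auto
    then have "rk H \<le> rk A" unfolding A(2) using \<open>finite ?S\<close> by (intro Max_ge) auto
    then show ?thesis using ext_rk_le[OF \<tau> H, of A] A(1) by simp
  qed simp
  then show ?thesis using A(1) G(1) unfolding gap_def by blast
qed

lemma gap_unique:
  assumes "gap \<tau> A B" "gap \<tau> A' B'" "x \<in> B - A" "x \<in> B' - A'"
  shows "A = A'" "B = B'"
proof -
  have G: "\<And>G. G \<in> ext \<tau> \<Longrightarrow> G \<subseteq> A \<or> B \<subseteq> G" "\<And>G. G \<in> ext \<tau> \<Longrightarrow> G \<subseteq> A' \<or> B' \<subseteq> G"
    and ex: "A \<in> ext \<tau>" "B \<in> ext \<tau>" "A' \<in> ext \<tau>" "B' \<in> ext \<tau>" using assms(1,2) unfolding gap_def by blast+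
  have "A' \<subseteq> A" "A \<subseteq> A'" "B \<subseteq> B'" "B' \<subseteq> B"
    using G(1)[OF ex(3)] G(1)[OF ex(4)] G(2)[OF ex(1)] G(2)[OF ex(2)] assms(3,4) by blast+
  then show "A = A'" "B = B'" by auto
qed

text \<open>The linear function that agrees with \<open>\<phi> \<circ> card\<close> on a chain interpolates \<open>\<phi>\<close> linearly in the cardinality on each gap.\<close>

lemma ample_strictly_concave_card:
  fixes \<phi> :: "nat \<Rightarrow> real"
  assumes concave: "\<And>x y z. x < y \<Longrightarrow> y < z \<Longrightarrow> z \<le> card E \<Longrightarrow>
      (real z - real y) * \<phi> x + (real y - real x) * \<phi> z < (real z - real x) * \<phi> y"
    and ends: "\<phi> 0 = 0" "\<phi> (card E) = 0"
  shows "ample (\<lambda>F. \<phi> (card F))"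
  unfolding ample_def
proof (intro allI impI)
  fix \<tau> assume \<tau>: "chain \<tau>"
  define slope where "slope = (\<lambda>(A :: 'a set) (B :: 'a set). (\<phi> (card B) - \<phi> (card A)) / (real (card B) - real (card A)))"
  \<comment> \<open>The weight is constant on each gap, equal to the slope of \<phi> between its
    ends. By \<open>gap_unique\<close> an element lies in at most one gap, so the slope is well
    defined.\<close>
  define w where "w = (\<lambda>x. SOME s. \<exists>A B. gap \<tau> A B \<and> x \<in> B - A \<and> s = slope A B)"
  have w: "w x = slope A B" if "gap \<tau> A B" "x \<in> B - A" for x A B
  proof -
    have "\<exists>s. \<exists>A B. gap \<tau> A B \<and> x \<in> B - A \<and> s = slope A B" using that by blast
    from someI_ex[OF this] obtain A' B' where "gap \<tau> A' B'" "x \<in> B' - A'" "w x = slope A' B'"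
      unfolding w_def by blast
    then show ?thesis using gap_unique[OF that(1) _ that(2)] by blast
  qed
  have finE: "finite G" if "G \<subseteq> E" for G using finite_E finite_subset that by blast
  have part: "sum w F = sum w A + (real (card F) - real (card A)) * slope A B"
    if g: "gap \<tau> A B" and "A \<subseteq> F" "F \<subseteq> B" for A B F
  proof -
    have f: "finite F" "finite A" using gap_flats[OF \<tau> g] that finE by (meson subset_trans)+
    have "sum w F = sum w A + sum w (F - A)" using f that by (simp add: sum.subset_diff)
    also have "sum w (F - A) = (\<Sum>x\<in>F - A. slope A B)" using w[OF g] that by (intro sum.cong) auto
    also have "\<dots> = (real (card F) - real (card A)) * slope A B"
      using f that by (simp add: card_Diff_subset card_mono of_nat_diff)
    finally show ?thesis .
  qed
  \<comment> \<open>The slopes telescope along the flag. At E this yields total weight \<phi> (card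
    E) = 0, which is what makes the function modular.\<close>
  have on_ext: "sum w G = \<phi> (card G)" if "G \<in> ext \<tau>" for G
    using that
  proof (induction "card G" arbitrary: G rule: less_induct)
    case less
    show ?case
    proof (cases "G = {}")
      case True
      then show ?thesis by (simp add: ends)
    next
      case False
      obtain A where g: "gap \<tau> A G" using gap_below[OF \<tau> less.prems False] by blast
      have "A \<in> ext \<tau>" "A \<subset> G" using g by (auto simp: gap_def)
      moreover have "card A < card G" using \<open>A \<subset> G\<close> gap_flats[OF \<tau> g] finE by (intro psubset_card_mono) auto
      ultimately show ?thesis using less.hyps[of A] part[OF g, of G] by (simp add: slope_def)
    qed
  qed
  show "\<exists>l\<in>modular_functions. (\<forall>F\<in>\<tau>. l F = \<phi> (card F)) \<and> (\<forall>F\<in>link \<tau>. l F < \<phi> (card F))"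
  proof (intro bexI conjI ballI)
    have "sum w E = 0" using on_ext[of E] ends by (simp add: ext_def)
    then show "(\<lambda>F. \<Sum>x\<in>F \<inter> E. w x) \<in> modular_functions" by (auto simp: modular_functions_def)
    show "(\<Sum>x\<in>F \<inter> E. w x) = \<phi> (card F)" if "F \<in> \<tau>" for F
      using on_ext[of F] ext_flat[OF \<tau>, of F] flat_subset[of F] that by (simp add: ext_def Int_absorb2)
    show "(\<Sum>x\<in>F \<inter> E. w x) < \<phi> (card F)" if "F \<in> link \<tau>" for F
    proof -
      have F: "F \<in> chain_link \<tau>" using that by (simp add: link_eq_chain_link)
      obtain A B where g: "gap \<tau> A B" and AB: "A \<subset> F" "F \<subset> B" using link_gap_exists[OF F] by blast
      note f = gap_flats[OF \<tau> g]
      have c: "card A < card F" "card F < card B" "card B \<le> card E"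
        using AB f finE finite_E by (auto intro!: psubset_card_mono card_mono)
      have "sum w F = \<phi> (card A) + (real (card F) - real (card A)) * slope A B"
        using part[OF g, of F] on_ext[of A] AB g by (auto simp: gap_def)
      \<comment> \<open>The left side is the chord of \<phi> from card A to card B, evaluated at
        card F.\<close>
      also have "\<dots> < \<phi> (card F)"
        using concave[OF c] c by (simp add: slope_def field_simps)
      finally show ?thesis using flat_subset[OF link_flat[OF F]] by (simp add: Int_absorb2)
    qed
  qed
qed

definition hypersimplex_fun :: "nat \<Rightarrow> 'a set \<Rightarrow> real" where
  "hypersimplex_fun k S = real (min (card S) k) - real k / real (card E) * real (card S)"

text \<open>The linear term drops out of the concavity inequality and makes the function vanish at
  card E, while min y k is concave. The perturbation adds
  \<open>\<epsilon> * ((y - x) * (z - y) * (z - x))\<close> to the inequality and so makes it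
  strict.\<close>

lemma ample_hypersimplex_perturb:
  assumes "k \<le> card E" "\<epsilon> > 0"
  shows "ample (\<lambda>F. hypersimplex_fun k F + \<epsilon> * (real (card F) * (real (card E) - real (card F))))"
proof -
  let ?\<phi> = "\<lambda>y. real (min y k) - real k / real (card E) * real y + \<epsilon> * (real y * (real (card E) - real y))"
  have "ample (\<lambda>F. ?\<phi> (card F))"
  proof (rule ample_strictly_concave_card)
    fix x y z :: nat assume xyz: "x < y" "y < z" "z \<le> card E"
    have "(real z - real y) * real (min x k) + (real y - real x) * real (min z k) \<le> (real z - real x) * real (min y k)"
    \<comment> \<open>min is the smaller of two linear functions, so the one attained at y bounds it
      from above at x and z.\<close>
    proof (cases "y \<le> k")
      case True
      have "(real z - real y) * real (min x k) + (real y - real x) * real (min z k) \<le>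
          (real z - real y) * real x + (real y - real x) * real z"
        using xyz by (intro add_mono mult_left_mono) auto
      also have "\<dots> = (real z - real x) * real (min y k)" using True by (simp add: min_absorb1 algebra_simps)
      finally show ?thesis .
    next
      case False
      have "(real z - real y) * real (min x k) + (real y - real x) * real (min z k) \<le>
          (real z - real y) * real k + (real y - real x) * real k"
        using xyz by (intro add_mono mult_left_mono) auto
      also have "\<dots> = (real z - real x) * real (min y k)" using False by (simp add: min_absorb2 algebra_simps)
      finally show ?thesis .
    qed
    moreover have "0 < \<epsilon> * ((real y - real x) * (real z - real y) * (real z - real x))"
      using xyz assms by (intro mult_pos_pos) auto
    moreover have "(real z - real x) * ?\<phi> y - ((real z - real y) * ?\<phi> x + (real y - real x) * ?\<phi> z) =
       ((real z - real x) * real (min y k) - ((real z - real y) * real (min x k) + (real y - real x) * real (min z k)))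
       + \<epsilon> * ((real y - real x) * (real z - real y) * (real z - real x))"
      by (simp add: algebra_simps diff_divide_distrib)
    ultimately show "(real z - real y) * ?\<phi> x + (real y - real x) * ?\<phi> z < (real z - real x) * ?\<phi> y"
      by (metis add_nonneg_pos diff_ge_0_iff_ge diff_gt_0_iff_gt)
  qed (use assms in \<open>auto simp: min_absorb2\<close>)
  then show ?thesis by (simp add: hypersimplex_fun_def)
qed

end

section \<open>The degree functional on polynomials\<close>

lemma const_mult_lookup: "Poly_Mapping.lookup (const t * p) m = t * Poly_Mapping.lookup p m"
  unfolding const_def mult_map_scale_conv_mult[symmetric] by (simp add: Poly_Mapping.map.rep_eq when_def)

lemma const_1: "const 1 = 1"
  by (simp add: const_def)

text \<open>Monomials are presented by lists because \<open>mixed_degree\<close> acts on lists; the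
  multiset of entries is all that the monomial remembers.\<close>

definition monomial_of :: "'a set list \<Rightarrow> ('a set \<Rightarrow>\<^sub>0 nat)" where
  "monomial_of xs = sum_list (map (\<lambda>F. Poly_Mapping.single F 1) xs)"

definition var_prod :: "'a set list \<Rightarrow> 'a set_poly" where
  "var_prod xs = prod_list (map var xs)"

lemma var_prod_eq: "var_prod xs = Poly_Mapping.single (monomial_of xs) 1"
  by (induction xs) (auto simp: var_prod_def monomial_of_def var_def mult_single)

lemma lookup_monomial_of: "Poly_Mapping.lookup (monomial_of xs) F = count (mset xs) F"
  by (induction xs) (auto simp: monomial_of_def lookup_add lookup_single when_def)

lemma monomial_of_eq_iff: "monomial_of xs = monomial_of ys \<longleftrightarrow> mset xs = mset ys"
  by (metis lookup_monomial_of multiset_eqI poly_mapping_eqI)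

lemma keys_monomial_of: "Poly_Mapping.keys (monomial_of xs) = set xs"
  by (auto simp: in_keys_iff lookup_monomial_of)

lemma total_degree_monomial_of: "total_degree (monomial_of xs) = length xs"
  using size_multiset_overloaded_eq[of "mset xs"]
  by (simp add: total_degree_def keys_monomial_of lookup_monomial_of)

lemma ex_monomial_of: "\<exists>xs. monomial_of xs = m"
proof -
  have "finite {F. 0 < Poly_Mapping.lookup m F}" by simp
  then have "count (Abs_multiset (Poly_Mapping.lookup m)) = Poly_Mapping.lookup m"
    by (rule count_Abs_multiset)
  moreover obtain xs where "mset xs = Abs_multiset (Poly_Mapping.lookup m)" using ex_mset by blast
  ultimately have "monomial_of xs = m" by (intro poly_mapping_eqI) (simp add: lookup_monomial_of)
  then show ?thesis by blast
qed

lemma poly_sum_monomials: "p = (\<Sum>m\<in>Poly_Mapping.keys p. const (Poly_Mapping.lookup p m) * Poly_Mapping.single m 1)"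
proof (rule poly_mapping_eqI)
  fix k
  have "Poly_Mapping.lookup (\<Sum>m\<in>Poly_Mapping.keys p. const (Poly_Mapping.lookup p m) * Poly_Mapping.single m 1) k
      = (\<Sum>m\<in>Poly_Mapping.keys p. if m = k then Poly_Mapping.lookup p k else 0)"
    unfolding lookup_sum const_mult_lookup by (intro sum.cong refl) (auto simp: lookup_single when_def)
  then show "Poly_Mapping.lookup p k = Poly_Mapping.lookup (\<Sum>m\<in>Poly_Mapping.keys p. const (Poly_Mapping.lookup p m) * Poly_Mapping.single m 1) k"
    by (simp add: in_keys_iff)
qed

context rank_matroid
begin

abbreviation "X \<equiv> proper_flats M"

definition delta :: "'a set \<Rightarrow> 'a set \<Rightarrow> real" where
  "delta F G = of_bool (G = F)"

text \<open>The ordering chosen for the factors does not matter, since mixed degrees with r factors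
  are symmetric. Monomials of other degrees get 0, so that arbitrary multipliers can be used without
  tracking the grading.\<close>

definition monomial_degree :: "('a set \<Rightarrow>\<^sub>0 nat) \<Rightarrow> real" where
  "monomial_degree m = (let xs = SOME xs. monomial_of xs = m in
     if length xs = r then mixed_degree (map delta xs) {} else 0)"

definition poly_degree :: "'a set_poly \<Rightarrow> real" where
  "poly_degree p = (\<Sum>m\<in>Poly_Mapping.keys p. Poly_Mapping.lookup p m * monomial_degree m)"

lemma monomial_degree:
  "monomial_degree (monomial_of xs) = (if length xs = r then mixed_degree (map delta xs) {} else 0)"
proof -
  define ys where "ys = (SOME ys. monomial_of ys = monomial_of xs)"
  have "monomial_of ys = monomial_of xs" unfolding ys_def by (rule someI) (rule refl)
  then have m: "mset ys = mset xs" by (simp add: monomial_of_eq_iff)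
  then have "length ys = length xs" by (rule mset_eq_length)
  moreover have "mixed_degree (map delta ys) {} = mixed_degree (map delta xs) {}" if "length ys = r"
    using m that face_empty by (intro mixed_degree_perm) auto
  ultimately show ?thesis unfolding monomial_degree_def ys_def[symmetric] by (simp add: Let_def)
qed

lemma poly_degree_superset:
  assumes "finite S" "Poly_Mapping.keys p \<subseteq> S"
  shows "poly_degree p = (\<Sum>m\<in>S. Poly_Mapping.lookup p m * monomial_degree m)"
  unfolding poly_degree_def using assms by (intro sum.mono_neutral_left) (auto simp: in_keys_iff)

lemma poly_degree_add: "poly_degree (p + q) = poly_degree p + poly_degree q"
proof -
  let ?S = "Poly_Mapping.keys p \<union> Poly_Mapping.keys q"
  have "poly_degree (p + q) = (\<Sum>m\<in>?S. Poly_Mapping.lookup (p + q) m * monomial_degree m)"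
    by (rule poly_degree_superset) (simp_all add: keys_add)
  also have "\<dots> = (\<Sum>m\<in>?S. Poly_Mapping.lookup p m * monomial_degree m) + (\<Sum>m\<in>?S. Poly_Mapping.lookup q m * monomial_degree m)"
    by (simp add: lookup_add algebra_simps sum.distrib)
  finally show ?thesis
    using poly_degree_superset[of ?S p] poly_degree_superset[of ?S q] by simp
qed

lemma poly_degree_const: "poly_degree (const t * p) = t * poly_degree p"
proof -
  have "Poly_Mapping.keys (const t * p) \<subseteq> Poly_Mapping.keys p" by (auto simp: in_keys_iff const_mult_lookup)
  then show ?thesis using poly_degree_superset[of "Poly_Mapping.keys p" "const t * p"]
    by (simp add: const_mult_lookup poly_degree_def sum_distrib_left mult.assoc)
qed

lemma poly_degree_zero: "poly_degree 0 = 0" by (simp add: poly_degree_def)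

lemma poly_degree_sum: "poly_degree (\<Sum>x\<in>A. f x) = (\<Sum>x\<in>A. poly_degree (f x))"
  by (induction A rule: infinite_finite_induct) (auto simp: poly_degree_add poly_degree_zero)

lemma poly_degree_var_prod:
  "poly_degree (var_prod xs) = (if length xs = r then mixed_degree (map delta xs) {} else 0)"
  by (simp add: poly_degree_def var_prod_eq monomial_degree)

definition lin_form :: "('a set \<Rightarrow> real) \<Rightarrow> 'a set_poly" where
  "lin_form a = (\<Sum>F\<in>X. const (a F) * var F)"

lemma var_prod_Cons: "var_prod (F # xs) = var F * var_prod xs"
  by (simp add: var_prod_def)

lemma mixed_degree_delta_sum:
  assumes "length as + 1 = r"
  shows "(\<Sum>F\<in>X. a F * mixed_degree (delta F # as) {}) = mixed_degree (a # as) {}"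
proof -
  have "(\<Sum>F\<in>X. a F * mixed_degree (delta F # as) {}) = mixed_degree ((\<lambda>G. \<Sum>F\<in>X. a F * delta F G) # as) {}"
    by (rule mixed_degree_sum[OF finite_proper_flats, symmetric])
  also have "\<dots> = mixed_degree (a # as) {}"
  proof (rule mixed_degree_cong[OF face_empty])
    fix G assume "G \<in> X"
    then have "(\<Sum>F\<in>X. a F * delta F G) = (\<Sum>F\<in>X. if F = G then a G else 0)"
      by (intro sum.cong refl) (auto simp: delta_def)
    then show "(\<Sum>F\<in>X. a F * delta F G) = a G" using \<open>G \<in> X\<close> finite_proper_flats by simp
  qed
  finally show ?thesis .
qed

text \<open>Expanding a linear form trades it for variables, so the induction carries a list xs of
  variables along. Multilinearity then reassembles a from its values times
  \<open>delta F\<close>.\<close>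

lemma poly_degree_lin_forms_var_prod:
  "poly_degree (prod_list (map lin_form as) * var_prod xs) =
    (if length as + length xs = r then mixed_degree (as @ map delta xs) {} else 0)"
proof (induction as arbitrary: xs)
  case Nil
  then show ?case by (simp add: poly_degree_var_prod)
next
  case (Cons a as)
  have "prod_list (map lin_form (a # as)) * var_prod xs =
      (\<Sum>F\<in>X. const (a F) * (prod_list (map lin_form as) * var_prod (F # xs)))"
    unfolding list.map prod_list.Cons lin_form_def[of a] sum_distrib_right
    by (intro sum.cong refl) (simp add: var_prod_Cons mult_ac)
  then have eq: "poly_degree (prod_list (map lin_form (a # as)) * var_prod xs) =
      (\<Sum>F\<in>X. a F * (if length as + Suc (length xs) = r then mixed_degree (as @ delta F # map delta xs) {} else 0))"
    by (simp add: poly_degree_sum poly_degree_const Cons.IH cong: if_cong)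
  show ?case
  proof (cases "length as + Suc (length xs) = r")
    case True
    have "(\<Sum>F\<in>X. a F * mixed_degree (as @ delta F # map delta xs) {}) =
        (\<Sum>F\<in>X. a F * mixed_degree (delta F # as @ map delta xs) {})"
      using True face_empty by (intro sum.cong refl arg_cong2[where f = "(*)"] mixed_degree_move) auto
    also have "\<dots> = mixed_degree (a # as @ map delta xs) {}"
      using True by (intro mixed_degree_delta_sum) auto
    finally show ?thesis unfolding eq using True by simp
  next
    case False
    then show ?thesis unfolding eq by simp
  qed
qed

lemma poly_degree_lin_forms:
  "length as = r \<Longrightarrow> poly_degree (prod_list (map lin_form as)) = mixed_degree as {}"
  using poly_degree_lin_forms_var_prod[of as "[]"] by (simp add: var_prod_def)

lemma poly_degree_mult_0I:
  assumes "\<And>xs. poly_degree (var_prod xs * p) = 0"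
  shows "poly_degree (q * p) = 0"
proof -
  have "q * p = (\<Sum>m\<in>Poly_Mapping.keys q. const (Poly_Mapping.lookup q m) * (Poly_Mapping.single m 1 * p))"
    by (subst poly_sum_monomials[of q]) (simp add: sum_distrib_right mult.assoc)
  moreover have "poly_degree (Poly_Mapping.single m 1 * p) = 0" for m
    using ex_monomial_of[of m] assms by (auto simp: var_prod_eq)
  ultimately show ?thesis by (simp add: poly_degree_sum poly_degree_const)
qed

lemma mixed_degree_delta:
  assumes "F \<in> link \<tau>"
  shows "mixed_degree (delta F # as) \<tau> = mixed_degree as (insert F \<tau>)"
proof -
  have "lin_part \<tau> (delta F) G = 0" for G
    using link_notin[OF assms] by (auto simp: lin_part_def delta_def intro!: sum.neutral)
  then have "mixed_degree (delta F # as) \<tau> = (\<Sum>G\<in>link \<tau>. if G = F then mixed_degree as (insert F \<tau>) else 0)"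
    by (auto simp: delta_def intro!: sum.cong)
  then show ?thesis using assms by simp
qed

lemma mixed_degree_delta_notin:
  assumes "F \<notin> link \<tau>" "F \<notin> \<tau>"
  shows "mixed_degree (delta F # as) \<tau> = 0"
proof -
  have "lin_part \<tau> (delta F) G = 0" for G
    using assms by (auto simp: lin_part_def delta_def intro!: sum.neutral)
  then show ?thesis using assms by (auto simp: delta_def intro!: sum.neutral)
qed

text \<open>Once the factor of F is expanded, the degree lives on the face {F}, whose link contains
  only flats comparable to F. If F is not a proper flat, the first expansion already gives
  0.\<close>

lemma poly_degree_incomparable:
  assumes "\<not> F \<subseteq> G" "\<not> G \<subseteq> F"
  shows "poly_degree (q * (var F * var G)) = 0"
proof (rule poly_degree_mult_0I)
  fix xs
  have "mixed_degree (delta F # delta G # map delta xs) {} = 0"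
  proof (cases "F \<in> link {}")
    case True
    have "G \<notin> link {F}" "G \<noteq> F" using assms by (auto simp: link_eq_chain_link chain_link_iff)
    then show ?thesis using mixed_degree_delta[OF True] mixed_degree_delta_notin[of G "{F}"]
      by (simp del: mixed_degree.simps)
  next
    case False
    then show ?thesis by (simp add: mixed_degree_delta_notin del: mixed_degree.simps)
  qed
  moreover have "var_prod xs * (var F * var G) = var_prod (F # G # xs)"
    by (simp add: var_prod_Cons mult_ac)
  ultimately show "poly_degree (var_prod xs * (var F * var G)) = 0"
    by (simp add: poly_degree_var_prod del: mixed_degree.simps)
qed

lemma poly_degree_modular:
  assumes "a \<in> modular_functions"
  shows "poly_degree (q * lin_form a) = 0"
proof (rule poly_degree_mult_0I)
  fix xs
  show "poly_degree (var_prod xs * lin_form a) = 0"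
    using poly_degree_lin_forms_var_prod[of "[a]" xs] mixed_degree_Lin[OF face_empty _ assms, of "map delta xs"]
    by (simp add: mult.commute del: mixed_degree.simps)
qed

lemma linear_relation:
  "(\<Sum>F | F \<in> X \<and> i \<in> F. var F) - (\<Sum>F | F \<in> X \<and> j \<in> F. var F) =
    lin_form (\<lambda>F. of_bool (i \<in> F) - of_bool (j \<in> F))"
proof -
  have c: "const (s - t) = const s - const t" for s t :: real by (simp add: const_def single_diff)
  have "(\<Sum>F | F \<in> X \<and> i \<in> F. var F) = (\<Sum>F\<in>X. const (of_bool (i \<in> F)) * var F)" for i
    using finite_proper_flats
    by (intro sum.mono_neutral_cong_left) (auto simp: const_1 const_def)
  then show ?thesis by (simp add: lin_form_def c left_diff_distrib sum_subtractf)
qed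

end

section \<open>The degree map of the Chow ring\<close>

lemma monomial_of_append: "monomial_of (xs @ ys) = monomial_of xs + monomial_of ys"
  by (simp add: monomial_of_def)

lemma total_degree_add: "total_degree (m + m') = total_degree m + total_degree m'"
proof -
  obtain xs ys where "monomial_of xs = m" "monomial_of ys = m'" using ex_monomial_of by metis
  then show ?thesis using total_degree_monomial_of[of "xs @ ys"]
    by (auto simp: total_degree_monomial_of monomial_of_append)
qed

context rank_matroid
begin

abbreviation "R \<equiv> flat_poly_ring M"

section \<open>Grading and ideal of the Chow ring\<close>

definition homogeneous :: "nat \<Rightarrow> 'a set_poly set" where
  "homogeneous d = {p \<in> carrier R. \<forall>m\<in>Poly_Mapping.keys p. total_degree m = d}"

lemma ring_simps [simp]:
  "p \<otimes>\<^bsub>R\<^esub> q = p * q" "p \<oplus>\<^bsub>R\<^esub> q = p + q" "\<one>\<^bsub>R\<^esub> = 1" "\<zero>\<^bsub>R\<^esub> = 0"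
  by (simp_all add: flat_poly_ring_def)

lemma carrier_iff: "p \<in> carrier R \<longleftrightarrow> (\<forall>m\<in>Poly_Mapping.keys p. Poly_Mapping.keys m \<subseteq> X)"
  by (simp add: flat_poly_ring_def)

lemma carrier_add: "p \<in> carrier R \<Longrightarrow> q \<in> carrier R \<Longrightarrow> p + q \<in> carrier R"
  using keys_add[of p q] unfolding carrier_iff by blast

lemma carrier_mult:
  assumes "p \<in> carrier R" "q \<in> carrier R"
  shows "p * q \<in> carrier R"
  unfolding carrier_iff
proof
  fix m assume "m \<in> Poly_Mapping.keys (p * q)"
  then obtain a b where "m = a + b" "a \<in> Poly_Mapping.keys p" "b \<in> Poly_Mapping.keys q"
    using keys_mult[of p q] by blast
  then show "Poly_Mapping.keys m \<subseteq> X"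
    using keys_add[of a b] assms unfolding carrier_iff by blast
qed

lemma carrier_const: "const t \<in> carrier R"
  by (simp add: carrier_iff const_def)

lemma carrier_0: "0 \<in> carrier R" by (simp add: carrier_iff)

lemma carrier_1: "1 \<in> carrier R" by (simp add: carrier_iff)

lemma uminus_eq_const_mult: "- p = const (- 1) * p"
  by (rule poly_mapping_eqI) (simp add: const_mult_lookup)

lemma carrier_uminus: "p \<in> carrier R \<Longrightarrow> - p \<in> carrier R"
  unfolding uminus_eq_const_mult by (intro carrier_mult carrier_const)

lemma carrier_var: "F \<in> X \<Longrightarrow> var F \<in> carrier R"
  by (simp add: carrier_iff var_def)

lemma flat_poly_cring: "cring R"
proof (rule cringI)
  show "abelian_group R"
  proof (rule abelian_groupI)
    show "\<exists>y\<in>carrier R. y \<oplus>\<^bsub>R\<^esub> x = \<zero>\<^bsub>R\<^esub>" if "x \<in> carrier R" for x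
      using carrier_uminus[OF that] by (intro bexI[of _ "- x"]) auto
  qed (auto simp: carrier_add carrier_0 add_ac)
  show "Group.comm_monoid R"
    by (rule comm_monoidI) (auto simp: carrier_mult carrier_1 mult_ac)
qed (simp add: distrib_right)

lemma homogeneous_carrier: "p \<in> homogeneous d \<Longrightarrow> p \<in> carrier R"
  by (simp add: homogeneous_def)

lemma homogeneous_0: "0 \<in> homogeneous d"
  by (simp add: homogeneous_def carrier_0)

lemma homogeneous_add: "p \<in> homogeneous d \<Longrightarrow> q \<in> homogeneous d \<Longrightarrow> p + q \<in> homogeneous d"
  using keys_add[of p q] carrier_add[of p q] unfolding homogeneous_def by blast

lemma homogeneous_mult: "p \<in> homogeneous d \<Longrightarrow> q \<in> homogeneous e \<Longrightarrow> p * q \<in> homogeneous (d + e)"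
  using keys_mult[of p q] carrier_mult[of p q] by (auto simp: homogeneous_def total_degree_add dest!: subsetD)

lemma homogeneous_const: "const t \<in> homogeneous 0"
  unfolding homogeneous_def using carrier_const by (simp add: const_def total_degree_def)

lemma homogeneous_scale: "p \<in> homogeneous d \<Longrightarrow> const t * p \<in> homogeneous d"
  using homogeneous_mult[OF homogeneous_const] by simp

lemma homogeneous_sum: "(\<And>x. x \<in> A \<Longrightarrow> f x \<in> homogeneous d) \<Longrightarrow> (\<Sum>x\<in>A. f x) \<in> homogeneous d"
  by (induction A rule: infinite_finite_induct) (auto intro: homogeneous_add homogeneous_0)

lemma homogeneous_var: "F \<in> X \<Longrightarrow> var F \<in> homogeneous 1"
  unfolding homogeneous_def using carrier_var[of F] by (simp add: var_def total_degree_def)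

lemma homogeneous_one: "1 \<in> homogeneous 0"
  using homogeneous_const[of 1] by (simp add: const_1)

lemma homogeneous_prod_list: "(\<And>p. p \<in> set ps \<Longrightarrow> p \<in> homogeneous 1) \<Longrightarrow> prod_list ps \<in> homogeneous (length ps)"
proof (induction ps)
  case (Cons p ps)
  then show ?case using homogeneous_mult[of p 1 "prod_list ps" "length ps"] by simp
qed (simp add: homogeneous_one)

lemma homogeneous_var_prod: "set xs \<subseteq> X \<Longrightarrow> var_prod xs \<in> homogeneous (length xs)"
  using homogeneous_prod_list[of "map var xs"] homogeneous_var by (auto simp: var_prod_def)

lemma homogeneous_lin_form: "lin_form a \<in> homogeneous 1"
  unfolding lin_form_def by (intro homogeneous_sum homogeneous_scale homogeneous_var)

definition relations :: "'a set_poly set" where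
  "relations = {var F * var G | F G. F \<in> X \<and> G \<in> X \<and> \<not> F \<subseteq> G \<and> \<not> G \<subseteq> F} \<union>
     {lin_form (\<lambda>F. of_bool (i \<in> F) - of_bool (j \<in> F)) | i j. i \<in> E \<and> j \<in> E}"

lemma chow_ideal_eq: "chow_ideal M = Idl\<^bsub>R\<^esub> relations"
  unfolding chow_ideal_def relations_def linear_relation ..

lemma relations_carrier: "relations \<subseteq> carrier R"
  using homogeneous_lin_form homogeneous_carrier carrier_mult carrier_var unfolding relations_def by blast

lemma ideal_chow: "ideal (chow_ideal M) R"
  unfolding chow_ideal_eq using relations_carrier flat_poly_cring
  by (intro ring.genideal_ideal cring.axioms(1))

lemma relations_chow: "relations \<subseteq> chow_ideal M"
  unfolding chow_ideal_eq using relations_carrier flat_poly_cring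
  by (intro ring.genideal_self cring.axioms(1))

lemma chow_ideal_add: "p \<in> chow_ideal M \<Longrightarrow> q \<in> chow_ideal M \<Longrightarrow> p + q \<in> chow_ideal M"
  using additive_subgroup.a_closed[OF ideal.axioms(1)[OF ideal_chow]] by simp

lemma chow_ideal_mult: "p \<in> chow_ideal M \<Longrightarrow> q \<in> carrier R \<Longrightarrow> q * p \<in> chow_ideal M"
  using ideal.I_l_closed[OF ideal_chow] by simp

lemma chow_ideal_0: "0 \<in> chow_ideal M"
  using additive_subgroup.zero_closed[OF ideal.axioms(1)[OF ideal_chow]] by simp

text \<open>The polynomials all of whose multiples have degree 0 form an ideal, and it contains the
  generators. Quantifying over multiples is what gives closure under multiplication.\<close>

lemma poly_degree_chow_ideal:
  assumes "p \<in> chow_ideal M"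
  shows "poly_degree p = 0"
proof -
  interpret R: cring R by (rule flat_poly_cring)
  define J where "J = {p \<in> carrier R. \<forall>q. poly_degree (q * p) = 0}"
  have neg: "\<ominus>\<^bsub>R\<^esub> p = - p" if "p \<in> carrier R" for p
    using R.minus_equality[of "- p" p] that carrier_uminus by simp
  have "subgroup J (add_monoid R)"
  proof
    show "inv\<^bsub>add_monoid R\<^esub> p \<in> J" if "p \<in> J" for p
    proof -
      have p: "p \<in> carrier R" "\<And>q. poly_degree (q * p) = 0" using that by (auto simp: J_def)
      have "poly_degree (q * (- p)) = 0" for q
        using p(2)[of "- q"] by simp
      then show ?thesis using neg[OF p(1)] carrier_uminus[OF p(1)] by (simp add: a_inv_def J_def)
    qed
  qed (auto simp: J_def carrier_add carrier_0 distrib_left poly_degree_add poly_degree_zero)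
  then have "ideal J R"
  proof (rule idealI[OF R.ring_axioms])
    show "x \<otimes>\<^bsub>R\<^esub> a \<in> J" if "a \<in> J" "x \<in> carrier R" for a x
      using that carrier_mult by (auto simp: J_def simp flip: mult.assoc)
    then show "a \<otimes>\<^bsub>R\<^esub> x \<in> J" if "a \<in> J" "x \<in> carrier R" for a x
      using that by (simp add: mult.commute)
  qed
  moreover have "poly_degree (q * x) = 0" if "x \<in> relations" for x q
    using that poly_degree_incomparable poly_degree_modular[OF indicator_diff_modular]
    unfolding relations_def by blast
  then have "relations \<subseteq> J" using relations_carrier by (auto simp: J_def)
  ultimately have "chow_ideal M \<subseteq> J" unfolding chow_ideal_eq by (rule R.genideal_minimal)
  then have "poly_degree (1 * p) = 0" using assms unfolding J_def by blast
  then show ?thesis by simp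
qed

lemma chow_class_eq: "chow_class M p = {h + p | h. h \<in> chow_ideal M}"
  unfolding chow_class_def a_r_coset_def' by auto

lemma chow_class_self: "p \<in> chow_class M p"
  unfolding chow_class_eq using chow_ideal_0 by force

lemma chow_class_cong:
  assumes "p - q \<in> chow_ideal M"
  shows "chow_class M p = chow_class M q"
proof -
  have neg: "q - p \<in> chow_ideal M"
    using chow_ideal_mult[OF assms carrier_const, of "- 1"] uminus_eq_const_mult[of "p - q"] by simp
  have "h + p = (h + (p - q)) + q" "h + q = (h + (q - p)) + p" for h by simp_all
  then show ?thesis unfolding chow_class_eq using chow_ideal_add assms neg by blast
qed

lemma chow_class_hom:
  assumes "p \<in> carrier R" "q \<in> carrier R"
  shows "chow_class M (p + q) = chow_class M p \<oplus>\<^bsub>chow_ring M\<^esub> chow_class M q"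
    "chow_class M (p * q) = chow_class M p \<otimes>\<^bsub>chow_ring M\<^esub> chow_class M q"
  using ring_hom_memE[OF ideal.rcos_ring_hom[OF ideal_chow]] assms
  unfolding chow_class_def chow_ring_def by (metis ring_simps(1,2))+

lemma chow_class_closed: "p \<in> carrier R \<Longrightarrow> chow_class M p \<in> carrier (chow_ring M)"
  using ring_hom_memE(1)[OF ideal.rcos_ring_hom[OF ideal_chow]]
  unfolding chow_class_def chow_ring_def by simp

lemma chow_class_one: "chow_class M 1 = \<one>\<^bsub>chow_ring M\<^esub>"
  using ring_hom_memE(4)[OF ideal.rcos_ring_hom[OF ideal_chow]]
  unfolding chow_class_def chow_ring_def by simp

lemma chow_graded_eq: "chow_graded M d = chow_class M ` homogeneous d"
  unfolding chow_graded_def homogeneous_def ..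

text \<open>The chosen representative need not be homogeneous. Since \<open>poly_degree\<close>
  vanishes on the ideal, it still gives the value of a homogeneous one.\<close>

definition degree_map :: "'a set_poly set \<Rightarrow> real" where
  "degree_map = restrict (\<lambda>c. poly_degree (SOME p. p \<in> c)) (chow_graded M r)"

lemma degree_map_class:
  assumes "p \<in> homogeneous r"
  shows "degree_map (chow_class M p) = poly_degree p"
proof -
  have "(SOME q. q \<in> chow_class M p) \<in> chow_class M p" using chow_class_self by (rule someI)
  then obtain h where "h \<in> chow_ideal M" "(SOME q. q \<in> chow_class M p) = h + p" by (auto simp: chow_class_eq)
  then show ?thesis using assms
    by (simp add: degree_map_def chow_graded_eq poly_degree_add poly_degree_chow_ideal)
qed

lemma mixed_degree_flag:
  assumes "chain (\<tau> \<union> set Fs)" "distinct Fs" "\<tau> \<inter> set Fs = {}"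
  shows "mixed_degree (map delta Fs) \<tau> = 1"
  using assms
proof (induction Fs arbitrary: \<tau>)
  case (Cons F Fs)
  have "F \<in> link \<tau>" using Cons.prems chain_mono[OF Cons.prems(1), of "insert F \<tau>"] by (auto simp: link_def)
  moreover have "mixed_degree (map delta Fs) (insert F \<tau>) = 1"
    using Cons.prems by (intro Cons.IH) (auto simp: Un_commute)
  ultimately show ?case using mixed_degree_delta by simp
qed simp

lemma complete_flagD:
  assumes "is_complete_flag M Fs"
  shows "length Fs = r" "set Fs \<subseteq> X" "distinct Fs" "chain (set Fs)"
proof -
  show 1: "length Fs = r" "set Fs \<subseteq> X" using assms rank by (auto simp: is_complete_flag_def)
  have s: "sorted_wrt (\<subset>) Fs" using assms by (simp add: is_complete_flag_def)
  then show "distinct Fs" by (auto simp: sorted_wrt_iff_nth_less distinct_conv_nth) (metis linorder_neqE_nat psubset_eq)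
  have "F \<subseteq> G \<or> G \<subseteq> F" if FG: "F \<in> set Fs" "G \<in> set Fs" for F G
  proof -
    obtain i j where ij: "i < length Fs" "j < length Fs" "F = Fs ! i" "G = Fs ! j"
      using FG by (metis in_set_conv_nth)
    consider "i < j" | "i = j" | "j < i" by linarith
    then show ?thesis
    proof cases
      case 1
      then show ?thesis using s ij unfolding sorted_wrt_iff_nth_less by blast
    next
      case 2
      then show ?thesis using ij by simp
    next
      case 3
      then show ?thesis using s ij unfolding sorted_wrt_iff_nth_less by blast
    qed
  qed
  then show "chain (set Fs)" using 1 unfolding chain_def by blast
qed

lemma is_degree_map: "is_degree_map M degree_map"
proof -
  have r: "rank M - 1 = r" using rank by simp
  have "degree_map (a \<oplus>\<^bsub>chow_ring M\<^esub> b) = degree_map a + degree_map b"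
    if "a \<in> chow_graded M r" "b \<in> chow_graded M r" for a b
  proof -
    obtain p q where "p \<in> homogeneous r" "q \<in> homogeneous r" "a = chow_class M p" "b = chow_class M q"
      using \<open>a \<in> _\<close> \<open>b \<in> _\<close> by (auto simp: chow_graded_eq)
    then show ?thesis
      by (simp add: chow_class_hom(1)[symmetric] homogeneous_carrier degree_map_class homogeneous_add poly_degree_add)
  qed
  moreover have "degree_map (chow_class M (const t) \<otimes>\<^bsub>chow_ring M\<^esub> a) = t * degree_map a"
    if "a \<in> chow_graded M r" for t a
  proof -
    obtain p where "p \<in> homogeneous r" "a = chow_class M p"
      using \<open>a \<in> _\<close> by (auto simp: chow_graded_eq)
    then show ?thesis
      by (simp add: chow_class_hom(2)[symmetric] carrier_const homogeneous_carrier degree_map_class homogeneous_scale poly_degree_const)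
  qed
  moreover have "degree_map (chow_class M (prod_list (map var Fs))) = 1" if "is_complete_flag M Fs" for Fs
  proof -
    note f = complete_flagD[OF that]
    have "poly_degree (var_prod Fs) = 1"
      using poly_degree_var_prod[of Fs] mixed_degree_flag[of "{}" Fs] f by simp
    then show ?thesis using degree_map_class[of "var_prod Fs"] homogeneous_var_prod[of Fs] f
      by (simp add: var_prod_def)
  qed
  ultimately show ?thesis unfolding is_degree_map_def r degree_map_def by auto
qed

section \<open>Uniqueness of the degree map\<close>

lemma chain_complete_flag:
  assumes "chain (set Fs)" "distinct Fs" "length Fs = r"
  shows "\<exists>Gs. mset Gs = mset Fs \<and> is_complete_flag M Gs"
proof -
  define Gs where "Gs = sort_key rk Fs"
  have m: "mset Gs = mset Fs" by (simp add: Gs_def)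
  have st: "set Gs = set Fs" "length Gs = length Fs" "distinct Gs" using assms by (auto simp: Gs_def)
  have "sorted (map rk Gs)" by (simp add: Gs_def)
  have "Gs ! i \<subset> Gs ! j" if "i < j" "j < length Gs" for i j
  proof -
    have "rk (Gs ! i) \<le> rk (Gs ! j)"
      using \<open>sorted (map rk Gs)\<close> that sorted_nth_mono[of "map rk Gs" i j] by simp
    moreover have "Gs ! i \<in> ext (set Fs)" "Gs ! j \<in> ext (set Fs)"
      using that st(1) nth_mem[of i Gs] nth_mem[of j Gs] by (auto simp: ext_def)
    ultimately have "Gs ! i \<subseteq> Gs ! j" using ext_rk_le[OF assms(1)] by blast
    moreover have "Gs ! i \<noteq> Gs ! j" using that st(3) by (simp add: nth_eq_iff_index_eq)
    ultimately show ?thesis by blast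
  qed
  then have "is_complete_flag M Gs"
    using assms st rank by (auto simp: is_complete_flag_def sorted_wrt_iff_nth_less chain_def)
  then show ?thesis using m by blast
qed

lemma var_prod_perm: "mset xs = mset ys \<Longrightarrow> var_prod xs = var_prod ys"
  by (simp add: var_prod_eq monomial_of_eq_iff[symmetric])

text \<open>The difference \<Delta> of the two maps is linear and vanishes on the ideal, so it
  suffices to treat monomials of degree r. In \<open>mono\<close> such a monomial is split into a
  flag Fs and remaining variables ys, which are absorbed into the flag one at a time; on complete
  flags both maps are 1.\<close>

lemma degree_map_unique:
  assumes d: "is_degree_map M d"
  shows "d = degree_map"
proof -
  have r: "rank M - 1 = r" using rank by simp
  have d_ext: "d \<in> extensional (chow_graded M r)"
    and d_add: "\<And>a b. a \<in> chow_graded M r \<Longrightarrow> b \<in> chow_graded M r \<Longrightarrow> d (a \<oplus>\<^bsub>chow_ring M\<^esub> b) = d a + d b"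
    and d_scale: "\<And>t a. a \<in> chow_graded M r \<Longrightarrow> d (chow_class M (const t) \<otimes>\<^bsub>chow_ring M\<^esub> a) = t * d a"
    and d_flag: "\<And>Fs. is_complete_flag M Fs \<Longrightarrow> d (chow_class M (var_prod Fs)) = 1"
    using d unfolding is_degree_map_def r var_prod_def by auto
  define \<Delta> where "\<Delta> = (\<lambda>p. d (chow_class M p) - poly_degree p)"
  have cls: "chow_class M p \<in> chow_graded M r" if "p \<in> homogeneous r" for p
    using that by (simp add: chow_graded_eq)
  have add: "\<Delta> (p + q) = \<Delta> p + \<Delta> q" if "p \<in> homogeneous r" "q \<in> homogeneous r" for p q
    using d_add[OF cls cls, OF that] that
    by (simp add: \<Delta>_def chow_class_hom(1) homogeneous_carrier poly_degree_add)
  have scale: "\<Delta> (const t * p) = t * \<Delta> p" if "p \<in> homogeneous r" for t p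
    using d_scale[OF cls, OF that] that
    by (simp add: \<Delta>_def chow_class_hom(2) carrier_const homogeneous_carrier poly_degree_const right_diff_distrib)
  have zero: "\<Delta> 0 = 0" using scale[OF homogeneous_0, of 0] by simp
  have idl: "\<Delta> p = 0" if "p \<in> chow_ideal M" for p
    using chow_class_cong[of p 0] that zero by (simp add: \<Delta>_def poly_degree_chow_ideal poly_degree_zero)
  have sum: "\<Delta> (\<Sum>x\<in>A. f x) = (\<Sum>x\<in>A. \<Delta> (f x))" if "\<And>x. x \<in> A \<Longrightarrow> f x \<in> homogeneous r"
    for A :: "'a set set" and f
    using that by (induction A rule: infinite_finite_induct) (auto simp: zero add homogeneous_sum)
  have sum': "\<Delta> (\<Sum>x\<in>A. f x) = (\<Sum>x\<in>A. \<Delta> (f x))" if "\<And>x. x \<in> A \<Longrightarrow> f x \<in> homogeneous r"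
    for A :: "('a set \<Rightarrow>\<^sub>0 nat) set" and f
    using that by (induction A rule: infinite_finite_induct) (auto simp: zero add homogeneous_sum)
  have mono: "\<Delta> (var_prod (Fs @ ys)) = 0"
    if "chain (set Fs)" "distinct Fs" "set ys \<subseteq> X" "length Fs + length ys = r" for Fs ys
    using that
  proof (induction ys arbitrary: Fs)
    case Nil
    then obtain Gs where Gs: "mset Gs = mset Fs" "is_complete_flag M Gs" using chain_complete_flag[of Fs] by auto
    have "poly_degree (var_prod Fs) = 1"
      using Nil poly_degree_var_prod[of Fs] mixed_degree_flag[of "{}" Fs] by simp
    then show ?case using d_flag[OF Gs(2)] var_prod_perm[OF Gs(1)] by (simp add: \<Delta>_def)
  next
    case (Cons F ys)
    have X: "F \<in> X" "set ys \<subseteq> X" "set Fs \<subseteq> X" using Cons.prems by (auto simp: chain_def)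
    \<comment> \<open>A variable outside the flag either extends it, so that the induction applies,
      or is incomparable to a member, so that the monomial lies in the ideal.\<close>
    have new: "\<Delta> (var_prod (Fs @ G # ys)) = 0" if G: "G \<in> X" "G \<notin> set Fs" for G
    proof (cases "chain (insert G (set Fs))")
      case True
      have "\<Delta> (var_prod ((G # Fs) @ ys)) = 0"
        using True G Cons.prems X by (intro Cons.IH) auto
      then show ?thesis using var_prod_perm[of "Fs @ G # ys" "(G # Fs) @ ys"] by simp
    next
      case False
      then obtain H where H: "H \<in> set Fs" "\<not> G \<subseteq> H" "\<not> H \<subseteq> G"
        using G Cons.prems(1) by (auto simp: chain_insert_iff)
      obtain us vs where Fs: "Fs = us @ H # vs" using split_list[OF H(1)] by blast
      have "var G * var H \<in> chow_ideal M"
        using relations_chow G H X unfolding relations_def by blast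
      moreover have "var_prod (us @ vs @ ys) \<in> carrier R"
        using X homogeneous_var_prod[of "us @ vs @ ys", THEN homogeneous_carrier] by (auto simp: Fs)
      ultimately have "var_prod (us @ vs @ ys) * (var G * var H) \<in> chow_ideal M" by (rule chow_ideal_mult)
      moreover have "var_prod (Fs @ G # ys) = var_prod (us @ vs @ ys) * (var G * var H)"
        using var_prod_perm[of "Fs @ G # ys" "G # H # us @ vs @ ys"] by (simp add: Fs var_prod_Cons mult_ac)
      ultimately show ?thesis using idl by simp
    qed
    show ?case
    proof (cases "F \<in> set Fs")
      case False
      then show ?thesis using new X by blast
    next
      case True
      \<comment> \<open>A repeated variable F is eliminated by the linear relation with coefficient
        1 at F and 0 at the other members of the flag. The remaining variables of the relation lie
        outside the flag and are covered by \<open>new\<close>.\<close>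
      obtain i j where ij: "i \<in> E" "j \<in> E"
        and sep: "\<forall>G\<in>set Fs. of_bool (i \<in> G) - of_bool (j \<in> G) = (of_bool (G = F) :: real)"
        using flag_separation[OF Cons.prems(1) True] by blast
      define l where "l = (\<lambda>G. of_bool (i \<in> G) - of_bool (j \<in> G) :: real)"
      have "lin_form l \<in> chow_ideal M" using relations_chow ij unfolding relations_def l_def by blast
      moreover have "var_prod (Fs @ ys) \<in> carrier R"
        using X homogeneous_var_prod[of "Fs @ ys", THEN homogeneous_carrier] by auto
      ultimately have "\<Delta> (var_prod (Fs @ ys) * lin_form l) = 0" by (intro idl chow_ideal_mult)
      moreover have "var_prod (Fs @ ys) * lin_form l = (\<Sum>G\<in>X. const (l G) * var_prod (Fs @ G # ys))"
      proof -
        have "var_prod (Fs @ G # ys) = var G * var_prod (Fs @ ys)" for G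
          using var_prod_perm[of "Fs @ G # ys" "G # Fs @ ys"] by (simp add: var_prod_Cons)
        then show ?thesis by (simp add: lin_form_def sum_distrib_left mult_ac)
      qed
      moreover have hom: "var_prod (Fs @ G # ys) \<in> homogeneous r" if "G \<in> X" for G
        using homogeneous_var_prod[of "Fs @ G # ys"] that X Cons.prems(4) by simp
      ultimately have "(\<Sum>G\<in>X. l G * \<Delta> (var_prod (Fs @ G # ys))) = 0"
        by (simp add: sum homogeneous_scale scale)
      moreover have "(\<Sum>G\<in>X. l G * \<Delta> (var_prod (Fs @ G # ys))) = (\<Sum>G\<in>X. if G = F then \<Delta> (var_prod (Fs @ F # ys)) else 0)"
      proof (intro sum.cong refl)
        fix G assume "G \<in> X"
        then show "l G * \<Delta> (var_prod (Fs @ G # ys)) = (if G = F then \<Delta> (var_prod (Fs @ F # ys)) else 0)"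
          using new[of G] sep True by (cases "G \<in> set Fs") (auto simp: l_def)
      qed
      ultimately show ?thesis using X finite_proper_flats by simp
    qed
  qed
  have "\<Delta> p = 0" if p: "p \<in> homogeneous r" for p
  proof -
    have m: "Poly_Mapping.single m 1 \<in> homogeneous r \<and> \<Delta> (Poly_Mapping.single m 1) = 0"
      if "m \<in> Poly_Mapping.keys p" for m
    proof -
      obtain xs where xs: "monomial_of xs = m" using ex_monomial_of by blast
      have "set xs \<subseteq> X" "length xs = r"
        using p that xs keys_monomial_of[of xs] total_degree_monomial_of[of xs]
        by (auto simp: homogeneous_def carrier_iff)
      then show ?thesis using homogeneous_var_prod[of xs] mono[of "[]" xs] face_empty
        by (auto simp: var_prod_eq xs)
    qed
    have "\<Delta> p = \<Delta> (\<Sum>m\<in>Poly_Mapping.keys p. const (Poly_Mapping.lookup p m) * Poly_Mapping.single m 1)"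
      using poly_sum_monomials[of p] by simp
    also have "\<dots> = 0" using m by (subst sum') (auto simp: homogeneous_scale scale)
    finally show ?thesis .
  qed
  then have "d c = degree_map c" if "c \<in> chow_graded M r" for c
    using that degree_map_class by (auto simp: chow_graded_eq \<Delta>_def)
  moreover have "degree_map \<in> extensional (chow_graded M r)" by (simp add: degree_map_def)
  ultimately show ?thesis using d_ext by (intro extensionalityI)
qed

lemma chow_degree_class: "p \<in> homogeneous r \<Longrightarrow> chow_degree M (chow_class M p) = poly_degree p"
proof -
  have "chow_degree M = degree_map"
    unfolding chow_degree_def using is_degree_map degree_map_unique by (intro the_equality)
  then show "p \<in> homogeneous r \<Longrightarrow> ?thesis" by (simp add: degree_map_class)
qed

end

section \<open>Hypersimplex classes\<close>

lemma prod_power_eq_prod_list: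
  fixes g :: "'k \<Rightarrow> 'b :: comm_monoid_mult"
  assumes "distinct ks"
  shows "(\<Prod>k\<in>set ks. g k ^ c k) = prod_list (map g (concat (map (\<lambda>k. replicate (c k) k) ks)))"
  using assms by (induction ks) auto

context rank_matroid
begin

lemma hypersimplex_class_eq: "hypersimplex_class M k = chow_class M (lin_form (hypersimplex_fun k))"
proof -
  have "(\<Sum>S | S \<noteq> {} \<and> S \<subset> E. const (hypersimplex_fun k S) * flat_var M S) = lin_form (hypersimplex_fun k)"
    unfolding lin_form_def
  proof (rule sum.mono_neutral_cong_right)
    show "finite {S. S \<noteq> {} \<and> S \<subset> E}" by (rule finite_subset[of _ "Pow E"]) (auto simp: finite_E)
    show "X \<subseteq> {S. S \<noteq> {} \<and> S \<subset> E}" using flat_subset by (auto simp: proper_flats_def)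
  qed (auto simp: flat_var_def)
  then show ?thesis by (simp add: hypersimplex_class_def hypersimplex_fun_def)
qed

lemma chow_cring: "cring (chow_ring M)"
  unfolding chow_ring_def by (rule ideal.quotient_is_cring[OF ideal_chow flat_poly_cring])

lemma carrier_power: "p \<in> carrier R \<Longrightarrow> p ^ k \<in> carrier R"
  by (induction k) (auto simp: carrier_1 carrier_mult)

lemma carrier_prod: "(\<And>k. k \<in> A \<Longrightarrow> f k \<in> carrier R) \<Longrightarrow> (\<Prod>k\<in>A. f k) \<in> carrier R"
  by (induction A rule: infinite_finite_induct) (auto simp: carrier_1 carrier_mult)

lemma chow_class_power:
  assumes "p \<in> carrier R"
  shows "chow_class M p [^]\<^bsub>chow_ring M\<^esub> k = chow_class M (p ^ k)"
proof -
  interpret Q: cring "chow_ring M" by (rule chow_cring)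
  show ?thesis
    by (induction k) (simp_all add: chow_class_one chow_class_hom assms carrier_power chow_class_closed Q.m_comm)
qed

lemma chow_class_prod:
  assumes "finite A" "\<And>k. k \<in> A \<Longrightarrow> f k \<in> carrier R"
  shows "(\<Otimes>\<^bsub>chow_ring M\<^esub>k\<in>A. chow_class M (f k)) = chow_class M (\<Prod>k\<in>A. f k)"
proof -
  interpret Q: cring "chow_ring M" by (rule chow_cring)
  show ?thesis using assms
  proof (induction A rule: finite_induct)
    case empty
    then show ?case by (simp add: chow_class_one)
  next
    case (insert k A)
    then show ?case by (subst Q.finprod_insert) (auto simp: chow_class_hom chow_class_closed carrier_prod)
  qed
qed

end

theorem theorem2p5:
  fixes n r i j :: nat and M :: "nat matroid" and c :: "nat \<Rightarrow> nat"
  defines "\<gamma> \<equiv> hypersimplex_class M"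
  defines "P \<equiv> (\<Otimes>\<^bsub>chow_ring M\<^esub>k\<in>{1..n}. \<gamma> k [^]\<^bsub>chow_ring M\<^esub> c k)"
  assumes "is_matroid M" and "ground M = {0..n}" and "loopless M" and "rank M = r + 1"
    and "(\<Sum>k=1..n. c k) + 2 = r"
    and "i \<in> {1..n}" and "j \<in> {1..n}"
  shows "chow_degree M (P \<otimes>\<^bsub>chow_ring M\<^esub> \<gamma> i [^]\<^bsub>chow_ring M\<^esub> (2::nat)) *
         chow_degree M (P \<otimes>\<^bsub>chow_ring M\<^esub> \<gamma> j [^]\<^bsub>chow_ring M\<^esub> (2::nat))
         \<le> (chow_degree M (P \<otimes>\<^bsub>chow_ring M\<^esub> \<gamma> i \<otimes>\<^bsub>chow_ring M\<^esub> \<gamma> j))\<^sup>2"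
proof -
  interpret rank_matroid M r by unfold_locales (use assms in auto)
  interpret Q: cring "chow_ring M" by (rule chow_cring)
  let ?f = hypersimplex_fun
  \<comment> \<open>Each index k is repeated c k times, so that the product of powers becomes a list
    of r - 2 factors.\<close>
  define ks where "ks = concat (map (\<lambda>k. replicate (c k) k) [1..<Suc n])"
  define as where "as = map ?f ks"
  have "length as = sum c (set [1..<Suc n])"
    unfolding as_def ks_def length_map length_concat by (simp add: comp_def sum_list_distinct_conv_sum_set del: upt_Suc)
  then have len: "length as + 2 = r"
    using assms(7) by (simp add: atLeastLessThanSuc_atLeastAtMost del: upt_Suc)
  have ks: "set ks \<subseteq> {1..n}" by (auto simp: ks_def)
  have lin: "lin_form a \<in> carrier R" for a using homogeneous_lin_form homogeneous_carrier by blast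
  have g: "\<gamma> k = chow_class M (lin_form (?f k))" for k
    unfolding \<gamma>_def by (rule hypersimplex_class_eq)
  have gC: "\<gamma> k \<in> carrier (chow_ring M)" for k unfolding g by (rule chow_class_closed[OF lin])
  have "P = chow_class M (\<Prod>k\<in>{1..n}. lin_form (?f k) ^ c k)"
    unfolding P_def g using lin by (simp add: chow_class_power chow_class_prod carrier_power)
  also have "(\<Prod>k\<in>{1..n}. lin_form (?f k) ^ c k) = (\<Prod>k\<in>set [1..<Suc n]. lin_form (?f k) ^ c k)"
    by (intro prod.cong) auto
  also have "\<dots> = prod_list (map lin_form as)"
    by (subst prod_power_eq_prod_list) (simp_all add: as_def ks_def comp_def del: upt_Suc)
  finally have P: "P = chow_class M (prod_list (map lin_form as))" .
  have asC: "prod_list (map lin_form as) \<in> carrier R"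
    using homogeneous_prod_list[of "map lin_form as"] homogeneous_lin_form homogeneous_carrier by auto
  have deg: "chow_degree M (P \<otimes>\<^bsub>chow_ring M\<^esub> (\<gamma> k \<otimes>\<^bsub>chow_ring M\<^esub> \<gamma> l)) = mixed_degree (?f k # ?f l # as) {}" for k l
  proof -
    let ?as = "as @ [?f k, ?f l]"
    have "P \<otimes>\<^bsub>chow_ring M\<^esub> (\<gamma> k \<otimes>\<^bsub>chow_ring M\<^esub> \<gamma> l) = chow_class M (prod_list (map lin_form ?as))"
      unfolding P g using lin asC by (simp add: chow_class_hom(2) carrier_mult)
    moreover have "prod_list (map lin_form ?as) \<in> homogeneous r"
      using homogeneous_prod_list[of "map lin_form ?as"] homogeneous_lin_form len by auto
    ultimately have "chow_degree M (P \<otimes>\<^bsub>chow_ring M\<^esub> (\<gamma> k \<otimes>\<^bsub>chow_ring M\<^esub> \<gamma> l)) = mixed_degree ?as {}"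
      using poly_degree_lin_forms[of ?as] len by (simp add: chow_degree_class del: mixed_degree.simps)
    also have "\<dots> = mixed_degree (?f k # ?f l # as) {}"
      using face_empty len by (intro mixed_degree_perm) auto
    finally show ?thesis .
  qed
  have sq: "\<gamma> k [^]\<^bsub>chow_ring M\<^esub> (2::nat) = \<gamma> k \<otimes>\<^bsub>chow_ring M\<^esub> \<gamma> k" for k
    using gC by (simp add: numeral_2_eq_2)
  have PC: "P \<in> carrier (chow_ring M)" unfolding P by (rule chow_class_closed[OF asC])
  have "mixed_degree (?f i # ?f i # as) {} * mixed_degree (?f j # ?f j # as) {}
      \<le> (mixed_degree (?f i # ?f j # as) {})\<^sup>2"
  \<comment> \<open>A single perturbing function, card F times the size of the complement of F,
    makes every factor ample at once.\<close>
  proof (rule hodge_index_nef[where h = "\<lambda>F. real (card F) * (real (card E) - real (card F))"])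
    show "ample (\<lambda>F. a F + \<epsilon> * (real (card F) * (real (card E) - real (card F))))"
      if \<epsilon>: "\<epsilon> > 0" and a: "a \<in> set (?f i # as)" for \<epsilon> a
    proof -
      obtain k where "a = ?f k" "k \<in> {1..n}" using a ks assms(8) by (auto simp: as_def)
      then show ?thesis using ample_hypersimplex_perturb[of k \<epsilon>] \<epsilon> assms(4) by simp
    qed
  qed (use len face_empty in auto)
  then show ?thesis unfolding sq deg using deg[of i j] PC gC by (simp add: Q.m_assoc)
qed

end
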